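(* There exists a universal constant $C > 0$ such that the following holds. Let $K \subset \mathbb{R}^n$ be a centrally symmetric convex body with associated norm $\|\cdot\|$, let $k_0$ be a real number with $1 \le k_0 < n$, and let $k$ be a positive integer with $k < k_0/4$. Then $$\left( \int_{G_{n,k}} \operatorname{diam}(K \cap E)^k \, d\mu(E) \right)^{1/k} \le C\, M(K) \left( \int_{S^{n-1}} \|x\|^{-k_0} \, d\sigma(x) \right)^{2/k_0}.$$
   Context: A centrally symmetric convex body $K \subset \mathbb{R}^n$ is a compact convex set with nonempty interior and $K=-K$; $\|\cdot\|$ denotes the norm on $\mathbb{R}^n$ whose unit ball is $K$. $S^{n-1}$ is the Euclidean unit sphere of $\mathbb{R}^n$, $\sigma$ is the rotation invariant probability measure on it, and $M(K) = \int_{S^{n-1}} \|x\|\, d\sigma(x)$. $G_{n,k}$ is the Grassmannian of $k$-dimensional linear subspaces of $\mathbb{R}^n$, and $\mu$ is the unique rotation invariant probability measure on it. $\operatorname{diam}$ is the Euclidean diameter. A universal constant does not depend on $n$, $K$, $k$ or $k_0$. *)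

theory Defs
  imports "HOL-Probability.Probability"
begin

text \<open>
  The dimension \<open>n\<close> is quantified inside the scope of the universal constant, so it cannot be
  carried by a type.  All the spaces \<open>R^n\<close> are therefore realised as the coordinate subspaces of
  one inner product space, the finitely supported real sequences with the standard inner product.
\<close>

typedef finseq = "{f :: nat \<Rightarrow> real. finite {i. f i \<noteq> 0}}"
  morphisms coord Abs_finseq
  by (rule exI[of _ "\<lambda>_. 0"]) simp

lemma finite_support: "finite {i. coord x i \<noteq> 0}"
  using coord[of x] by simp

lemma coord_Abs_finseq: "finite {i. f i \<noteq> 0} \<Longrightarrow> coord (Abs_finseq f) = f"
  by (simp add: Abs_finseq_inverse)

lemma finseq_eq_iff: "x = y \<longleftrightarrow> (\<forall>i. coord x i = coord y i)"
  by (metis coord_inject ext)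

instantiation finseq :: real_vector
begin

definition "0 = Abs_finseq (\<lambda>_. 0)"
definition "x + y = Abs_finseq (\<lambda>i. coord x i + coord y i)"
definition "x - y = Abs_finseq (\<lambda>i. coord x i - coord y i)"
definition "- x = Abs_finseq (\<lambda>i. - coord x i)"
definition "scaleR c x = Abs_finseq (\<lambda>i. c * coord x i)"

lemma coord_simps [simp]:
  "coord 0 i = 0"
  "coord (x + y) i = coord x i + coord y i"
  "coord (x - y) i = coord x i - coord y i"
  "coord (- x) i = - coord x i"
  "coord (c *\<^sub>R x) i = c * coord x i"
proof -
  have fin: "finite {i. coord x i \<noteq> 0 \<or> coord y i \<noteq> 0}"
    using finite_UnI[OF finite_support[of x] finite_support[of y]] by (simp only: Collect_disj_eq)
  have "finite {i. coord x i + coord y i \<noteq> 0}" "finite {i. coord x i - coord y i \<noteq> 0}"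
    by (rule finite_subset[OF _ fin]; auto)+
  moreover have "finite {i. - coord x i \<noteq> 0}" "finite {i. c * coord x i \<noteq> 0}"
    by (rule finite_subset[OF _ finite_support[of x]]; auto)+
  ultimately show "coord 0 i = 0"
    "coord (x + y) i = coord x i + coord y i"
    "coord (x - y) i = coord x i - coord y i"
    "coord (- x) i = - coord x i"
    "coord (c *\<^sub>R x) i = c * coord x i"
    by (simp_all add: zero_finseq_def plus_finseq_def minus_finseq_def uminus_finseq_def
        scaleR_finseq_def coord_Abs_finseq)
qed

instance
  by standard (simp_all add: finseq_eq_iff algebra_simps)

end

instantiation finseq :: real_inner
begin

definition "inner x y = (\<Sum>i | coord x i \<noteq> 0. coord x i * coord y i)"
definition "norm (x::finseq) = sqrt (inner x x)"
definition "dist (x::finseq) y = norm (x - y)"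
definition "sgn (x::finseq) = x /\<^sub>R norm x"
definition "uniformity = (INF e\<in>{0<..}. principal {(x::finseq, y). dist x y < e})"
definition "open (U :: finseq set) \<longleftrightarrow> (\<forall>x\<in>U. \<forall>\<^sub>F (x', y) in uniformity. x' = x \<longrightarrow> y \<in> U)"

lemma inner_finseq_sum:
  assumes "finite A" "{i. coord x i \<noteq> 0} \<subseteq> A"
  shows "inner x y = (\<Sum>i\<in>A. coord x i * coord y i)"
  unfolding inner_finseq_def using assms by (intro sum.mono_neutral_left) auto

instance
proof
  fix x y z :: finseq and c :: real
  let ?A = "{i. coord x i \<noteq> 0} \<union> {i. coord y i \<noteq> 0}"
  have fin: "finite ?A"
    using finite_support by simp
  have x: "inner x w = (\<Sum>i\<in>?A. coord x i * coord w i)" for w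
    by (rule inner_finseq_sum[OF fin]) auto
  have y: "inner y w = (\<Sum>i\<in>?A. coord y i * coord w i)" for w
    by (rule inner_finseq_sum[OF fin]) auto
  have xy: "inner (x + y) w = (\<Sum>i\<in>?A. coord (x + y) i * coord w i)" for w
    by (rule inner_finseq_sum[OF fin]) auto
  have cx: "inner (c *\<^sub>R x) w = (\<Sum>i\<in>?A. coord (c *\<^sub>R x) i * coord w i)" for w
    by (rule inner_finseq_sum[OF fin]) auto
  show "inner x y = inner y x"
    by (simp add: x y mult.commute)
  show "inner (x + y) z = inner x z + inner y z"
    by (simp add: x y xy sum.distrib[symmetric] algebra_simps)
  show "inner (c *\<^sub>R x) y = c * inner x y"
    by (simp add: x cx sum_distrib_left mult.assoc)
  show "0 \<le> inner x x"
    by (simp add: inner_finseq_def sum_nonneg)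
  show "inner x x = 0 \<longleftrightarrow> x = 0"
    by (auto simp: inner_finseq_def finseq_eq_iff finite_support sum_nonneg_eq_0_iff)
qed (simp_all add: norm_finseq_def dist_finseq_def sgn_finseq_def uniformity_finseq_def
    open_finseq_def)

end

definition Rn :: "nat \<Rightarrow> finseq set" where
  "Rn n = {x. \<forall>i\<ge>n. coord x i = 0}"

lemma inner_Rn: "x \<in> Rn n \<Longrightarrow> inner x y = (\<Sum>i<n. coord x i * coord y i)"
  by (rule inner_finseq_sum) (auto simp: Rn_def not_le[symmetric])

definition symmetric_convex_body :: "nat \<Rightarrow> finseq set \<Rightarrow> bool" where
  "symmetric_convex_body n K \<longleftrightarrow>
     K \<subseteq> Rn n \<and> compact K \<and> convex K \<and> uminus ` K = K \<and>
     top_of_set (Rn n) interior_of K \<noteq> {}"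

text \<open>The norm on \<open>R^n\<close> with unit ball \<open>K\<close>, as the Minkowski functional of \<open>K\<close>.\<close>

definition body_norm :: "finseq set \<Rightarrow> finseq \<Rightarrow> real" where
  "body_norm K x = Inf {t. 0 < t \<and> x \<in> (\<lambda>y. t *\<^sub>R y) ` K}"

text \<open>
  The orthogonal group of \<open>R^n\<close>.  The maps act on the whole sequence space, but only their
  restriction to \<open>Rn n\<close> is ever used; every linear isometry of \<open>Rn n\<close> arises in this way, being
  extendable by the identity on the orthogonal complement.
\<close>

definition rotations :: "nat \<Rightarrow> (finseq \<Rightarrow> finseq) set" where
  "rotations n = {T. orthogonal_transformation T \<and> T ` Rn n = Rn n}"

definition unit_sphere :: "nat \<Rightarrow> finseq set" where
  "unit_sphere n = sphere 0 1 \<inter> Rn n"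

definition invariant_sphere_measure :: "nat \<Rightarrow> finseq measure \<Rightarrow> bool" where
  "invariant_sphere_measure n \<sigma> \<longleftrightarrow>
     prob_space \<sigma> \<and> sets \<sigma> = sets (restrict_space borel (unit_sphere n)) \<and>
     (\<forall>T\<in>rotations n. distr \<sigma> \<sigma> T = \<sigma>)"

definition grassmannian :: "nat \<Rightarrow> nat \<Rightarrow> finseq set set" where
  "grassmannian n k = {E. subspace E \<and> E \<subseteq> Rn n \<and> dim E = k}"

definition orth_proj :: "finseq set \<Rightarrow> finseq \<Rightarrow> finseq" where
  "orth_proj E x = (THE p. p \<in> E \<and> (\<forall>y\<in>E. orthogonal (x - p) y))"

text \<open>
  The gap metric; it induces the usual topology of the Grassmannian.  The absolute value has no
  effect on subspaces of some \<open>Rn n\<close>; it is there because \<open>Metric_space\<close> asks for nonnegativity also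
  outside the carrier.
\<close>

definition gap :: "finseq set \<Rightarrow> finseq set \<Rightarrow> real" where
  "gap E F = \<bar>onorm (\<lambda>x. orth_proj E x - orth_proj F x)\<bar>"

definition invariant_grassmannian_measure :: "nat \<Rightarrow> nat \<Rightarrow> finseq set measure \<Rightarrow> bool" where
  "invariant_grassmannian_measure n k \<mu> \<longleftrightarrow>
     prob_space \<mu> \<and>
     sets \<mu> = sets (sigma (grassmannian n k)
                     {U. openin (Metric_space.mtopology (grassmannian n k) gap) U}) \<and>
     (\<forall>T\<in>rotations n. distr \<mu> \<mu> (image T) = \<mu>)"

subsection \<open>The gap is a metric\<close>

lemma ex_proj_span:
  assumes "finite B"
  shows "\<exists>p\<in>span B. \<forall>y\<in>span B. orthogonal ((x::finseq) - p) y"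
  using assms
proof (induction B arbitrary: x rule: finite_induct)
  case empty
  then show ?case by (auto simp: orthogonal_def)
next
  case (insert b B)
  obtain q where q: "q \<in> span B" "\<And>y. y \<in> span B \<Longrightarrow> orthogonal (b - q) y"
    using insert.IH[of b] by blast
  obtain p where p: "p \<in> span B" "\<And>y. y \<in> span B \<Longrightarrow> orthogonal (x - p) y"
    using insert.IH[of x] by blast
  define d where "d = b - q"
  define r where "r = p + (inner x d / inner d d) *\<^sub>R d"
  have sub: "span B \<subseteq> span (insert b B)"
    by (intro span_mono) auto
  have dspan: "d \<in> span (insert b B)"
    unfolding d_def by (intro span_diff span_base subsetD[OF sub q(1)]) simp
  have "r \<in> span (insert b B)"
    unfolding r_def by (intro span_add span_scale dspan subsetD[OF sub p(1)])
  moreover have "orthogonal (x - r) y" if "y \<in> span (insert b B)" for y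
  proof -
    obtain c where c: "y - c *\<^sub>R b \<in> span B"
      using \<open>y \<in> span (insert b B)\<close> by (auto simp: span_insert)
    define z where "z = y - c *\<^sub>R d"
    have z: "z \<in> span B"
    proof -
      have "z = (y - c *\<^sub>R b) + c *\<^sub>R q"
        by (simp add: z_def d_def algebra_simps)
      then show ?thesis
        by (simp add: span_add[OF c span_scale[OF q(1)]])
    qed
    have "inner d z = 0" "inner (x - p) z = 0" "inner d p = 0"
      using q(2)[OF z] q(2)[OF p(1)] p(2)[OF z] by (simp_all add: d_def orthogonal_def)
    have inner_xd: "inner p d = 0"
      using \<open>inner d p = 0\<close> by (simp add: inner_commute)
    have "inner (x - r) d = 0"
      by (cases "d = 0") (simp_all add: r_def inner_diff_left inner_add_left inner_xd)
    moreover have "inner (x - r) z = 0"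
      using \<open>inner d z = 0\<close> \<open>inner (x - p) z = 0\<close>
      by (simp add: r_def inner_diff_left inner_add_left)
    ultimately have "inner (x - r) (z + c *\<^sub>R d) = 0"
      by (simp add: inner_add_right)
    then show ?thesis
      by (simp add: z_def orthogonal_def)
  qed
  ultimately show ?case by blast
qed

lemma subspace_Rn: "subspace (Rn n)"
  by (auto simp: subspace_def Rn_def)

lemma finite_span_Rn: "\<exists>B. finite B \<and> Rn n = span B"
proof -
  define e where "e j = Abs_finseq (\<lambda>i. if i = j then 1 else 0)" for j :: nat
  have e: "coord (e j) i = (if i = j then 1 else 0)" for i j
    by (simp add: e_def coord_Abs_finseq)
  have coord_sum: "coord (\<Sum>j\<in>A. c j *\<^sub>R e j) i = (\<Sum>j\<in>A. c j * (if i = j then 1 else 0))"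
    if "finite A" for A c i
    using that by (induction A rule: finite_induct) (auto simp: e)
  have "x \<in> span (e ` {..<n})" if "x \<in> Rn n" for x
  proof -
    have "x = (\<Sum>j<n. coord x j *\<^sub>R e j)"
    proof -
      have "coord (\<Sum>j<n. coord x j *\<^sub>R e j) i = coord x i" for i
      proof -
        have "coord (\<Sum>j<n. coord x j *\<^sub>R e j) i = (\<Sum>j<n. if i = j then coord x j else 0)"
          unfolding coord_sum[OF finite_lessThan] by (intro sum.cong) simp_all
        also have "\<dots> = coord x i"
          using that by (simp add: Rn_def)
        finally show ?thesis .
      qed
      then show ?thesis
        by (simp add: finseq_eq_iff)
    qed
    also have "\<dots> \<in> span (e ` {..<n})"
      by (intro span_sum span_scale span_base) auto
    finally show ?thesis .
  qed
  moreover have "span (e ` {..<n}) \<subseteq> Rn n"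
  proof (rule span_minimal[OF _ subspace_Rn])
    show "e ` {..<n} \<subseteq> Rn n"
      by (auto simp: Rn_def e)
  qed
  ultimately show ?thesis
    by (meson finite_imageI finite_lessThan subsetI subset_antisym)
qed

lemma grassmannian_finite_span:
  assumes "E \<in> grassmannian n k"
  shows "\<exists>B. finite B \<and> E = span B"
proof -
  obtain B0 where B0: "finite B0" "Rn n = span B0"
    using finite_span_Rn by blast
  obtain B where B: "B \<subseteq> E" "independent B" "E \<subseteq> span B" "card B = dim E"
    by (rule basis_exists)
  have "B \<subseteq> span B0"
    using B(1) assms B0 by (auto simp: grassmannian_def)
  then have "finite B"
    using independent_span_bound[OF B0(1) B(2)] by blast
  moreover have "span B \<subseteq> E"
    using B(1) assms by (intro span_minimal) (auto simp: grassmannian_def)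
  ultimately show ?thesis
    using B(3) by blast
qed

lemma orth_proj_unique:
  assumes "subspace E" "p \<in> E" "\<And>y. y \<in> E \<Longrightarrow> orthogonal (x - p) y"
  shows "orth_proj E x = p"
  unfolding orth_proj_def
proof (rule the_equality)
  fix q assume q: "q \<in> E \<and> (\<forall>y\<in>E. orthogonal (x - q) y)"
  then have "q - p \<in> E"
    using assms by (auto intro: subspace_diff)
  then have "inner (x - p) (q - p) = 0" "inner (x - q) (q - p) = 0"
    using assms q by (auto simp: orthogonal_def)
  then have "inner (q - p) (q - p) = 0"
    by (simp add: inner_diff_left inner_diff_right)
  then show "q = p" by simp
qed (use assms in auto)

lemma orth_proj:
  assumes "E \<in> grassmannian n k"
  shows "orth_proj E x \<in> E" "y \<in> E \<Longrightarrow> orthogonal (x - orth_proj E x) y"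
proof -
  have sE: "subspace E"
    using assms by (simp add: grassmannian_def)
  obtain p where p: "p \<in> E" "\<And>y. y \<in> E \<Longrightarrow> orthogonal (x - p) y"
    using grassmannian_finite_span[OF assms] ex_proj_span[of _ x] by metis
  have "orth_proj E x = p"
    by (rule orth_proj_unique[OF sE p])
  with p show "orth_proj E x \<in> E" "y \<in> E \<Longrightarrow> orthogonal (x - orth_proj E x) y"
    by auto
qed

lemma bounded_linear_orth_proj:
  assumes E: "E \<in> grassmannian n k"
  shows "bounded_linear (orth_proj E)"
proof (rule bounded_linear_intro[where K = 1])
  have sE: "subspace E"
    using assms by (simp add: grassmannian_def)
  note P = orth_proj[OF E, unfolded orthogonal_def]
  show "orth_proj E (x + y) = orth_proj E x + orth_proj E y" for x y
  proof (intro orth_proj_unique[OF sE] subspace_add[OF sE] P(1))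
    fix z assume "z \<in> E"
    from P(2)[OF this, of x] P(2)[OF this, of y]
    show "orthogonal (x + y - (orth_proj E x + orth_proj E y)) z"
      unfolding orthogonal_def by (simp add: inner_diff_left inner_add_left)
  qed
  show "orth_proj E (c *\<^sub>R x) = c *\<^sub>R orth_proj E x" for c x
  proof (intro orth_proj_unique[OF sE] subspace_scale[OF sE] P(1))
    fix z assume "z \<in> E"
    from P(2)[OF this, of x] show "orthogonal (c *\<^sub>R x - c *\<^sub>R orth_proj E x) z"
      unfolding orthogonal_def by (simp add: inner_diff_left)
  qed
  show "norm (orth_proj E x) \<le> norm x * 1" for x
  proof -
    have "inner (orth_proj E x) (orth_proj E x) = inner x (orth_proj E x)"
      using P(2)[OF P(1)[of x], of x] by (simp add: inner_diff_left)
    also have "\<dots> \<le> norm x * norm (orth_proj E x)"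
      by (rule norm_cauchy_schwarz)
    finally have "norm (orth_proj E x) * norm (orth_proj E x) \<le> norm x * norm (orth_proj E x)"
      by (simp add: power2_norm_eq_inner[symmetric] power2_eq_square)
    then show ?thesis
      by (cases "orth_proj E x = 0") auto
  qed
qed

lemma gap_grassmannian:
  assumes "E \<in> grassmannian n k" "F \<in> grassmannian n k"
  shows "gap E F = onorm (\<lambda>x. orth_proj E x - orth_proj F x)"
    and "bounded_linear (\<lambda>x. orth_proj E x - orth_proj F x)"
proof -
  show "bounded_linear (\<lambda>x. orth_proj E x - orth_proj F x)"
    using assms by (intro bounded_linear_sub bounded_linear_orth_proj)
  then show "gap E F = onorm (\<lambda>x. orth_proj E x - orth_proj F x)"
    unfolding gap_def by (simp add: onorm_pos_le)
qed

lemma range_orth_proj: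
  assumes "E \<in> grassmannian n k"
  shows "range (orth_proj E) = E"
proof -
  have "orth_proj E x = x" if "x \<in> E" for x
    using that assms by (intro orth_proj_unique) (auto simp: grassmannian_def orthogonal_def)
  then show ?thesis
    using orth_proj(1)[OF assms] by (metis image_subset_iff rangeI subsetI subset_antisym)
qed

lemma Metric_space_gap: "Metric_space (grassmannian n k) gap"
proof
  show "0 \<le> gap E F" for E F
    by (simp add: gap_def)
  show "gap E F = gap F E" for E F
    by (simp add: gap_def onorm_def norm_minus_commute)
  show "gap E F = 0 \<longleftrightarrow> E = F" if "E \<in> grassmannian n k" "F \<in> grassmannian n k" for E F
  proof
    assume "gap E F = 0"
    then have "orth_proj E = orth_proj F"
      using gap_grassmannian[OF that] by (auto simp: onorm_eq_0)
    then show "E = F"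
      using range_orth_proj that by metis
  next
    assume "E = F"
    then show "gap E F = 0"
      by (simp add: gap_def onorm_zero)
  qed
  show "gap E H \<le> gap E F + gap F H"
    if E: "E \<in> grassmannian n k" and F: "F \<in> grassmannian n k" and H: "H \<in> grassmannian n k"
    for E F H
    using onorm_triangle[OF gap_grassmannian(2)[OF E F] gap_grassmannian(2)[OF F H]]
    by (simp add: gap_grassmannian(1)[OF E F] gap_grassmannian(1)[OF F H]
        gap_grassmannian(1)[OF E H])
qed

end

theory Submission
  imports Defs
begin

text \<open>
  The constant is \<open>C = 16\<close>. Write \<open>N\<close> for the norm of \<open>K\<close>, \<open>M\<close> for its mean on the sphere,
  \<open>S\<close> for the mean of \<open>N powr (- k0)\<close>, and let \<open>r\<close> be the largest Euclidean norm of a point of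
  \<open>K \<inter> E\<close>, so that the diameter of the section is \<open>2 * r\<close>.

  Inside one section, convexity and symmetry give a lower bound for a moment of the body
  \<open>B = K \<inter> E\<close>. If \<open>x0\<close> is a farthest point, then \<open>(x0 + b) / 2\<close> and \<open>(x0 - b) / 2\<close> lie in \<open>B\<close>
  for each \<open>b\<close> in \<open>B\<close>, and one of them has norm at least \<open>r / 2\<close>. Hence the integral of
  \<open>norm x ^ (2 * k)\<close> over \<open>B\<close> is at least \<open>r ^ (2 * k)\<close> times the volume of \<open>B\<close>, up to a factor
  exponential in \<open>k\<close> (\<open>unit_ball_moment_ge\<close>). In polar coordinates both quantities are averages over
  the unit sphere of \<open>E\<close>: in units of the volume of the Euclidean ball, the volume of \<open>B\<close> is the
  average \<open>V\<close> of \<open>N powr (- k)\<close>, and the moment is at most the average \<open>Q\<close> of \<open>N powr (- 3 * k)\<close>, so \<open>r ^ (2 * k) \<le> 2 * 8 ^ k * Q / V\<close>.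

  The factor \<open>1 / V\<close> is bounded by the average \<open>Y\<close> of the product \<open>N u1 * ... * N uk\<close> over all
  orthonormal bases of \<open>E\<close>: this is the inequality of arithmetic and geometric means followed by the
  Cauchy-Schwarz inequality (\<open>haar_inverse_power_ge\<close>). The gain is that such a product can be
  averaged over \<open>E\<close> one vector at a time. Given the other vectors, the next one is uniform on the
  sphere of a subspace of dimension at least \<open>n / 2\<close>, and there the mean of \<open>N\<close> is at most \<open>2 * M\<close>,
  because projecting a vector onto a subspace does not increase the mean of \<open>N\<close>
  (\<open>haar_norm_le_sphere\<close>, \<open>haar_prod_norm_le\<close>). So \<open>Y\<close> has mean at most \<open>(2 * M) ^ k\<close>, while \<open>Q\<close>
  has mean equal to the mean of \<open>N powr (- 3 * k)\<close> over the whole sphere.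

  Since \<open>r ^ k\<close> is at most \<open>sqrt (2 * 8 ^ k * Q * Y)\<close>, the inequality of Cauchy and Schwarz bounds
  the mean of \<open>r ^ k\<close> by the square root of the product of these means. As \<open>3 * k < k0\<close>, the mean of
  \<open>N powr (- 3 * k)\<close> is at most \<open>S powr (3 * k / k0)\<close>, and one arrives at
  \<open>sqrt M * S powr (3 / (2 * k0))\<close> up to a constant. This is at most \<open>M * S powr (2 / k0)\<close>, because
  \<open>M * S powr (1 / k0) \<ge> 1\<close> by convexity (\<open>mean_times_negative_moment_ge_one\<close>). Working with the
  power \<open>3 * k\<close> is what makes first moments of \<open>N\<close> sufficient: no comparison between different
  positive moments of a norm enters.

  Two measures are constructed on the way. Lebesgue measure on \<open>Rn k\<close> is built one coordinate at a
  time, and its rotation invariance follows from the uniqueness of translation invariant measures.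
  Haar measure on orthonormal frames, invariant under right multiplication by rotations, is built by
  induction on the dimension from reflections. Averaging against it gives all the integral geometry:
  the sphere measure and the Grassmannian measure enter only through their invariance.
\<close>

section \<open>Coordinates\<close>

definition basis_vec :: "nat \<Rightarrow> finseq" where
  "basis_vec i = Abs_finseq (\<lambda>j. if j = i then 1 else 0)"

definition trunc :: "nat \<Rightarrow> finseq \<Rightarrow> finseq" where
  "trunc n x = (\<Sum>i<n. coord x i *\<^sub>R basis_vec i)"

lemma coord_basis_vec [simp]: "coord (basis_vec i) j = (if j = i then 1 else 0)"
  by (simp add: basis_vec_def coord_Abs_finseq)

lemma coord_sum: "coord (sum f A) i = (\<Sum>j\<in>A. coord (f j) i)"
  by (induction A rule: infinite_finite_induct) auto

lemma coord_trunc [simp]: "coord (trunc n x) i = (if i < n then coord x i else 0)"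
proof -
  have "coord (trunc n x) i = (\<Sum>j<n. if j = i then coord x i else 0)"
    unfolding trunc_def coord_sum by (intro sum.cong) auto
  then show ?thesis by simp
qed

lemma basis_vec_Rn_iff [simp]: "basis_vec i \<in> Rn n \<longleftrightarrow> i < n"
  by (auto simp: Rn_def not_le[symmetric])

lemma Rn_mono: "m \<le> n \<Longrightarrow> Rn m \<subseteq> Rn n"
  by (auto simp: Rn_def)

lemma trunc_in_Rn [simp]: "trunc n x \<in> Rn n"
  by (simp add: Rn_def)

lemma trunc_eq: "x \<in> Rn n \<Longrightarrow> trunc n x = x"
  by (simp add: finseq_eq_iff Rn_def)

lemma inner_basis_vec [simp]: "inner (basis_vec i) x = coord x i" "inner x (basis_vec i) = coord x i"
proof -
  have "inner (basis_vec i) x = (\<Sum>j\<in>{i}. coord (basis_vec i) j * coord x j)"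
    by (intro inner_finseq_sum) auto
  then show "inner (basis_vec i) x = coord x i" by simp
  then show "inner x (basis_vec i) = coord x i" by (simp add: inner_commute)
qed

lemma norm_basis_vec [simp]: "norm (basis_vec i) = 1"
  by (simp add: norm_eq_sqrt_inner)

lemma abs_coord_le_norm: "\<bar>coord x i\<bar> \<le> norm x"
  using Cauchy_Schwarz_ineq2[of "basis_vec i" x] by simp

lemma continuous_coord [continuous_intros]:
  assumes "continuous_on S f" shows "continuous_on S (\<lambda>x. coord (f x) i)"
  using continuous_on_inner[OF continuous_on_const[of S "basis_vec i"] assms] by simp

lemma closed_Rn: "closed (Rn n)"
proof -
  have "Rn n = (\<Inter>i\<in>{n..}. {x. coord x i = 0})"
    by (auto simp: Rn_def)
  then show ?thesis
    by (auto intro!: closed_INT closed_Collect_eq continuous_intros)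
qed

lemma exists_Rn: "\<exists>n. x \<in> Rn n"
proof -
  obtain n where "\<forall>i\<in>{i. coord x i \<noteq> 0}. i < n"
    using finite_nat_set_iff_bounded[of "{i. coord x i \<noteq> 0}"] finite_support by auto
  then show ?thesis by (intro exI[of _ n]) (auto simp: Rn_def not_le[symmetric])
qed

text \<open>
  Vectors with rational coordinates form a countable dense set.
\<close>

instance finseq :: second_countable_topology
proof
  define q :: "rat list \<Rightarrow> finseq" where "q xs = (\<Sum>i<length xs. of_rat (xs ! i) *\<^sub>R basis_vec i)" for xs
  define B where "B = (\<lambda>(xs, k). ball (q xs) (inverse (real (Suc k)))) ` UNIV"
  have cB: "countable B" unfolding B_def by simp
  have dense: "\<exists>xs. dist x (q xs) < \<epsilon>" if "\<epsilon> > 0" for x and \<epsilon> :: real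
  proof -
    obtain n where n: "x \<in> Rn n" using exists_Rn by blast
    define d where "d = \<epsilon> / (real n + 1)"
    have d: "d > 0" using that by (simp add: d_def)
    have "\<exists>r::rat. \<bar>coord x i - of_rat r\<bar> < d" for i
    proof -
      obtain r :: rat where "coord x i - d < of_rat r" "of_rat r < coord x i + d"
        using of_rat_dense[of "coord x i - d" "coord x i + d"] d by auto
      then show ?thesis by (intro exI[of _ r]) auto
    qed
    then obtain r :: "nat \<Rightarrow> rat" where r: "\<And>i. \<bar>coord x i - of_rat (r i)\<bar> < d" by metis
    have "x - q (map r [0..<n]) = (\<Sum>i<n. (coord x i - of_rat (r i)) *\<^sub>R basis_vec i)"
      using trunc_eq[OF n] by (simp add: q_def trunc_def scaleR_diff_left sum_subtractf)
    also have "norm \<dots> \<le> (\<Sum>i<n. \<bar>coord x i - of_rat (r i)\<bar>)"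
      by (rule order_trans[OF norm_sum]) simp
    also have "\<dots> \<le> real n * d"
      using sum_bounded_above[of "{..<n}" "\<lambda>i. \<bar>coord x i - of_rat (r i)\<bar>" d] r by (simp add: less_imp_le)
    also have "\<dots> < \<epsilon>"
      using that by (simp add: d_def field_simps)
    finally show ?thesis by (auto simp: dist_norm)
  qed
  have "topological_basis B"
  proof (rule topological_basisI)
    show "open S" if "S \<in> B" for S using that by (auto simp: B_def)
    fix O' :: "finseq set" and x assume O': "open O'" "x \<in> O'"
    then obtain \<epsilon> where \<epsilon>: "\<epsilon> > 0" "ball x \<epsilon> \<subseteq> O'" by (meson openE)
    obtain k where k: "inverse (real (Suc k)) < \<epsilon> / 2" using reals_Archimedean[of "\<epsilon> / 2"] \<epsilon> by auto
    obtain xs where xs: "dist x (q xs) < inverse (real (Suc k))" using dense[of "inverse (real (Suc k))"] by auto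
    have "ball (q xs) (inverse (real (Suc k))) \<subseteq> ball x \<epsilon>"
    proof
      fix y assume "y \<in> ball (q xs) (inverse (real (Suc k)))"
      then show "y \<in> ball x \<epsilon>"
        using dist_triangle[of x y "q xs"] xs k by (simp add: dist_commute)
    qed
    then show "\<exists>B'\<in>B. x \<in> B' \<and> B' \<subseteq> O'"
      using xs \<epsilon> by (intro bexI[of _ "ball (q xs) (inverse (real (Suc k)))"]) (auto simp: B_def dist_commute)
  qed
  then show "\<exists>B::finseq set set. countable B \<and> open = generate_topology B"
    using cB topological_basis_imp_subbasis by blast
qed

lemma borel_measurable_coord [measurable (raw)]:
  assumes "f \<in> borel_measurable M" shows "(\<lambda>x. coord (f x) i) \<in> borel_measurable M"
  using borel_measurable_inner[OF borel_measurable_const[of "basis_vec i" M] assms] by simp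

lemma Rn_borel [measurable]: "Rn n \<in> sets borel"
  by (intro borel_closed closed_Rn)

lemma borel_measurable_trunc [measurable]: "trunc n \<in> borel_measurable borel"
  unfolding trunc_def[abs_def] by measurable

lemma norm_sq_Rn: "x \<in> Rn n \<Longrightarrow> (norm x)\<^sup>2 = (\<Sum>i<n. (coord x i)\<^sup>2)"
  by (simp add: power2_norm_eq_inner inner_Rn) (simp add: power2_eq_square)

lemma linear_trunc: "linear (trunc n)"
  by (rule linearI) (simp_all add: finseq_eq_iff)

lemma norm_trunc_le: "norm (trunc n x) \<le> norm x"
proof -
  have "inner (trunc n x) (trunc n x) = (\<Sum>i<n. coord x i * coord x i)"
    by (subst inner_Rn[OF trunc_in_Rn]) auto
  also have "\<dots> = inner (trunc n x) x"
    by (subst inner_Rn[OF trunc_in_Rn]) auto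
  also have "\<dots> \<le> norm (trunc n x) * norm x" by (rule norm_cauchy_schwarz)
  finally have "norm (trunc n x) * norm (trunc n x) \<le> norm (trunc n x) * norm x"
    by (simp add: power2_norm_eq_inner[symmetric] power2_eq_square)
  then show ?thesis by (cases "trunc n x = 0") auto
qed

section \<open>Orthonormal frames and rotations\<close>

definition frames :: "nat \<Rightarrow> (nat \<Rightarrow> finseq) set" where
  "frames m = {f \<in> {..<m} \<rightarrow>\<^sub>E Rn m. \<forall>i<m. \<forall>j<m. inner (f i) (f j) = (if i = j then 1 else 0)}"

text \<open>
  The linear map that sends the first \<open>m\<close> coordinate axes to the frame \<open>f\<close> and fixes all later axes. It is
  defined on the whole sequence space, so that rotations of \<open>Rn m\<close> act on every larger \<open>Rn n\<close>.
\<close>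

definition act :: "nat \<Rightarrow> (nat \<Rightarrow> finseq) \<Rightarrow> finseq \<Rightarrow> finseq" where
  "act m f x = x + (\<Sum>i<m. coord x i *\<^sub>R (f i - basis_vec i))"

lemma rotationsD:
  assumes "T \<in> rotations n"
  shows "linear T" "inner (T x) (T y) = inner x y" "norm (T x) = norm x"
    "T (x + y) = T x + T y" "T (c *\<^sub>R x) = c *\<^sub>R T x" "T 0 = 0" "T (x - y) = T x - T y" "T (- x) = - T x"
    "x \<in> Rn n \<Longrightarrow> T x \<in> Rn n"
  using assms
  by (auto simp: rotations_def orthogonal_transformation_def linear_add linear_scale linear_0 linear_diff linear_neg
      norm_eq_sqrt_inner)

lemma rotations_preimage: "T \<in> rotations n \<Longrightarrow> y \<in> Rn n \<Longrightarrow> \<exists>x\<in>Rn n. T x = y"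
  by (force simp: rotations_def)

lemma rotations_continuous:
  assumes "T \<in> rotations n" shows "continuous_on S T"
proof -
  have "bounded_linear T"
    using assms by (intro bounded_linear_intro[where K=1]) (auto simp: rotationsD)
  then show ?thesis by (rule linear_continuous_on)
qed

lemma rotations_measurable:
  assumes "T \<in> rotations n" shows "T \<in> borel_measurable borel"
  using rotations_continuous[OF assms] by (rule borel_measurable_continuous_onI)

text \<open>
  An isometry that maps \<open>Rn n\<close> into itself maps it onto itself: otherwise adjoining a missing
  vector to the image of the basis gives \<open>n + 1\<close> independent vectors in the span of \<open>n\<close>.
\<close>

lemma rotationsI:
  assumes lin: "linear T" and inn: "\<And>x y. inner (T x) (T y) = inner x y" and sub: "\<And>x. x \<in> Rn n \<Longrightarrow> T x \<in> Rn n"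
  shows "T \<in> rotations n"
proof -
  let ?B = "basis_vec ` {..<n}" and ?C = "(\<lambda>i. T (basis_vec i)) ` {..<n}"
  have Rn_span: "Rn n \<subseteq> span ?B"
  proof
    fix x assume "x \<in> Rn n"
    then have "x = (\<Sum>i<n. coord x i *\<^sub>R basis_vec i)"
      using trunc_eq[of x n] by (simp add: trunc_def)
    also have "\<dots> \<in> span ?B"
      by (intro span_sum span_scale span_base) auto
    finally show "x \<in> span ?B" .
  qed
  have inner_C: "inner (T (basis_vec i)) (T (basis_vec j)) = (if i = j then 1 else 0)" for i j
    by (auto simp: inn)
  have inj: "inj_on (\<lambda>i. T (basis_vec i)) {..<n}"
    by (rule inj_onI) (metis inner_C zero_neq_one)
  have indep: "independent ?C"
  proof (rule pairwise_orthogonal_independent)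
    show "pairwise orthogonal ?C"
      by (auto simp: pairwise_def orthogonal_def inner_C)
    show "0 \<notin> ?C"
    proof
      assume "0 \<in> ?C"
      then obtain i where "0 = T (basis_vec i)" by auto
      then show False using inner_C[of i i] by simp
    qed
  qed
  have "y \<in> T ` Rn n" if y: "y \<in> Rn n" for y
  proof (rule ccontr)
    assume ny: "y \<notin> T ` Rn n"
    have "span ?C \<subseteq> T ` Rn n"
    proof (rule span_minimal)
      show "?C \<subseteq> T ` Rn n" by auto
      show "subspace (T ` Rn n)" by (intro linear_subspace_image lin subspace_Rn)
    qed
    then have "y \<notin> span ?C" using ny by auto
    then have ind: "independent (insert y ?C)" using indep by (simp add: independent_insert)
    have "insert y ?C \<subseteq> span ?B" using y Rn_span sub by auto
    from independent_span_bound[OF _ ind this] have "card (insert y ?C) \<le> card ?B" by simp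
    also have "\<dots> \<le> n" using card_image_le[of "{..<n}" basis_vec] by simp
    finally have "card (insert y ?C) \<le> n" .
    moreover have "y \<notin> ?C" using ny by auto
    ultimately show False using card_image[OF inj] by simp
  qed
  then show ?thesis
    using assms by (auto simp: rotations_def orthogonal_transformation_def)
qed

lemma rotations_compose: "T \<in> rotations n \<Longrightarrow> S \<in> rotations n \<Longrightarrow> (\<lambda>x. T (S x)) \<in> rotations n"
  by (rule rotationsI) (auto simp: rotationsD intro!: linearI)

lemma rotations_id: "(\<lambda>x. x) \<in> rotations n"
  by (auto simp: rotations_def)

lemma linear_act: "linear (act m f)"
  by (rule linearI) (simp_all add: act_def sum.distrib scaleR_add_left scaleR_add_right scaleR_sum_right)

lemma act_alt: "act m f x = (\<Sum>i<m. coord x i *\<^sub>R f i) + (x - trunc m x)"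
  by (simp add: act_def trunc_def scaleR_diff_right sum_subtractf)

lemma act_basis_vec: "act m f (basis_vec i) = (if i < m then f i else basis_vec i)"
proof -
  have "(\<Sum>j<m. coord (basis_vec i) j *\<^sub>R (f j - basis_vec j))
      = (\<Sum>j<m. if j = i then f i - basis_vec i else 0)"
    by (intro sum.cong) auto
  then show ?thesis by (simp add: act_def)
qed

lemma linear_eq_on_Rn:
  fixes S T :: "finseq \<Rightarrow> finseq"
  assumes "linear S" "linear T" "\<And>i. i < n \<Longrightarrow> S (basis_vec i) = T (basis_vec i)" "x \<in> Rn n"
  shows "S x = T x"
proof -
  have "U x = (\<Sum>i<n. coord x i *\<^sub>R U (basis_vec i))" if "linear U" for U :: "finseq \<Rightarrow> finseq"
    using arg_cong[OF trunc_eq[OF assms(4)], of U]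
    by (simp add: trunc_def linear_sum[OF that] linear_scale[OF that])
  from this[OF assms(1)] this[OF assms(2)] show ?thesis
    using assms(3) by simp
qed

lemma framesD:
  assumes "f \<in> frames m"
  shows "i < m \<Longrightarrow> f i \<in> Rn m" "i < m \<Longrightarrow> j < m \<Longrightarrow> inner (f i) (f j) = (if i = j then 1 else 0)"
    "i < m \<Longrightarrow> norm (f i) = 1"
  using assms by (auto simp: frames_def norm_eq_sqrt_inner)

lemma act_rotations:
  assumes f: "f \<in> frames m" and mn: "m \<le> n"
  shows "act m f \<in> rotations n"
proof (rule rotationsI)
  show "linear (act m f)" by (rule linear_act)
  have tail: "inner (f i) (x - trunc m x) = 0" if "i < m" for i x
    using framesD(1)[OF f that] by (simp add: inner_Rn)
  have tail': "inner (trunc m y) (x - trunc m x) = 0" for x y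
    by (subst inner_Rn[OF trunc_in_Rn]) auto
  fix x y
  have "inner (act m f x) (act m f y) = (\<Sum>i<m. \<Sum>j<m. coord x i * coord y j * inner (f i) (f j))
      + inner (x - trunc m x) (y - trunc m y)"
  proof -
    let ?u = "\<lambda>x. \<Sum>i<m. coord x i *\<^sub>R f i"
    have "inner (?u x) (y - trunc m y) = 0" "inner (x - trunc m x) (?u y) = 0"
      using tail by (simp_all add: inner_sum_left inner_sum_right inner_commute)
    moreover have "inner (?u x) (?u y) = (\<Sum>i<m. \<Sum>j<m. coord x i * coord y j * inner (f i) (f j))"
      unfolding inner_sum_left inner_sum_right inner_scaleR_left inner_scaleR_right
      by (subst sum.swap) (simp add: sum_distrib_left mult_ac)
    ultimately show ?thesis
      unfolding act_alt inner_add_left inner_add_right by linarith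
  qed
  also have "(\<Sum>i<m. \<Sum>j<m. coord x i * coord y j * inner (f i) (f j)) = (\<Sum>i<m. coord x i * coord y i)"
  proof (intro sum.cong refl)
    fix i assume "i \<in> {..<m}"
    then have "(\<Sum>j<m. coord x i * coord y j * inner (f i) (f j)) = (\<Sum>j<m. if j = i then coord x i * coord y i else 0)"
      by (intro sum.cong) (auto simp: framesD[OF f])
    then show "(\<Sum>j<m. coord x i * coord y j * inner (f i) (f j)) = coord x i * coord y i"
      using \<open>i \<in> _\<close> by simp
  qed
  also have "\<dots> = inner (trunc m x) (trunc m y)"
    by (subst inner_Rn[OF trunc_in_Rn]) auto
  also have "\<dots> + inner (x - trunc m x) (y - trunc m y) = inner x y"
    using tail'[of x y] tail'[of y x] by (simp add: inner_diff_left inner_diff_right inner_commute)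
  finally show "inner (act m f x) (act m f y) = inner x y" .
next
  fix x assume "x \<in> Rn n"
  moreover have "f i - basis_vec i \<in> Rn n" if "i < m" for i
    using framesD(1)[OF f that] Rn_mono[OF mn] that mn by (intro subspace_diff subspace_Rn) auto
  ultimately show "act m f x \<in> Rn n"
    unfolding act_def by (intro subspace_add subspace_sum subspace_scale subspace_Rn) auto
qed

lemma frame_of_rotation:
  assumes "T \<in> rotations m" shows "(\<lambda>i\<in>{..<m}. T (basis_vec i)) \<in> frames m"
  using assms by (auto simp: frames_def rotationsD PiE_def)

lemma act_frame_of_linear:
  assumes "linear T" "x \<in> Rn m" shows "act m (\<lambda>i\<in>{..<m}. T (basis_vec i)) x = T x"
  by (rule linear_eq_on_Rn[OF linear_act assms(1) _ assms(2)]) (simp add: act_basis_vec)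

text \<open>
  The reflection in the hyperplane orthogonal to \<open>v\<close>; division by zero makes it the identity for \<open>v = 0\<close>.
\<close>

definition reflect :: "finseq \<Rightarrow> finseq \<Rightarrow> finseq" where
  "reflect v x = x - (2 * inner v x / inner v v) *\<^sub>R v"

lemma reflect_rotations:
  assumes "v \<in> Rn n" shows "reflect v \<in> rotations n"
proof (cases "v = 0")
  case True
  then show ?thesis using rotations_id by (simp add: reflect_def[abs_def])
next
  case False
  then have vv: "inner v v \<noteq> 0" by simp
  show ?thesis
  proof (rule rotationsI)
    show "linear (reflect v)"
      by (rule linearI) (simp_all add: reflect_def inner_add_right add_divide_distrib algebra_simps)
    show "inner (reflect v x) (reflect v y) = inner x y" for x y
    proof -
      have "2 * inner v y / inner v v * (2 * inner v x / inner v v) * inner v v = 4 * inner v x * inner v y / inner v v"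
        using vv by simp
      then show ?thesis
        by (simp add: reflect_def inner_diff_left inner_diff_right inner_commute[of x v] inner_commute[of y v])
    qed
    show "reflect v x \<in> Rn n" if "x \<in> Rn n" for x
      unfolding reflect_def using that assms by (intro subspace_diff subspace_scale subspace_Rn)
  qed
qed

lemma reflect_swap:
  assumes "norm x = norm y" shows "reflect (x - y) y = x" "reflect (x - y) x = y"
proof -
  have eq: "inner x x = inner y y" using assms by (simp add: power2_norm_eq_inner[symmetric])
  have "reflect (x - y) y = x \<and> reflect (x - y) x = y"
  proof (cases "x = y")
    case True then show ?thesis by (simp add: reflect_def)
  next
    case False
    then have nz: "inner (x - y) (x - y) \<noteq> 0" by simp
    have "2 * inner (x - y) x = inner (x - y) (x - y)" "2 * inner (x - y) y = - inner (x - y) (x - y)"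
      using eq by (simp_all add: inner_diff_left inner_diff_right inner_commute)
    with nz show ?thesis by (simp add: reflect_def)
  qed
  then show "reflect (x - y) y = x" "reflect (x - y) x = y" by auto
qed

lemma reflect_orthogonal: "inner v x = 0 \<Longrightarrow> reflect v x = x"
  by (simp add: reflect_def)

lemma reflect_reflect: "reflect v (reflect v x) = x"
  by (cases "v = 0") (simp_all add: reflect_def inner_diff_right)

lemma reflect_measurable [measurable (raw)]:
  assumes "f \<in> borel_measurable M" "g \<in> borel_measurable M"
  shows "(\<lambda>x. reflect (f x) (g x)) \<in> borel_measurable M"
  unfolding reflect_def using assms by measurable

lemma rotation_to:
  assumes "x \<in> Rn n" "y \<in> Rn n" "norm x = norm y" shows "\<exists>T\<in>rotations n. T x = y"
  using reflect_swap(2)[OF assms(3)] reflect_rotations[OF subspace_diff[OF subspace_Rn assms(1,2)]] by blast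

text \<open>
  The hyperplane orthogonal to a fixed axis is mapped to itself.
\<close>

lemma rotation_pred:
  assumes T: "T \<in> rotations (Suc m)" and fixd: "T (basis_vec m) = basis_vec m"
  shows "T \<in> rotations m"
proof (rule rotationsI)
  fix x assume x: "x \<in> Rn m"
  have "coord (T x) m = inner (T x) (T (basis_vec m))" by (simp add: fixd)
  also have "\<dots> = 0" using x by (simp add: rotationsD[OF T] Rn_def del: inner_basis_vec) (simp add: inner_commute)
  finally have "coord (T x) m = 0" .
  moreover have "T x \<in> Rn (Suc m)" using x Rn_mono[of m "Suc m"] rotationsD(9)[OF T] by auto
  ultimately show "T x \<in> Rn m"
    by (auto simp: Rn_def) (metis Suc_leI le_neq_implies_less)
qed (auto simp: rotationsD[OF T])

text \<open>
  Induction over the basis: given a rotation that takes the first coordinate axes to the span of the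
  earlier vectors, a reflection that fixes these axes turns one more axis into the direction of the
  new vector, corrected by its projection.
\<close>

lemma span_rotated:
  assumes "finite B" "independent B" "B \<subseteq> Rn n"
  shows "card B \<le> n \<and> (\<exists>Q\<in>rotations n. Q ` Rn (card B) = span B)"
  using assms
proof (induction B rule: finite_induct)
  case empty
  have "Rn 0 = {0}" by (auto simp: Rn_def finseq_eq_iff)
  then show ?case using rotations_id by auto
next
  case (insert b B)
  let ?k = "card B"
  have ind: "independent B" and nb: "b \<notin> span B"
    using insert.prems insert.hyps by (auto simp: independent_insert)
  obtain Q where Q: "Q \<in> rotations n" "Q ` Rn ?k = span B" and kn: "?k \<le> n"
    using insert.IH[OF ind] insert.prems by auto
  obtain p where p: "p \<in> span B" "\<And>y. y \<in> span B \<Longrightarrow> inner (b - p) y = 0"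
    using ex_proj_span[OF insert.hyps(1), of b] by (auto simp: orthogonal_def)
  define w where "w = b - p"
  have spB: "span B \<subseteq> Rn n" using insert.prems by (intro span_minimal subspace_Rn) auto
  have w: "w \<in> Rn n" "w \<noteq> 0"
    using spB p(1) insert.prems nb by (auto simp: w_def intro!: subspace_diff subspace_Rn)
  obtain v0 where v0: "v0 \<in> Rn n" "Q v0 = w" using rotations_preimage[OF Q(1) w(1)] by auto
  have v0perp: "inner v0 y = 0" if "y \<in> Rn ?k" for y
    using p(2)[of "Q y"] that Q(2) rotationsD(2)[OF Q(1), of v0 y] by (auto simp: w_def v0(2))
  have v0nz: "v0 \<noteq> 0" using v0 w rotationsD(6)[OF Q(1)] by auto
  define v where "v = v0 /\<^sub>R norm v0"
  have v: "norm v = 1" "v \<in> Rn n" "\<And>y. y \<in> Rn ?k \<Longrightarrow> inner v y = 0"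
    using v0nz v0 v0perp by (auto simp: v_def intro!: subspace_scale subspace_Rn)
  have "?k \<noteq> n" using v(3)[of v] v(1,2) by auto
  with kn have kn': "?k < n" by simp
  define R where "R = reflect (v - basis_vec ?k)"
  have R: "R \<in> rotations n" unfolding R_def
    using kn' v by (intro reflect_rotations subspace_diff subspace_Rn) auto
  have R1: "R (basis_vec ?k) = v" unfolding R_def using v(1) by (intro reflect_swap) simp
  have R2: "R y = y" if "y \<in> Rn ?k" for y
    unfolding R_def using v(3)[OF that] that by (intro reflect_orthogonal) (simp add: inner_diff_left Rn_def)
  have QR: "Q (R (basis_vec ?k)) = w /\<^sub>R norm v0"
    by (simp add: R1 v_def rotationsD(5)[OF Q(1)] v0)
  have wsp: "w \<in> span (insert b B)"
    unfolding w_def by (intro span_diff span_base subsetD[OF span_mono p(1)]) auto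
  have sub: "span B \<subseteq> span (insert b B)" by (intro span_mono) auto
  have "(\<lambda>x. Q (R x)) ` Rn (Suc ?k) = span (insert b B)"
  proof (intro equalityI subsetI)
    fix z assume "z \<in> (\<lambda>x. Q (R x)) ` Rn (Suc ?k)"
    then obtain x where x: "x \<in> Rn (Suc ?k)" "z = Q (R x)" by auto
    have "x = trunc ?k x + coord x ?k *\<^sub>R basis_vec ?k"
      using trunc_eq[OF x(1)] by (simp add: trunc_def)
    then have "z = Q (trunc ?k x) + coord x ?k *\<^sub>R (w /\<^sub>R norm v0)"
      using x(2) by (metis QR R2 rotationsD(4,5)[OF Q(1)] rotationsD(4,5)[OF R] trunc_in_Rn)
    moreover have "Q (trunc ?k x) \<in> span B" using Q(2) trunc_in_Rn by blast
    ultimately show "z \<in> span (insert b B)"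
      using wsp sub by (auto intro!: span_add span_scale)
  next
    fix z assume "z \<in> span (insert b B)"
    then obtain c where "z - c *\<^sub>R b \<in> span B" by (auto simp: span_insert)
    then have "z - c *\<^sub>R w \<in> span B"
      using span_add[OF _ span_scale[OF p(1), of c]] by (force simp: w_def algebra_simps)
    then obtain y where y: "y \<in> Rn ?k" "z - c *\<^sub>R w = Q y" using Q(2) by (metis imageE)
    have "Q (R (y + (c * norm v0) *\<^sub>R basis_vec ?k)) = Q y + (c * norm v0) *\<^sub>R (w /\<^sub>R norm v0)"
      using QR by (simp add: rotationsD[OF R] rotationsD[OF Q(1)] R2[OF y(1)])
    also have "\<dots> = z" using y(2) v0nz by (simp add: algebra_simps)
    finally have "z = Q (R (y + (c * norm v0) *\<^sub>R basis_vec ?k))" by simp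
    moreover have "y + (c * norm v0) *\<^sub>R basis_vec ?k \<in> Rn (Suc ?k)"
      using y(1) Rn_mono[of ?k "Suc ?k"] by (intro subspace_add subspace_scale subspace_Rn) auto
    ultimately show "z \<in> (\<lambda>x. Q (R x)) ` Rn (Suc ?k)" by blast
  qed
  then show ?case
    using rotations_compose[OF Q(1) R] kn' insert.hyps by (intro conjI bexI[of _ "\<lambda>x. Q (R x)"]) auto
qed

lemma grassmannian_rotated:
  assumes "E \<in> grassmannian n k"
  shows "k \<le> n" "\<exists>Q\<in>rotations n. Q ` Rn k = E"
proof -
  have E: "subspace E" "E \<subseteq> Rn n" "dim E = k" using assms by (auto simp: grassmannian_def)
  obtain B0 where B0: "finite B0" "Rn n = span B0" using finite_span_Rn by blast
  obtain B where B: "B \<subseteq> E" "independent B" "E \<subseteq> span B" "card B = dim E"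
    by (rule basis_exists)
  have "finite B" using independent_span_bound[OF B0(1) B(2)] B(1) E B0 by auto
  moreover have "span B = E" using B E by (simp add: span_minimal subset_antisym)
  ultimately show "k \<le> n" "\<exists>Q\<in>rotations n. Q ` Rn k = E"
    using span_rotated[of B n] B E by auto
qed

section \<open>Lebesgue measure on the coordinate subspaces\<close>

lemma cball_sphere_borel [measurable]:
  "cball (a::finseq) r \<in> sets borel" "sphere (a::finseq) r \<in> sets borel"
  by (auto intro!: borel_closed closed_Collect_eq continuous_intros simp: sphere_def)

text \<open>
  Lebesgue measure on \<open>Rn k\<close>, as a measure on the ambient sequence space that is concentrated on \<open>Rn k\<close>.
\<close>

primrec lebesgue_Rn :: "nat \<Rightarrow> finseq measure" where
  "lebesgue_Rn 0 = return borel 0"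
| "lebesgue_Rn (Suc k) = distr (lebesgue_Rn k \<Otimes>\<^sub>M lborel) borel (\<lambda>(x, t). x + t *\<^sub>R basis_vec k)"

lemma sets_lebesgue_Rn [simp, measurable_cong]: "sets (lebesgue_Rn k) = sets borel"
  by (cases k) simp_all

lemma space_lebesgue_Rn [simp]: "space (lebesgue_Rn k) = UNIV"
  using sets_eq_imp_space_eq[OF sets_lebesgue_Rn[of k]] by simp

lemma nn_integral_lebesgue_Rn_Suc:
  assumes [measurable]: "F \<in> borel_measurable borel"
  shows "(\<integral>\<^sup>+x. F x \<partial>lebesgue_Rn (Suc k)) = (\<integral>\<^sup>+x. (\<integral>\<^sup>+t. F (x + t *\<^sub>R basis_vec k) \<partial>lborel) \<partial>lebesgue_Rn k)"
proof -
  have "(\<integral>\<^sup>+x. F x \<partial>lebesgue_Rn (Suc k)) = (\<integral>\<^sup>+z. F (fst z + snd z *\<^sub>R basis_vec k) \<partial>(lebesgue_Rn k \<Otimes>\<^sub>M lborel))"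
    by (simp add: nn_integral_distr split_beta')
  also have "\<dots> = (\<integral>\<^sup>+x. (\<integral>\<^sup>+t. F (x + t *\<^sub>R basis_vec k) \<partial>lborel) \<partial>lebesgue_Rn k)"
    by (subst lborel.nn_integral_fst[symmetric]) auto
  finally show ?thesis .
qed

lemma AE_lebesgue_Rn_Rn: "AE x in lebesgue_Rn k. x \<in> Rn k"
proof (induction k)
  case 0
  have "0 \<in> Rn 0" by (simp add: Rn_def)
  then show ?case by (simp only: lebesgue_Rn.simps) (subst AE_return, auto)
next
  case (Suc k)
  have "(\<integral>\<^sup>+x. indicator (- Rn (Suc k)) x \<partial>lebesgue_Rn (Suc k))
      = (\<integral>\<^sup>+x. (\<integral>\<^sup>+t. indicator (- Rn (Suc k)) (x + t *\<^sub>R basis_vec k) \<partial>lborel) \<partial>lebesgue_Rn k)"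
    by (rule nn_integral_lebesgue_Rn_Suc) simp
  also have "\<dots> = (\<integral>\<^sup>+x. 0 \<partial>lebesgue_Rn k)"
  proof (rule nn_integral_cong_AE)
    show "AE x in lebesgue_Rn k. (\<integral>\<^sup>+t. indicator (- Rn (Suc k)) (x + t *\<^sub>R basis_vec k) \<partial>lborel) = 0"
      using Suc
    proof eventually_elim
      case (elim x)
      then have "x + t *\<^sub>R basis_vec k \<in> Rn (Suc k)" for t
        using Rn_mono[of k "Suc k"] by (intro subspace_add subspace_scale subspace_Rn) auto
      then show ?case by simp
    qed
  qed
  finally have "emeasure (lebesgue_Rn (Suc k)) (- Rn (Suc k)) = 0" by simp
  then show ?case by (intro AE_I[of _ _ "- Rn (Suc k)"]) auto
qed

lemma nn_integral_lebesgue_Rn_affine: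
  assumes "F \<in> borel_measurable borel" "a \<in> Rn k" and c: "c \<noteq> 0"
  shows "(\<integral>\<^sup>+x. F x \<partial>lebesgue_Rn k) = ennreal (\<bar>c\<bar> ^ k) * (\<integral>\<^sup>+x. F (a + c *\<^sub>R x) \<partial>lebesgue_Rn k)"
  using assms(1,2)
proof (induction k arbitrary: F a)
  case 0
  then have "a = 0" by (simp add: Rn_def finseq_eq_iff)
  then show ?case using 0 by (simp add: nn_integral_return)
next
  case (Suc k)
  note [measurable] = Suc.prems(1)
  define a' where "a' = trunc k a"
  define s where "s = coord a k"
  have a: "a = a' + s *\<^sub>R basis_vec k"
    using trunc_eq[OF Suc.prems(2)] by (simp add: a'_def s_def trunc_def)
  define H where "H y = (\<integral>\<^sup>+t. F (y + t *\<^sub>R basis_vec k) \<partial>lborel)" for y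
  have H [measurable]: "H \<in> borel_measurable borel"
    unfolding H_def[abs_def] by measurable
  have Heq: "H y = ennreal \<bar>c\<bar> * (\<integral>\<^sup>+t. F (y + (s + c * t) *\<^sub>R basis_vec k) \<partial>lborel)" for y
    unfolding H_def by (rule nn_integral_real_affine[OF _ c]) measurable
  have "(\<integral>\<^sup>+x. F x \<partial>lebesgue_Rn (Suc k)) = (\<integral>\<^sup>+x. H x \<partial>lebesgue_Rn k)"
    unfolding H_def by (rule nn_integral_lebesgue_Rn_Suc) measurable
  also have "\<dots> = ennreal (\<bar>c\<bar> ^ k) * (\<integral>\<^sup>+x. H (a' + c *\<^sub>R x) \<partial>lebesgue_Rn k)"
    by (rule Suc.IH) (auto simp: a'_def)
  also have "(\<integral>\<^sup>+x. H (a' + c *\<^sub>R x) \<partial>lebesgue_Rn k)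
      = (\<integral>\<^sup>+x. ennreal \<bar>c\<bar> * (\<integral>\<^sup>+t. F (a + c *\<^sub>R (x + t *\<^sub>R basis_vec k)) \<partial>lborel) \<partial>lebesgue_Rn k)"
    unfolding Heq a by (simp add: algebra_simps)
  also have "\<dots> = ennreal \<bar>c\<bar> * (\<integral>\<^sup>+x. F (a + c *\<^sub>R x) \<partial>lebesgue_Rn (Suc k))"
    by (subst nn_integral_cmult) (auto simp: nn_integral_lebesgue_Rn_Suc simp del: lebesgue_Rn.simps)
  finally show ?case
    by (simp add: mult.assoc[symmetric] ennreal_mult'[symmetric] mult.commute)
qed

definition cube :: "nat \<Rightarrow> real \<Rightarrow> finseq set" where
  "cube k R = {x. \<forall>i<k. \<bar>coord x i\<bar> \<le> R}"

lemma cube_borel [measurable]: "cube k R \<in> sets borel"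
proof -
  have "cube k R = (\<Inter>i\<in>{..<k}. {x. \<bar>coord x i\<bar> \<le> R})" by (auto simp: cube_def)
  then show ?thesis
    by (auto intro!: borel_closed closed_INT closed_Collect_le continuous_intros)
qed

lemma emeasure_lebesgue_Rn_cube:
  assumes "R \<ge> 0" shows "emeasure (lebesgue_Rn k) (cube k R) = ennreal ((2 * R) ^ k)"
proof (induction k)
  case 0
  then show ?case by (simp add: cube_def)
next
  case (Suc k)
  have "emeasure (lebesgue_Rn (Suc k)) (cube (Suc k) R) = (\<integral>\<^sup>+x. indicator (cube (Suc k) R) x \<partial>lebesgue_Rn (Suc k))"
    by simp
  also have "\<dots> = (\<integral>\<^sup>+x. (\<integral>\<^sup>+t. indicator (cube (Suc k) R) (x + t *\<^sub>R basis_vec k) \<partial>lborel) \<partial>lebesgue_Rn k)"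
    by (rule nn_integral_lebesgue_Rn_Suc) simp
  also have "\<dots> = (\<integral>\<^sup>+x. indicator (cube k R) x * ennreal (2 * R) \<partial>lebesgue_Rn k)"
  proof (rule nn_integral_cong_AE)
    show "AE x in lebesgue_Rn k. (\<integral>\<^sup>+t. indicator (cube (Suc k) R) (x + t *\<^sub>R basis_vec k) \<partial>lborel)
        = indicator (cube k R) x * ennreal (2 * R)"
      using AE_lebesgue_Rn_Rn[of k]
    proof eventually_elim
      case (elim x)
      then have "x + t *\<^sub>R basis_vec k \<in> cube (Suc k) R \<longleftrightarrow> x \<in> cube k R \<and> t \<in> {-R..R}" for t
        by (auto simp: cube_def Rn_def less_Suc_eq)
      then have "(\<integral>\<^sup>+t. indicator (cube (Suc k) R) (x + t *\<^sub>R basis_vec k) \<partial>lborel)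
          = (\<integral>\<^sup>+t. indicator (cube k R) x * indicator {-R..R} t \<partial>lborel)"
        by (intro nn_integral_cong) (auto simp: indicator_def)
      then show ?case
        using assms by (simp add: nn_integral_cmult)
    qed
  qed
  also have "\<dots> = ennreal ((2 * R) ^ k) * ennreal (2 * R)"
    by (subst nn_integral_multc) (simp_all add: Suc)
  finally show ?case using assms by (simp add: ennreal_mult'[symmetric] mult.commute)
qed

lemma sigma_finite_lebesgue_Rn: "sigma_finite_measure (lebesgue_Rn k)"
proof
  have "x \<in> (\<Union>R::nat. cube k (real R))" for x
  proof -
    obtain R :: nat where "norm x \<le> real R" using real_arch_simple by blast
    then have "x \<in> cube k (real R)"
      using abs_coord_le_norm[of x] by (auto simp: cube_def intro: order_trans)
    then show ?thesis by blast
  qed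
  then have "(\<Union>R::nat. cube k (real R)) = UNIV" by blast
  then show "\<exists>A. countable A \<and> A \<subseteq> sets (lebesgue_Rn k) \<and> \<Union> A = space (lebesgue_Rn k) \<and> (\<forall>a\<in>A. emeasure (lebesgue_Rn k) a \<noteq> \<infinity>)"
    by (intro exI[of _ "range (\<lambda>R::nat. cube k (real R))"]) (auto simp: emeasure_lebesgue_Rn_cube)
qed

definition ball_volume :: "nat \<Rightarrow> ennreal" where
  "ball_volume k = emeasure (lebesgue_Rn k) (cball 0 1)"

lemma ball_volume_pos: "ball_volume k > 0" and ball_volume_finite: "ball_volume k < \<infinity>"
proof -
  have "cball 0 1 \<subseteq> cube k 1"
    using abs_coord_le_norm order_trans by (fastforce simp: cube_def)
  then have "ball_volume k \<le> ennreal (2 ^ k)"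
    unfolding ball_volume_def using emeasure_lebesgue_Rn_cube[of 1 k] emeasure_mono[of "cball 0 1" "cube k 1" "lebesgue_Rn k"] by simp
  then show "ball_volume k < \<infinity>" by (rule order.strict_trans1) simp
  define R where "R = 1 / (real k + 1)"
  have R: "R > 0" "real k * R \<le> 1" by (auto simp: R_def field_simps)
  have "emeasure (lebesgue_Rn k) (cube k R) = emeasure (lebesgue_Rn k) (cube k R \<inter> Rn k)"
    using AE_lebesgue_Rn_Rn[of k] by (intro emeasure_eq_AE) auto
  also have "\<dots> \<le> ball_volume k"
    unfolding ball_volume_def
  proof (intro emeasure_mono subsetI)
    fix x assume x: "x \<in> cube k R \<inter> Rn k"
    then have "x = (\<Sum>i<k. coord x i *\<^sub>R basis_vec i)"
      using trunc_eq[of x k] by (simp add: trunc_def)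
    then have "norm x \<le> (\<Sum>i<k. norm (coord x i *\<^sub>R basis_vec i))"
      by (metis norm_sum)
    also have "\<dots> \<le> real k * R"
      using sum_bounded_above[of "{..<k}" "\<lambda>i. \<bar>coord x i\<bar>" R] x by (simp add: cube_def)
    also have "\<dots> \<le> 1" by (rule R)
    finally show "x \<in> cball 0 1" by simp
  qed auto
  finally have "ennreal ((2 * R) ^ k) \<le> ball_volume k"
    using R emeasure_lebesgue_Rn_cube[of R k] by simp
  moreover have "ennreal ((2 * R) ^ k) > 0" using R by simp
  ultimately show "ball_volume k > 0" by (rule order.strict_trans2[rotated])
qed

lemma nn_integral_lebesgue_Rn_translate:
  assumes "F \<in> borel_measurable borel" "a \<in> Rn k"
  shows "(\<integral>\<^sup>+x. F (a + x) \<partial>lebesgue_Rn k) = (\<integral>\<^sup>+x. F x \<partial>lebesgue_Rn k)"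
  using nn_integral_lebesgue_Rn_affine[OF assms, of 1] by simp

lemma nn_integral_lebesgue_Rn_minus:
  assumes "F \<in> borel_measurable borel" "a \<in> Rn k"
  shows "(\<integral>\<^sup>+x. F (a - x) \<partial>lebesgue_Rn k) = (\<integral>\<^sup>+x. F x \<partial>lebesgue_Rn k)"
  using nn_integral_lebesgue_Rn_affine[OF assms, of "-1"] by simp

text \<open>
  The image of Lebesgue measure under a rotation is again translation invariant. Two translation
  invariant measures are proportional: a shift in \<open>y\<close> takes the double integral of \<open>f x * g (T y)\<close> to that of
  \<open>f x * g (x + T y)\<close>, a shift in \<open>x\<close> to that of \<open>f (x - T y) * g x\<close>, and a shift and reflection in \<open>y\<close>
  to that of \<open>f (T y) * g x\<close>. The unit ball, which rotations preserve, shows that the factor is 1.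
\<close>

lemma nn_integral_lebesgue_Rn_rotation:
  assumes T: "T \<in> rotations k" and f [measurable]: "f \<in> borel_measurable borel"
  shows "(\<integral>\<^sup>+x. f (T x) \<partial>lebesgue_Rn k) = (\<integral>\<^sup>+x. f x \<partial>lebesgue_Rn k)"
proof -
  interpret lebesgue_Rn: sigma_finite_measure "lebesgue_Rn k" by (rule sigma_finite_lebesgue_Rn)
  interpret P: pair_sigma_finite "lebesgue_Rn k" "lebesgue_Rn k" ..
  note [measurable] = rotations_measurable[OF T]
  define g :: "finseq \<Rightarrow> ennreal" where "g = indicator (cball 0 1)"
  have g [measurable]: "g \<in> borel_measurable borel" unfolding g_def by measurable
  have gT: "g (T x) = g x" for x by (simp add: g_def indicator_def rotationsD[OF T])
  have gint: "(\<integral>\<^sup>+x. g x \<partial>lebesgue_Rn k) = ball_volume k" by (simp add: g_def ball_volume_def)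
  have shift: "(\<integral>\<^sup>+y. h (a + T y) \<partial>lebesgue_Rn k) = (\<integral>\<^sup>+y. h (T y) \<partial>lebesgue_Rn k)"
    "(\<integral>\<^sup>+y. h (a - T y) \<partial>lebesgue_Rn k) = (\<integral>\<^sup>+y. h (T y) \<partial>lebesgue_Rn k)"
    if a: "a \<in> Rn k" and [measurable]: "h \<in> borel_measurable borel" for h :: "finseq \<Rightarrow> ennreal" and a
  proof -
    obtain b where b: "b \<in> Rn k" "T b = a" using rotations_preimage[OF T a] by auto
    show "(\<integral>\<^sup>+y. h (a + T y) \<partial>lebesgue_Rn k) = (\<integral>\<^sup>+y. h (T y) \<partial>lebesgue_Rn k)"
      using nn_integral_lebesgue_Rn_translate[OF _ b(1), of "\<lambda>y. h (T y)"] by (simp add: rotationsD[OF T] b)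
    show "(\<integral>\<^sup>+y. h (a - T y) \<partial>lebesgue_Rn k) = (\<integral>\<^sup>+y. h (T y) \<partial>lebesgue_Rn k)"
      using nn_integral_lebesgue_Rn_minus[OF _ b(1), of "\<lambda>y. h (T y)"] by (simp add: rotationsD[OF T] b)
  qed
  have "(\<integral>\<^sup>+x. f x \<partial>lebesgue_Rn k) * ball_volume k = (\<integral>\<^sup>+x. f x \<partial>lebesgue_Rn k) * (\<integral>\<^sup>+y. g (T y) \<partial>lebesgue_Rn k)"
    by (simp add: gT gint)
  also have "\<dots> = (\<integral>\<^sup>+x. f x * (\<integral>\<^sup>+y. g (T y) \<partial>lebesgue_Rn k) \<partial>lebesgue_Rn k)"
    by (simp add: nn_integral_multc)
  also have "\<dots> = (\<integral>\<^sup>+x. (\<integral>\<^sup>+y. f x * g (x + T y) \<partial>lebesgue_Rn k) \<partial>lebesgue_Rn k)"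
  proof (rule nn_integral_cong_AE)
    show "AE x in lebesgue_Rn k. f x * (\<integral>\<^sup>+y. g (T y) \<partial>lebesgue_Rn k) = (\<integral>\<^sup>+y. f x * g (x + T y) \<partial>lebesgue_Rn k)"
      using AE_lebesgue_Rn_Rn[of k] by eventually_elim (simp add: nn_integral_cmult shift(1))
  qed
  also have "\<dots> = (\<integral>\<^sup>+y. (\<integral>\<^sup>+x. f x * g (x + T y) \<partial>lebesgue_Rn k) \<partial>lebesgue_Rn k)"
    by (rule P.Fubini'[symmetric]) measurable
  also have "\<dots> = (\<integral>\<^sup>+y. (\<integral>\<^sup>+x. f (x - T y) * g x \<partial>lebesgue_Rn k) \<partial>lebesgue_Rn k)"
  proof (rule nn_integral_cong_AE)
    show "AE y in lebesgue_Rn k. (\<integral>\<^sup>+x. f x * g (x + T y) \<partial>lebesgue_Rn k) = (\<integral>\<^sup>+x. f (x - T y) * g x \<partial>lebesgue_Rn k)"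
      using AE_lebesgue_Rn_Rn[of k]
    proof eventually_elim
      case (elim y)
      then show ?case
        using nn_integral_lebesgue_Rn_translate[of "\<lambda>x. f (x - T y) * g x" "T y" k]
        by (simp add: rotationsD[OF T] add.commute)
    qed
  qed
  also have "\<dots> = (\<integral>\<^sup>+x. (\<integral>\<^sup>+y. f (x - T y) * g x \<partial>lebesgue_Rn k) \<partial>lebesgue_Rn k)"
    by (rule P.Fubini') measurable
  also have "\<dots> = (\<integral>\<^sup>+x. (\<integral>\<^sup>+y. f (T y) \<partial>lebesgue_Rn k) * g x \<partial>lebesgue_Rn k)"
  proof (rule nn_integral_cong_AE)
    show "AE x in lebesgue_Rn k. (\<integral>\<^sup>+y. f (x - T y) * g x \<partial>lebesgue_Rn k) = (\<integral>\<^sup>+y. f (T y) \<partial>lebesgue_Rn k) * g x"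
      using AE_lebesgue_Rn_Rn[of k] by eventually_elim (simp add: nn_integral_multc shift(2))
  qed
  also have "\<dots> = (\<integral>\<^sup>+y. f (T y) \<partial>lebesgue_Rn k) * ball_volume k"
    by (simp add: nn_integral_cmult gint)
  finally have "ball_volume k * (\<integral>\<^sup>+x. f x \<partial>lebesgue_Rn k) = ball_volume k * (\<integral>\<^sup>+y. f (T y) \<partial>lebesgue_Rn k)"
    by (simp add: mult.commute)
  then show ?thesis
    using ball_volume_pos[of k] ball_volume_finite[of k] by (auto simp: ennreal_mult_cancel_left)
qed

section \<open>The uniform measure on the sphere\<close>

lemma unit_sphere_iff: "x \<in> unit_sphere n \<longleftrightarrow> x \<in> Rn n \<and> norm x = 1"
  by (auto simp: unit_sphere_def)

lemma unit_sphere_borel [measurable]: "unit_sphere n \<in> sets borel"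
  unfolding unit_sphere_def by measurable

lemma invariant_sphere_measureD:
  assumes "invariant_sphere_measure n \<sigma>"
  shows "prob_space \<sigma>" "sets \<sigma> = sets (restrict_space borel (unit_sphere n))" "space \<sigma> = unit_sphere n"
proof -
  show *: "prob_space \<sigma>" "sets \<sigma> = sets (restrict_space borel (unit_sphere n))"
    using assms by (auto simp: invariant_sphere_measure_def)
  show "space \<sigma> = unit_sphere n"
    using sets_eq_imp_space_eq[OF *(2)] by (simp add: space_restrict_space)
qed

lemma measurable_sphere_borel:
  assumes "sets \<sigma> = sets (restrict_space borel (unit_sphere n))" "F \<in> measurable borel N"
  shows "F \<in> measurable \<sigma> N"
  using measurable_restrict_space1[OF assms(2)] by (simp cong: measurable_cong_sets add: assms(1))

lemma rotations_measurable_sphere: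
  assumes "T \<in> rotations n" "sets \<sigma> = sets (restrict_space borel (unit_sphere n))"
  shows "T \<in> measurable \<sigma> \<sigma>"
proof -
  have "T \<in> measurable (restrict_space borel (unit_sphere n)) (restrict_space borel (unit_sphere n))"
    by (intro measurable_restrict_space3 rotations_measurable[OF assms(1)])
       (auto simp: unit_sphere_iff rotationsD[OF assms(1)])
  then show ?thesis by (simp cong: measurable_cong_sets add: assms(2))
qed

lemma nn_integral_sphere_rotation:
  assumes s: "invariant_sphere_measure n \<sigma>" and T: "T \<in> rotations n" and F: "F \<in> borel_measurable \<sigma>"
  shows "(\<integral>\<^sup>+x. F (T x) \<partial>\<sigma>) = (\<integral>\<^sup>+x. F x \<partial>\<sigma>)"
proof -
  have d: "distr \<sigma> \<sigma> T = \<sigma>" using s T by (auto simp: invariant_sphere_measure_def)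
  have "(\<integral>\<^sup>+x. F x \<partial>\<sigma>) = (\<integral>\<^sup>+x. F x \<partial>distr \<sigma> \<sigma> T)" by (simp add: d)
  also have "\<dots> = (\<integral>\<^sup>+x. F (T x) \<partial>\<sigma>)"
    using rotations_measurable_sphere[OF T invariant_sphere_measureD(2)[OF s]] F by (simp add: nn_integral_distr)
  finally show ?thesis ..
qed

text \<open>
  Radial projection of the uniform measure on the ball commutes with rotations away from the origin,
  which is a null set by homogeneity.
\<close>

lemma exists_invariant_sphere_measure:
  assumes m: "m > 0" shows "\<exists>\<sigma>. invariant_sphere_measure m \<sigma>"
proof -
  let ?U = "uniform_measure (lebesgue_Rn m) (cball 0 1)"
  let ?S = "restrict_space borel (unit_sphere m)"
  \<comment> \<open>The default value keeps \<open>s\<close> inside the sphere; it is taken on a null set only.\<close>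
  define s where "s x = (if x \<in> Rn m \<and> x \<noteq> 0 then x /\<^sub>R norm x else basis_vec 0)" for x
  define \<sigma> where "\<sigma> = distr ?U ?S s"
  have U: "prob_space ?U"
    using ball_volume_pos[of m] ball_volume_finite[of m] by (intro prob_space_uniform_measure) (auto simp: ball_volume_def)
  have s_borel: "s \<in> borel_measurable borel"
    unfolding s_def[abs_def] by measurable
  have s_sphere: "s x \<in> unit_sphere m" for x
    using m by (auto simp: s_def unit_sphere_iff intro!: subspace_scale subspace_Rn)
  have s_meas: "s \<in> measurable ?U ?S"
    using measurable_restrict_space2[OF _ s_borel, of "unit_sphere m"] s_sphere
    by (simp cong: measurable_cong_sets)
  have sets: "sets \<sigma> = sets ?S" by (simp add: \<sigma>_def)
  have "prob_space \<sigma>" unfolding \<sigma>_def by (rule prob_space.prob_space_distr[OF U s_meas])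
  moreover have "distr \<sigma> \<sigma> T = \<sigma>" if T: "T \<in> rotations m" for T
  proof (rule measure_eqI)
    show "sets (distr \<sigma> \<sigma> T) = sets \<sigma>" by simp
    fix A assume "A \<in> sets (distr \<sigma> \<sigma> T)"
    then have A: "A \<in> sets \<sigma>" by simp
    have TS: "T \<in> measurable \<sigma> \<sigma>" by (rule rotations_measurable_sphere[OF T sets])
    have A_borel [measurable]: "A \<in> sets borel"
      using A sets by (simp add: sets_restrict_space_iff)
    note [measurable] = s_borel rotations_measurable[OF T]
    have em: "emeasure \<sigma> B = (\<integral>\<^sup>+x. indicator B (s x) * indicator (cball 0 1) x \<partial>lebesgue_Rn m) / ball_volume m"
      if "B \<in> sets \<sigma>" for B
    proof -
      have [measurable]: "B \<in> sets borel" using that sets by (simp add: sets_restrict_space_iff)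
      have "emeasure \<sigma> B = (\<integral>\<^sup>+x. indicator B x \<partial>\<sigma>)" using that by simp
      also have "\<dots> = (\<integral>\<^sup>+x. indicator B (s x) \<partial>?U)"
        unfolding \<sigma>_def using that s_meas by (subst nn_integral_distr) (auto simp: sets)
      also have "\<dots> = (\<integral>\<^sup>+x. indicator B (s x) * indicator (cball 0 1) x \<partial>lebesgue_Rn m) / ball_volume m"
        unfolding ball_volume_def by (subst nn_integral_uniform_measure) auto
      finally show ?thesis .
    qed
    have null: "AE x in lebesgue_Rn m. x \<noteq> 0"
    proof -
      have "emeasure (lebesgue_Rn m) {0} = (\<integral>\<^sup>+x. indicator {0} x \<partial>lebesgue_Rn m)" by simp
      also have "\<dots> = ennreal (\<bar>2\<bar> ^ m) * (\<integral>\<^sup>+x. indicator {0} (0 + 2 *\<^sub>R x) \<partial>lebesgue_Rn m)"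
        by (rule nn_integral_lebesgue_Rn_affine) (auto simp: subspace_0 subspace_Rn)
      also have "(\<lambda>x::finseq. indicator {0} (0 + 2 *\<^sub>R x) :: ennreal) = indicator {0}"
        by (auto simp: indicator_def)
      finally have eq: "emeasure (lebesgue_Rn m) {0} = ennreal (2 ^ m) * emeasure (lebesgue_Rn m) {0}" by simp
      have "emeasure (lebesgue_Rn m) {0} \<le> ball_volume m"
        unfolding ball_volume_def by (intro emeasure_mono) auto
      then have fin: "emeasure (lebesgue_Rn m) {0} < \<infinity>" using ball_volume_finite[of m] by (rule order.strict_trans1)
      define r where "r = enn2real (emeasure (lebesgue_Rn m) {0})"
      have r: "emeasure (lebesgue_Rn m) {0} = ennreal r" "r \<ge> 0" using fin by (auto simp: r_def)
      have "r = 2 ^ m * r" using eq r by (simp add: ennreal_mult'[symmetric])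
      moreover have "(2::real) ^ m > 1" using m by (intro one_less_power) auto
      ultimately have "r = 0" by simp
      then show ?thesis using r by (intro AE_I[of _ _ "{0}"]) auto
    qed
    have "emeasure (distr \<sigma> \<sigma> T) A = emeasure \<sigma> (T -` A \<inter> space \<sigma>)"
      by (rule emeasure_distr[OF TS A])
    also have "\<dots> = (\<integral>\<^sup>+x. indicator (T -` A \<inter> space \<sigma>) (s x) * indicator (cball 0 1) x \<partial>lebesgue_Rn m) / ball_volume m"
      by (rule em) (rule measurable_sets[OF TS A])
    also have "(\<integral>\<^sup>+x. indicator (T -` A \<inter> space \<sigma>) (s x) * indicator (cball 0 1) x \<partial>lebesgue_Rn m)
        = (\<integral>\<^sup>+x. indicator A (s (T x)) * indicator (cball 0 1) (T x) \<partial>lebesgue_Rn m)"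
    proof (rule nn_integral_cong_AE)
      show "AE x in lebesgue_Rn m. indicator (T -` A \<inter> space \<sigma>) (s x) * indicator (cball 0 1) x
          = (indicator A (s (T x)) * indicator (cball 0 1) (T x) :: ennreal)"
        using AE_lebesgue_Rn_Rn[of m] null
      proof eventually_elim
        case (elim x)
        have "T x \<noteq> 0" using elim rotationsD(3)[OF T, of x] by auto
        then have "s (T x) = T (s x)" using elim by (simp add: s_def rotationsD[OF T])
        moreover have "s x \<in> space \<sigma>"
          using s_sphere by (simp add: \<sigma>_def space_restrict_space)
        ultimately show ?case by (simp add: indicator_def rotationsD[OF T])
      qed
    qed
    also have "\<dots> = (\<integral>\<^sup>+x. indicator A (s x) * indicator (cball 0 1) x \<partial>lebesgue_Rn m)"
      by (rule nn_integral_lebesgue_Rn_rotation[OF T]) measurable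
    also have "\<dots> / ball_volume m = emeasure \<sigma> A" by (rule em[OF A, symmetric])
    finally show "emeasure (distr \<sigma> \<sigma> T) A = emeasure \<sigma> A" .
  qed
  ultimately show ?thesis using sets by (auto simp: invariant_sphere_measure_def)
qed

section \<open>Haar measure on orthonormal frames\<close>

definition frame_space :: "nat \<Rightarrow> (nat \<Rightarrow> finseq) measure" where
  "frame_space m = restrict_space (PiM {..<m} (\<lambda>_. borel)) (frames m)"

text \<open>
  A probability measure on the frames of \<open>Rn m\<close>, that is on its rotation group, with invariance under
  composition with a rotation on the right.
\<close>

definition haar :: "nat \<Rightarrow> (nat \<Rightarrow> finseq) measure \<Rightarrow> bool" where
  "haar m \<rho> \<longleftrightarrow> prob_space \<rho> \<and> sets \<rho> = sets (frame_space m) \<and>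
     (\<forall>Q\<in>rotations m. \<forall>F\<in>borel_measurable \<rho>.
        (\<integral>\<^sup>+f. F (\<lambda>i\<in>{..<m}. act m f (Q (basis_vec i))) \<partial>\<rho>) = (\<integral>\<^sup>+f. F f \<partial>\<rho> :: ennreal))"

lemma space_frame_space: "space (frame_space m) = frames m"
  by (auto simp: frame_space_def space_restrict_space space_PiM frames_def PiE_def)

lemma frame_component_measurable:
  assumes "sets \<rho> = sets (frame_space m)" "i < m"
  shows "(\<lambda>f. f i) \<in> borel_measurable \<rho>"
proof -
  have "(\<lambda>f. f i) \<in> borel_measurable (frame_space m)"
    unfolding frame_space_def using assms(2)
    by (intro measurable_restrict_space1 measurable_component_singleton) auto
  then show ?thesis by (simp cong: measurable_cong_sets add: assms(1))
qed

lemma measurable_into_frame_space: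
  assumes "\<And>i. i < m \<Longrightarrow> (\<lambda>\<omega>. g \<omega> i) \<in> borel_measurable M" "\<And>\<omega>. \<omega> \<in> space M \<Longrightarrow> g \<omega> \<in> frames m"
  shows "g \<in> measurable M (frame_space m)"
  unfolding frame_space_def
proof (rule measurable_restrict_space2)
  show "g \<in> space M \<rightarrow> frames m" using assms(2) by auto
  show "g \<in> measurable M (PiM {..<m} (\<lambda>_. borel))"
    using assms by (intro measurable_PiM_single') (auto simp: frames_def PiE_def)
qed

lemma act_measurable:
  assumes "\<And>i. i < m \<Longrightarrow> (\<lambda>\<omega>. g \<omega> i) \<in> borel_measurable M" "h \<in> borel_measurable M"
  shows "(\<lambda>\<omega>. act m (g \<omega>) (h \<omega>)) \<in> borel_measurable M"
  unfolding act_def using assms by (intro borel_measurable_add borel_measurable_sum) auto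

lemma haarD:
  assumes "haar m \<rho>"
  shows "prob_space \<rho>" "sets \<rho> = sets (frame_space m)" "space \<rho> = frames m"
    "Q \<in> rotations m \<Longrightarrow> F \<in> borel_measurable \<rho> \<Longrightarrow>
      (\<integral>\<^sup>+f. F (\<lambda>i\<in>{..<m}. act m f (Q (basis_vec i))) \<partial>\<rho>) = (\<integral>\<^sup>+f. F f \<partial>\<rho>)"
  using assms sets_eq_imp_space_eq[of \<rho> "frame_space m"]
  by (auto simp: haar_def space_frame_space)

text \<open>
  A random frame of \<open>Rn (Suc m)\<close> is obtained from a random frame \<open>f\<close> of \<open>Rn m\<close> and an independent
  uniform vector \<open>x\<close> as the rotation \<open>act m f \<circ> H x\<close>, where the reflection \<open>H x\<close> exchanges \<open>x\<close> with the
  last axis. For a rotation \<open>Q\<close> one has \<open>H (Q y) \<circ> Q = Q' \<circ> H y\<close> with a rotation \<open>Q'\<close> that fixes the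
  last axis; so composing with \<open>Q\<close> on the right replaces \<open>x = Q y\<close> by \<open>y\<close> and \<open>f\<close> by \<open>f\<close> composed with
  \<open>Q'\<close>, and neither change is seen by the measures.
\<close>

lemma haar_exists: "\<exists>\<rho>. haar m \<rho>"
proof (induction m)
  case 0
  have f0: "frames 0 = {\<lambda>_. undefined}" by (auto simp: frames_def)
  let ?\<rho> = "return (frame_space 0) (\<lambda>_. undefined)"
  have "prob_space ?\<rho>" by (rule prob_space_return) (simp add: space_frame_space f0)
  moreover have "(\<integral>\<^sup>+f. F (\<lambda>i\<in>{..<0}. act 0 f (Q (basis_vec i))) \<partial>?\<rho>) = (\<integral>\<^sup>+f. F f \<partial>?\<rho>)"
    for F :: "(nat \<Rightarrow> finseq) \<Rightarrow> ennreal" and Q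
    by (rule nn_integral_cong) (simp add: space_frame_space f0 restrict_def)
  ultimately show ?case by (auto simp: haar_def)
next
  case (Suc m)
  then obtain \<rho> where \<rho>: "haar m \<rho>" by blast
  obtain \<sigma> where \<sigma>: "invariant_sphere_measure (Suc m) \<sigma>" using exists_invariant_sphere_measure by blast
  interpret R: prob_space \<rho> by (rule haarD[OF \<rho>])
  interpret S: prob_space \<sigma> by (rule invariant_sphere_measureD[OF \<sigma>])
  interpret P: pair_prob_space \<rho> \<sigma> ..
  define H where "H x = reflect (x - basis_vec m)" for x
  define \<phi> where "\<phi> f x = (\<lambda>i\<in>{..<Suc m}. act m f (H x (basis_vec i)))" for f x
  define \<rho>' where "\<rho>' = distr (\<rho> \<Otimes>\<^sub>M \<sigma>) (frame_space (Suc m)) (\<lambda>(f, x). \<phi> f x)"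
  have comp: "(\<lambda>z. fst z i) \<in> borel_measurable (\<rho> \<Otimes>\<^sub>M \<sigma>)" if "i < m" for i
    using measurable_compose[OF measurable_fst frame_component_measurable[OF haarD(2)[OF \<rho>] that]] .
  have sndm: "snd \<in> borel_measurable (\<rho> \<Otimes>\<^sub>M \<sigma>)"
    using measurable_compose[OF measurable_snd measurable_sphere_borel[OF invariant_sphere_measureD(2)[OF \<sigma>] measurable_ident]]
    by simp
  have Hrot: "H x \<in> rotations (Suc m)" if "x \<in> unit_sphere (Suc m)" for x
    unfolding H_def using that by (intro reflect_rotations subspace_diff subspace_Rn) (auto simp: unit_sphere_iff)
  have H1: "H x (basis_vec m) = x" "H x x = basis_vec m" if "x \<in> unit_sphere (Suc m)" for x
    unfolding H_def using that by (auto simp: unit_sphere_iff intro!: reflect_swap)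
  have actrot: "act m f \<in> rotations (Suc m)" if "f \<in> frames m" for f
    using act_rotations[OF that, of "Suc m"] by simp
  have \<phi>_frames: "\<phi> f x \<in> frames (Suc m)" if "f \<in> frames m" "x \<in> unit_sphere (Suc m)" for f x
    unfolding \<phi>_def by (intro frame_of_rotation rotations_compose[OF actrot Hrot] that)
  have \<phi>_meas: "(\<lambda>(f, x). \<phi> f x) \<in> measurable (\<rho> \<Otimes>\<^sub>M \<sigma>) (frame_space (Suc m))"
  proof (rule measurable_into_frame_space)
    show "(case \<omega> of (f, x) \<Rightarrow> \<phi> f x) \<in> frames (Suc m)" if "\<omega> \<in> space (\<rho> \<Otimes>\<^sub>M \<sigma>)" for \<omega>
      using that by (auto simp: space_pair_measure haarD(3)[OF \<rho>] invariant_sphere_measureD(3)[OF \<sigma>] intro!: \<phi>_frames)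
    fix i assume "i < Suc m"
    then have "(\<lambda>\<omega>. (case \<omega> of (f, x) \<Rightarrow> \<phi> f x) i)
        = (\<lambda>\<omega>. act m (fst \<omega>) (reflect (snd \<omega> - basis_vec m) (basis_vec i)))"
      by (auto simp: \<phi>_def H_def)
    also have "\<dots> \<in> borel_measurable (\<rho> \<Otimes>\<^sub>M \<sigma>)"
      using sndm by (intro act_measurable comp reflect_measurable borel_measurable_diff) auto
    finally show "(\<lambda>\<omega>. (case \<omega> of (f, x) \<Rightarrow> \<phi> f x) i) \<in> borel_measurable (\<rho> \<Otimes>\<^sub>M \<sigma>)" .
  qed
  have prob: "prob_space \<rho>'"
    unfolding \<rho>'_def by (rule P.prob_space_distr[OF \<phi>_meas])
  have sets: "sets \<rho>' = sets (frame_space (Suc m))" by (simp add: \<rho>'_def)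
  have int: "(\<integral>\<^sup>+f. G f \<partial>\<rho>') = (\<integral>\<^sup>+x. (\<integral>\<^sup>+f. G (\<phi> f x) \<partial>\<rho>) \<partial>\<sigma>)"
    and Gm: "(\<lambda>x. \<integral>\<^sup>+f. G (\<phi> f x) \<partial>\<rho>) \<in> borel_measurable \<sigma>"
    if G: "G \<in> borel_measurable \<rho>'" for G :: "_ \<Rightarrow> ennreal"
  proof -
    have G': "G \<in> borel_measurable (frame_space (Suc m))" using G by (simp add: \<rho>'_def)
    have m': "(\<lambda>(f, x). G (\<phi> f x)) \<in> borel_measurable (\<rho> \<Otimes>\<^sub>M \<sigma>)"
      using measurable_compose[OF \<phi>_meas G'] by (simp add: split_beta')
    have "(\<integral>\<^sup>+f. G f \<partial>\<rho>') = (\<integral>\<^sup>+z. (case z of (f, x) \<Rightarrow> G (\<phi> f x)) \<partial>(\<rho> \<Otimes>\<^sub>M \<sigma>))"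
      unfolding \<rho>'_def by (subst nn_integral_distr[OF \<phi>_meas]) (use G' in \<open>auto simp: split_beta'\<close>)
    also have "\<dots> = (\<integral>\<^sup>+x. (\<integral>\<^sup>+f. G (\<phi> f x) \<partial>\<rho>) \<partial>\<sigma>)"
      using P.nn_integral_snd[OF m'] by simp
    finally show "(\<integral>\<^sup>+f. G f \<partial>\<rho>') = (\<integral>\<^sup>+x. (\<integral>\<^sup>+f. G (\<phi> f x) \<partial>\<rho>) \<partial>\<sigma>)" .
    show "(\<lambda>x. \<integral>\<^sup>+f. G (\<phi> f x) \<partial>\<rho>) \<in> borel_measurable \<sigma>"
      using m' by measurable
  qed
  have inv: "(\<integral>\<^sup>+g. F (\<lambda>i\<in>{..<Suc m}. act (Suc m) g (Q (basis_vec i))) \<partial>\<rho>') = (\<integral>\<^sup>+g. F g \<partial>\<rho>')"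
    if Q: "Q \<in> rotations (Suc m)" and F: "F \<in> borel_measurable \<rho>'" for Q and F :: "_ \<Rightarrow> ennreal"
  proof -
    let ?c = "\<lambda>g. \<lambda>i\<in>{..<Suc m}. act (Suc m) g (Q (basis_vec i))"
    have spaceP: "space \<rho>' = frames (Suc m)" by (simp add: \<rho>'_def space_frame_space)
    have cm: "?c \<in> measurable \<rho>' \<rho>'"
    proof -
      have "?c \<in> measurable \<rho>' (frame_space (Suc m))"
      proof (rule measurable_into_frame_space)
        fix g assume "g \<in> space \<rho>'"
        then have "g \<in> frames (Suc m)" by (simp add: spaceP)
        then show "?c g \<in> frames (Suc m)"
          by (intro frame_of_rotation rotations_compose[OF act_rotations Q]) auto
      next
        fix i assume "i < Suc m"
        moreover have "(\<lambda>g. act (Suc m) g (Q (basis_vec i))) \<in> borel_measurable \<rho>'"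
          by (intro act_measurable frame_component_measurable[OF sets]) auto
        ultimately show "(\<lambda>g. ?c g i) \<in> borel_measurable \<rho>'" by simp
      qed
      then show ?thesis by (simp cong: measurable_cong_sets add: sets)
    qed
    have key: "(\<integral>\<^sup>+f. F (?c (\<phi> f (Q y))) \<partial>\<rho>) = (\<integral>\<^sup>+f. F (\<phi> f y) \<partial>\<rho>)" if y: "y \<in> space \<sigma>" for y
    proof -
      have y': "y \<in> unit_sphere (Suc m)" using y by (simp add: invariant_sphere_measureD(3)[OF \<sigma>])
      then have Qy: "Q y \<in> unit_sphere (Suc m)" by (simp add: unit_sphere_iff rotationsD[OF Q])
      \<comment> \<open>\<open>Q'\<close> fixes the last axis and hence is a rotation of \<open>Rn m\<close>, which \<open>f\<close> absorbs.\<close>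
      define Q' where "Q' x = H (Q y) (Q (H y x))" for x
      have Q'Suc: "Q' \<in> rotations (Suc m)"
        unfolding Q'_def by (intro rotations_compose[OF Hrot[OF Qy]] rotations_compose[OF Q] Hrot y')
      have Q'm: "Q' (basis_vec m) = basis_vec m" by (simp add: Q'_def H1[OF y'] H1[OF Qy])
      have Q': "Q' \<in> rotations m" by (rule rotation_pred[OF Q'Suc Q'm])
      have HQ: "H (Q y) (Q x) = Q' (H y x)" for x
        by (simp add: Q'_def H_def reflect_reflect)
      have eq: "?c (\<phi> f (Q y)) = \<phi> (\<lambda>i\<in>{..<m}. act m f (Q' (basis_vec i))) y" if f: "f \<in> frames m" for f
      proof (rule ext)
        fix i
        show "?c (\<phi> f (Q y)) i = \<phi> (\<lambda>i\<in>{..<m}. act m f (Q' (basis_vec i))) y i"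
        proof (cases "i < Suc m")
          case True
          let ?z = "H y (basis_vec i)"
          have z: "?z \<in> Rn (Suc m)" using True by (simp add: rotationsD(9)[OF Hrot[OF y']])
          have "?c (\<phi> f (Q y)) i = act m f (H (Q y) (Q (basis_vec i)))"
            unfolding \<phi>_def using True
            by (simp del: lessThan_Suc) (rule act_frame_of_linear,
                auto intro!: linearI simp: rotationsD[OF actrot[OF f]] rotationsD[OF Hrot[OF Qy]] rotationsD[OF Q])
          also have "\<dots> = act m f (Q' ?z)" by (simp add: HQ)
          also have "\<dots> = act m (\<lambda>i\<in>{..<m}. act m f (Q' (basis_vec i))) ?z"
          proof (rule linear_eq_on_Rn[OF _ linear_act _ z])
            show "linear (\<lambda>x. act m f (Q' x))"
              using rotations_compose[OF actrot[OF f] Q'Suc] by (rule rotationsD)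
            show "act m f (Q' (basis_vec j)) = act m (\<lambda>i\<in>{..<m}. act m f (Q' (basis_vec i))) (basis_vec j)"
              if "j < Suc m" for j
              using that by (cases "j = m") (simp_all add: act_basis_vec Q'm)
          qed
          finally show ?thesis using True by (simp add: \<phi>_def)
        qed (simp add: \<phi>_def)
      qed
      have Fm: "(\<lambda>f. F (\<phi> f y)) \<in> borel_measurable \<rho>"
      proof -
        have "(\<lambda>f. \<phi> f y) \<in> measurable \<rho> (frame_space (Suc m))"
          using measurable_compose[OF measurable_Pair2'[OF y] \<phi>_meas] by simp
        moreover have "F \<in> borel_measurable (frame_space (Suc m))" using F by (simp add: \<rho>'_def)
        ultimately show ?thesis by (rule measurable_compose)
      qed
      have "(\<integral>\<^sup>+f. F (?c (\<phi> f (Q y))) \<partial>\<rho>)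
          = (\<integral>\<^sup>+f. F (\<phi> (\<lambda>i\<in>{..<m}. act m f (Q' (basis_vec i))) y) \<partial>\<rho>)"
        by (rule nn_integral_cong) (simp only: haarD(3)[OF \<rho>] eq)
      also have "\<dots> = (\<integral>\<^sup>+f. F (\<phi> f y) \<partial>\<rho>)"
        by (rule haarD(4)[OF \<rho> Q' Fm])
      finally show ?thesis .
    qed
    have Fc: "(\<lambda>g. F (?c g)) \<in> borel_measurable \<rho>'" by (rule measurable_compose[OF cm F])
    have "(\<integral>\<^sup>+g. F (?c g) \<partial>\<rho>') = (\<integral>\<^sup>+x. (\<integral>\<^sup>+f. F (?c (\<phi> f x)) \<partial>\<rho>) \<partial>\<sigma>)"
      by (rule int[OF Fc])
    also have "\<dots> = (\<integral>\<^sup>+y. (\<integral>\<^sup>+f. F (?c (\<phi> f (Q y))) \<partial>\<rho>) \<partial>\<sigma>)"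
      by (rule nn_integral_sphere_rotation[OF \<sigma> Q Gm[OF Fc], symmetric])
    also have "\<dots> = (\<integral>\<^sup>+y. (\<integral>\<^sup>+f. F (\<phi> f y) \<partial>\<rho>) \<partial>\<sigma>)"
      by (rule nn_integral_cong) (rule key)
    also have "\<dots> = (\<integral>\<^sup>+g. F g \<partial>\<rho>')" by (rule int[OF F, symmetric])
    finally show ?thesis .
  qed
  have "haar (Suc m) \<rho>'" using prob sets inv by (auto simp: haar_def)
  then show ?case by blast
qed

lemma haar_act_measurable:
  assumes "haar m \<rho>" "F \<in> borel_measurable borel"
  shows "(\<lambda>f. F (act m f z)) \<in> borel_measurable \<rho>"
  by (intro measurable_compose[OF act_measurable assms(2)] frame_component_measurable[OF haarD(2)[OF assms(1)]]) auto

text \<open>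
  Some rotation takes the axis \<open>i\<close> to \<open>z\<close>.
\<close>

lemma haar_unit_vector:
  assumes \<rho>: "haar m \<rho>" and z: "z \<in> Rn m" "norm z = 1" and i: "i < m" and F: "F \<in> borel_measurable borel"
  shows "(\<integral>\<^sup>+f. F (act m f z) \<partial>\<rho>) = (\<integral>\<^sup>+f. F (f i) \<partial>\<rho> :: ennreal)"
proof -
  obtain Q where Q: "Q \<in> rotations m" "Q (basis_vec i) = z"
    using rotation_to[of "basis_vec i" m z] z i by auto
  have "(\<lambda>f. F (f i)) \<in> borel_measurable \<rho>"
    by (rule measurable_compose[OF frame_component_measurable[OF haarD(2)[OF \<rho>] i] F])
  from haarD(4)[OF \<rho> Q(1) this] show ?thesis using i Q(2) by simp
qed

text \<open>
  The vectors of a random frame are uniform on the sphere. Since the measure on the sphere is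
  invariant, the integral of \<open>F\<close> may be averaged over the rotations \<open>act n f\<close>; after exchanging the
  integrals the inner one is independent of the point of the sphere. In particular the invariant
  measure on the sphere is unique.
\<close>

lemma nn_integral_sphere_haar:
  assumes \<rho>: "haar n \<rho>" and \<sigma>: "invariant_sphere_measure n \<sigma>" and i: "i < n" and F [measurable]: "F \<in> borel_measurable borel"
  shows "(\<integral>\<^sup>+x. F x \<partial>\<sigma>) = (\<integral>\<^sup>+f. F (f i) \<partial>\<rho> :: ennreal)"
proof -
  interpret R: prob_space \<rho> by (rule haarD[OF \<rho>])
  interpret S: prob_space \<sigma> by (rule invariant_sphere_measureD[OF \<sigma>])
  interpret P: pair_prob_space \<rho> \<sigma> ..
  have F\<sigma>: "F \<in> borel_measurable \<sigma>" by (rule measurable_sphere_borel[OF invariant_sphere_measureD(2)[OF \<sigma>] F])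
  have m: "(\<lambda>(f, x). F (act n f x)) \<in> borel_measurable (\<rho> \<Otimes>\<^sub>M \<sigma>)"
  proof -
    have "(\<lambda>z. act n (fst z) (snd z)) \<in> borel_measurable (\<rho> \<Otimes>\<^sub>M \<sigma>)"
      using measurable_compose[OF measurable_fst frame_component_measurable[OF haarD(2)[OF \<rho>]]]
        measurable_compose[OF measurable_snd measurable_sphere_borel[OF invariant_sphere_measureD(2)[OF \<sigma>] measurable_ident]]
      by (intro act_measurable) auto
    from measurable_compose[OF this F] show ?thesis by (simp add: split_beta')
  qed
  have "(\<integral>\<^sup>+x. F x \<partial>\<sigma>) = (\<integral>\<^sup>+f. (\<integral>\<^sup>+x. F x \<partial>\<sigma>) \<partial>\<rho>)"
    by (simp add: R.emeasure_space_1)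
  also have "\<dots> = (\<integral>\<^sup>+f. (\<integral>\<^sup>+x. F (act n f x) \<partial>\<sigma>) \<partial>\<rho>)"
    by (intro nn_integral_cong nn_integral_sphere_rotation[OF \<sigma> act_rotations F\<sigma>, symmetric])
       (auto simp: haarD(3)[OF \<rho>])
  also have "\<dots> = (\<integral>\<^sup>+x. (\<integral>\<^sup>+f. F (act n f x) \<partial>\<rho>) \<partial>\<sigma>)"
    using P.Fubini'[OF m] by simp
  also have "\<dots> = (\<integral>\<^sup>+x. (\<integral>\<^sup>+f. F (f i) \<partial>\<rho>) \<partial>\<sigma>)"
    by (intro nn_integral_cong haar_unit_vector[OF \<rho> _ _ i F])
       (auto simp: invariant_sphere_measureD(3)[OF \<sigma>] unit_sphere_iff)
  also have "\<dots> = (\<integral>\<^sup>+f. F (f i) \<partial>\<rho>)"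
    by (simp add: S.emeasure_space_1)
  finally show ?thesis .
qed

section \<open>Norms and rotation averages\<close>

text \<open>
  A norm on \<open>Rn n\<close>, extended to a continuous seminorm on the whole sequence space so that it can be composed
  with projections and rotations without restricting domains.
\<close>

definition norm_on :: "nat \<Rightarrow> (finseq \<Rightarrow> real) \<Rightarrow> bool" where
  "norm_on n N \<longleftrightarrow> continuous_on UNIV N \<and> (\<forall>x y. N (x + y) \<le> N x + N y) \<and>
     (\<forall>c x. N (c *\<^sub>R x) = \<bar>c\<bar> * N x) \<and> (\<forall>x\<in>Rn n. x \<noteq> 0 \<longrightarrow> N x > 0)"

lemma norm_onD:
  assumes "norm_on n N"
  shows "continuous_on UNIV N" "N (x + y) \<le> N x + N y" "N (c *\<^sub>R x) = \<bar>c\<bar> * N x" "x \<in> Rn n \<Longrightarrow> x \<noteq> 0 \<Longrightarrow> N x > 0"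
    "N 0 = 0" "N (- x) = N x" "N x \<ge> 0" "N \<in> borel_measurable borel"
proof -
  show 1: "continuous_on UNIV N" and 2: "\<And>x y. N (x + y) \<le> N x + N y" and 3: "\<And>c x. N (c *\<^sub>R x) = \<bar>c\<bar> * N x"
    and "x \<in> Rn n \<Longrightarrow> x \<noteq> 0 \<Longrightarrow> N x > 0" using assms by (auto simp: norm_on_def)
  show "N 0 = 0" using 3[of 0 0] by simp
  show minus: "N (- x) = N x" for x using 3[of "-1" x] by simp
  show "N x \<ge> 0" using 2[of x "- x"] minus[of x] \<open>N 0 = 0\<close> by simp
  show "N \<in> borel_measurable borel" by (rule borel_measurable_continuous_onI[OF 1])
qed

lemma norm_on_rotation:
  assumes N: "norm_on n N" and T: "T \<in> rotations n" and kn: "k \<le> n"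
  shows "norm_on k (\<lambda>x. N (T x))"
  unfolding norm_on_def
proof (intro conjI allI ballI impI)
  show "continuous_on UNIV (\<lambda>x. N (T x))"
    using continuous_on_compose2[OF norm_onD(1)[OF N] rotations_continuous[OF T]] by simp
  fix x assume x: "x \<in> Rn k" "x \<noteq> 0"
  then have "T x \<in> Rn n" using Rn_mono[OF kn] rotationsD(9)[OF T] by auto
  moreover have "T x \<noteq> 0" using x(2) rotationsD(3)[OF T, of x] by auto
  ultimately show "N (T x) > 0" by (rule norm_onD(4)[OF N])
qed (simp_all add: rotationsD[OF T] norm_onD[OF N])

lemma norm_frame_pos:
  assumes "norm_on m N" "f \<in> frames m" "i < m" shows "N (f i) > 0"
  using framesD(1,3)[OF assms(2,3)] by (intro norm_onD(4)[OF assms(1)]) auto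

lemma trunc_act: "f \<in> frames m \<Longrightarrow> trunc m (act m f x) = act m f (trunc m x)"
  by (simp add: act_alt linear_add[OF linear_trunc] linear_diff[OF linear_trunc] linear_sum[OF linear_trunc]
      linear_scale[OF linear_trunc] trunc_eq framesD)

lemma haar_same_component:
  assumes \<rho>: "haar m \<rho>" and i: "i < m" and j: "j < m" and F: "F \<in> borel_measurable borel"
  shows "(\<integral>\<^sup>+f. F (f i) \<partial>\<rho>) = (\<integral>\<^sup>+f. F (f j) \<partial>\<rho> :: ennreal)"
  using haar_unit_vector[OF \<rho> _ _ j F, of "basis_vec i"] i by (simp add: act_basis_vec)

text \<open>
  All coordinates have the same second moment, and the sum of these moments is 1.
\<close>

lemma sphere_second_moment:
  assumes \<sigma>: "invariant_sphere_measure n \<sigma>" and mn: "m \<le> n"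
  shows "of_nat n * (\<integral>\<^sup>+x. ennreal ((norm (trunc m x))\<^sup>2) \<partial>\<sigma>) = of_nat m"
proof -
  interpret S: prob_space \<sigma> by (rule invariant_sphere_measureD[OF \<sigma>])
  define t where "t i = (\<integral>\<^sup>+x. ennreal ((coord x i)\<^sup>2) \<partial>\<sigma>)" for i
  have cm: "(\<lambda>x. ennreal ((coord x i)\<^sup>2)) \<in> borel_measurable \<sigma>" for i
    by (rule measurable_sphere_borel[OF invariant_sphere_measureD(2)[OF \<sigma>]]) measurable
  have t_eq: "t i = t 0" if i: "i < n" for i
  proof -
    obtain T where T: "T \<in> rotations n" "T (basis_vec i) = basis_vec 0"
      using rotation_to[of "basis_vec i" n "basis_vec 0"] i by auto
    have "coord (T x) 0 = coord x i" for x
      using rotationsD(2)[OF T(1), of "basis_vec i" x] by (simp add: T(2))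
    then show ?thesis
      using nn_integral_sphere_rotation[OF \<sigma> T(1) cm[of 0]] by (simp add: t_def)
  qed
  have sum: "(\<integral>\<^sup>+x. ennreal ((norm (trunc j x))\<^sup>2) \<partial>\<sigma>) = of_nat j * t 0" if "j \<le> n" for j
  proof -
    have "(\<integral>\<^sup>+x. ennreal ((norm (trunc j x))\<^sup>2) \<partial>\<sigma>) = (\<integral>\<^sup>+x. (\<Sum>i<j. ennreal ((coord x i)\<^sup>2)) \<partial>\<sigma>)"
      by (intro nn_integral_cong) (simp add: norm_sq_Rn[OF trunc_in_Rn] sum_ennreal)
    also have "\<dots> = (\<Sum>i<j. t i)"
      unfolding t_def by (rule nn_integral_sum[OF cm])
    also have "\<dots> = (\<Sum>i<j. t 0)" using that by (intro sum.cong refl t_eq) auto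
    finally show ?thesis by simp
  qed
  have "of_nat n * t 0 = (\<integral>\<^sup>+x. 1 \<partial>\<sigma>)"
    unfolding sum[OF order_refl, symmetric]
    by (intro nn_integral_cong) (auto simp: invariant_sphere_measureD(3)[OF \<sigma>] unit_sphere_iff trunc_eq)
  then have "of_nat n * t 0 = 1" by (simp add: S.emeasure_space_1)
  then show ?thesis
    unfolding sum[OF mn] by (metis mult.left_commute mult.right_neutral)
qed

text \<open>
  Let \<open>A\<close> be the mean of \<open>N\<close> on the sphere of \<open>Rn m\<close>. The projection of a uniform unit vector of
  \<open>Rn n\<close> to \<open>Rn m\<close> has a uniform direction, independent of its length, so the mean of \<open>N\<close> at the
  projection is \<open>A\<close> times the mean length, and the latter is at least the second moment \<open>m / n\<close>. On
  the other hand the projection is the midpoint of the vector and its mirror image in \<open>Rn m\<close>, so the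
  mean of \<open>N\<close> at the projection is at most the mean of \<open>N\<close> on the sphere.
\<close>

lemma haar_norm_le_sphere:
  assumes N: "norm_on n N" and \<sigma>: "invariant_sphere_measure n \<sigma>" and \<rho>: "haar m \<rho>"
    and mn: "m \<le> n" "n \<le> 2 * m" and i: "i < m"
  shows "(\<integral>\<^sup>+g. ennreal (N (g i)) \<partial>\<rho>) \<le> 2 * (\<integral>\<^sup>+x. ennreal (N x) \<partial>\<sigma>)"
proof -
  interpret R: prob_space \<rho> by (rule haarD[OF \<rho>])
  interpret S: prob_space \<sigma> by (rule invariant_sphere_measureD[OF \<sigma>])
  interpret P: pair_prob_space \<rho> \<sigma> ..
  note [measurable] = norm_onD(8)[OF N]
  note ms = measurable_sphere_borel[OF invariant_sphere_measureD(2)[OF \<sigma>]]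
  define A where "A = (\<integral>\<^sup>+g. ennreal (N (g i)) \<partial>\<rho>)"
  define M where "M = (\<integral>\<^sup>+x. ennreal (N x) \<partial>\<sigma>)"
  \<comment> \<open>The projection to \<open>Rn m\<close> is the midpoint of \<open>x\<close> and the mirror image \<open>R x\<close>.\<close>
  define R where "R x = 2 *\<^sub>R trunc m x - x" for x
  have R: "R \<in> rotations n"
  proof (rule rotationsI)
    show "linear R" unfolding R_def
      by (intro linear_compose_sub linear_compose_scale_right linear_trunc linear_id[unfolded id_def])
    show "R x \<in> Rn n" if "x \<in> Rn n" for x
      unfolding R_def using that Rn_mono[OF mn(1)] trunc_in_Rn[of m x]
      by (intro subspace_diff subspace_scale subspace_Rn) auto
    have *: "inner (trunc m x) (trunc m y) = inner (trunc m x) y" "inner x (trunc m y) = inner (trunc m x) y" for x y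
      by (simp_all add: inner_Rn[OF trunc_in_Rn] inner_commute[of x] mult.commute)
    show "inner (R x) (R y) = inner x y" for x y
      using *[of x y] by (simp add: R_def inner_diff_left inner_diff_right)
  qed
  have proj: "(\<integral>\<^sup>+x. ennreal (N (trunc m x)) \<partial>\<sigma>) \<le> M"
  proof -
    have half: "2 * ennreal (N (trunc m x)) \<le> ennreal (N x) + ennreal (N (R x))" for x
    proof -
      have "2 *\<^sub>R trunc m x = x + R x" by (simp add: R_def)
      then have "2 * N (trunc m x) \<le> N x + N (R x)"
        using norm_onD(2)[OF N, of x "R x"] norm_onD(3)[OF N, of 2 "trunc m x"] by simp
      then have "ennreal (2 * N (trunc m x)) \<le> ennreal (N x + N (R x))" by (rule ennreal_leI)
      then show ?thesis by (simp add: norm_onD(7)[OF N] ennreal_mult')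
    qed
    have "2 * (\<integral>\<^sup>+x. ennreal (N (trunc m x)) \<partial>\<sigma>) = (\<integral>\<^sup>+x. 2 * ennreal (N (trunc m x)) \<partial>\<sigma>)"
      by (rule nn_integral_cmult[symmetric]) (intro ms, measurable)
    also have "\<dots> \<le> (\<integral>\<^sup>+x. ennreal (N x) + ennreal (N (R x)) \<partial>\<sigma>)"
      by (intro nn_integral_mono half)
    also have "\<dots> = M + (\<integral>\<^sup>+x. ennreal (N (R x)) \<partial>\<sigma>)"
      unfolding M_def using measurable_compose[OF rotations_measurable[OF R], of N borel]
      by (intro nn_integral_add) (auto intro!: ms)
    also have "(\<integral>\<^sup>+x. ennreal (N (R x)) \<partial>\<sigma>) = M"
      unfolding M_def by (rule nn_integral_sphere_rotation[OF \<sigma> R]) (intro ms, measurable)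
    also have "M + M = 2 * M" by (simp add: mult_2)
    finally have "2 * (\<integral>\<^sup>+x. ennreal (N (trunc m x)) \<partial>\<sigma>) \<le> 2 * M" .
    then show ?thesis
      using ennreal_mult_le_mult_iff[of 2] by simp
  qed
  have meas: "(\<lambda>(g, x). ennreal (N (act m g (trunc m x)))) \<in> borel_measurable (\<rho> \<Otimes>\<^sub>M \<sigma>)"
  proof -
    have "(\<lambda>z. trunc m (snd z)) \<in> borel_measurable (\<rho> \<Otimes>\<^sub>M \<sigma>)"
      by (rule measurable_compose[OF measurable_snd ms]) measurable
    then have "(\<lambda>z. act m (fst z) (trunc m (snd z))) \<in> borel_measurable (\<rho> \<Otimes>\<^sub>M \<sigma>)"
      using measurable_compose[OF measurable_fst frame_component_measurable[OF haarD(2)[OF \<rho>]]]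
      by (intro act_measurable) auto
    then show ?thesis by (simp add: split_beta')
  qed
  have "(\<integral>\<^sup>+x. ennreal (norm (trunc m x)) \<partial>\<sigma>) * A = (\<integral>\<^sup>+x. ennreal (norm (trunc m x)) * A \<partial>\<sigma>)"
    by (rule nn_integral_multc[symmetric]) (intro ms, measurable)
  also have "\<dots> = (\<integral>\<^sup>+x. (\<integral>\<^sup>+g. ennreal (N (act m g (trunc m x))) \<partial>\<rho>) \<partial>\<sigma>)"
  proof (rule nn_integral_cong)
    fix x
    show "ennreal (norm (trunc m x)) * A = (\<integral>\<^sup>+g. ennreal (N (act m g (trunc m x))) \<partial>\<rho>)"
    proof (cases "trunc m x = 0")
      case True
      then show ?thesis by (simp add: linear_0[OF linear_act] norm_onD[OF N])
    next
      case False
      define z where "z = trunc m x /\<^sub>R norm (trunc m x)"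
      have z: "z \<in> Rn m" "norm z = 1"
        using False by (auto simp: z_def intro!: subspace_scale subspace_Rn)
      have xz: "trunc m x = norm (trunc m x) *\<^sub>R z" using False by (simp add: z_def)
      have "(\<integral>\<^sup>+g. ennreal (N (act m g (trunc m x))) \<partial>\<rho>)
          = (\<integral>\<^sup>+g. ennreal (norm (trunc m x)) * ennreal (N (act m g z)) \<partial>\<rho>)"
        by (subst xz) (simp add: linear_scale[OF linear_act] norm_onD[OF N] ennreal_mult' del: scaleR_scaleR)
      also have "\<dots> = ennreal (norm (trunc m x)) * (\<integral>\<^sup>+g. ennreal (N (act m g z)) \<partial>\<rho>)"
        by (rule nn_integral_cmult) (rule haar_act_measurable[OF \<rho>], measurable)
      also have "(\<integral>\<^sup>+g. ennreal (N (act m g z)) \<partial>\<rho>) = A"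
        unfolding A_def by (rule haar_unit_vector[OF \<rho> z i]) measurable
      finally show ?thesis ..
    qed
  qed
  also have "\<dots> = (\<integral>\<^sup>+g. (\<integral>\<^sup>+x. ennreal (N (act m g (trunc m x))) \<partial>\<sigma>) \<partial>\<rho>)"
    using P.Fubini'[OF meas] by simp
  also have "\<dots> = (\<integral>\<^sup>+g. (\<integral>\<^sup>+x. ennreal (N (trunc m x)) \<partial>\<sigma>) \<partial>\<rho>)"
  proof (rule nn_integral_cong)
    fix g assume "g \<in> space \<rho>"
    then have g: "g \<in> frames m" by (simp add: haarD(3)[OF \<rho>])
    show "(\<integral>\<^sup>+x. ennreal (N (act m g (trunc m x))) \<partial>\<sigma>) = (\<integral>\<^sup>+x. ennreal (N (trunc m x)) \<partial>\<sigma>)"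
      using nn_integral_sphere_rotation[OF \<sigma> act_rotations[OF g mn(1)], of "\<lambda>x. ennreal (N (trunc m x))"]
      by (simp add: trunc_act[OF g] ms)
  qed
  also have "\<dots> = (\<integral>\<^sup>+x. ennreal (N (trunc m x)) \<partial>\<sigma>)" by (simp add: R.emeasure_space_1)
  also have "\<dots> \<le> M" by (rule proj)
  finally have AM: "(\<integral>\<^sup>+x. ennreal (norm (trunc m x)) \<partial>\<sigma>) * A \<le> M" .
  define s where "s = (\<integral>\<^sup>+x. ennreal ((norm (trunc m x))\<^sup>2) \<partial>\<sigma>)"
  have "s \<le> (\<integral>\<^sup>+x. ennreal (norm (trunc m x)) \<partial>\<sigma>)"
    unfolding s_def
  proof (intro nn_integral_mono ennreal_leI)
    fix x assume "x \<in> space \<sigma>"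
    then have "norm (trunc m x) \<le> 1"
      using norm_trunc_le[of m x] by (simp add: invariant_sphere_measureD(3)[OF \<sigma>] unit_sphere_iff)
    then show "(norm (trunc m x))\<^sup>2 \<le> norm (trunc m x)"
      by (simp add: power2_eq_square mult_left_le)
  qed
  then have sA: "s * A \<le> M" using AM by (meson mult_right_mono order_trans zero_le)
  have "of_nat m \<le> of_nat m * (2 * s)"
  proof -
    have "of_nat m = of_nat n * s" unfolding s_def using sphere_second_moment[OF \<sigma> mn(1)] by simp
    also have "\<dots> \<le> of_nat (2 * m) * s"
      using mn(2) by (intro mult_right_mono) (simp_all only: ennreal_of_nat_eq_real_of_nat ennreal_leI of_nat_mono zero_le)
    finally show ?thesis by (simp add: mult_ac)
  qed
  then have "1 \<le> 2 * s"
    using i ennreal_mult_le_mult_iff[of "of_nat m" 1 "2 * s"] by (simp add: ennreal_of_nat_eq_real_of_nat)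
  then have "A \<le> 2 * s * A" by (metis mult_right_mono mult_1 zero_le)
  also have "\<dots> \<le> 2 * M" using sA by (simp add: mult.assoc mult_left_mono)
  finally show ?thesis by (simp add: A_def M_def)
qed

text \<open>
  By invariance the frame \<open>f\<close> may be composed with a random rotation \<open>g\<close> of the first \<open>m = n - j\<close>
  axes. This leaves the last \<open>j\<close> vectors alone and makes the next one uniform on the sphere of the
  complementary space, where \<open>haar_norm_le_sphere\<close> applies to the rotated norm.
\<close>

lemma haar_prod_norm_le:
  assumes N: "norm_on n N" and \<sigma>: "invariant_sphere_measure n \<sigma>" and \<rho>: "haar n \<rho>"
  shows "2 * j \<le> n \<Longrightarrow>
    (\<integral>\<^sup>+f. ennreal (\<Prod>i<j. N (f (n - 1 - i))) \<partial>\<rho>) \<le> (2 * (\<integral>\<^sup>+x. ennreal (N x) \<partial>\<sigma>)) ^ j"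
proof (induction j)
  case 0
  interpret R: prob_space \<rho> by (rule haarD[OF \<rho>])
  show ?case by (simp add: R.emeasure_space_1)
next
  case (Suc j)
  define M where "M = (\<integral>\<^sup>+x. ennreal (N x) \<partial>\<sigma>)"
  define m where "m = n - j"
  have m: "0 < m" "m \<le> n" "n \<le> 2 * m" "n - 1 - j = m - 1" using Suc.prems by (auto simp: m_def)
  obtain \<gamma> where \<gamma>: "haar m \<gamma>" using haar_exists by blast
  interpret R: prob_space \<rho> by (rule haarD[OF \<rho>])
  interpret G: prob_space \<gamma> by (rule haarD[OF \<gamma>])
  interpret P: pair_prob_space \<gamma> \<rho> ..
  note [measurable] = norm_onD(8)[OF N]
  define h where "h f = ennreal (\<Prod>i<j. N (f (n - 1 - i)))" for f
  have hm: "h \<in> borel_measurable \<rho>"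
    unfolding h_def
  proof -
    have "(\<lambda>f. N (f (n - 1 - i))) \<in> borel_measurable \<rho>" for i
      using m by (intro measurable_compose[OF frame_component_measurable[OF haarD(2)[OF \<rho>]] norm_onD(8)[OF N]]) auto
    then show "(\<lambda>f. ennreal (\<Prod>i<j. N (f (n - 1 - i)))) \<in> borel_measurable \<rho>" by measurable
  qed
  have cm: "(\<lambda>f. ennreal (N (f (m - 1)))) \<in> borel_measurable \<rho>"
    using measurable_compose[OF frame_component_measurable[OF haarD(2)[OF \<rho>], of "m - 1"] norm_onD(8)[OF N]] m
    by simp
  have split: "ennreal (\<Prod>i<Suc j. N (f (n - 1 - i))) = h f * ennreal (N (f (m - 1)))" for f
    unfolding h_def using m by (simp add: ennreal_mult'' norm_onD(7)[OF N])
  have rot: "(\<integral>\<^sup>+f. h f * ennreal (N (f (m - 1))) \<partial>\<rho>) = (\<integral>\<^sup>+f. h f * ennreal (N (act n f (g (m - 1)))) \<partial>\<rho>)"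
    if g: "g \<in> frames m" for g
  proof -
    have "(\<integral>\<^sup>+f. h f * ennreal (N (f (m - 1))) \<partial>\<rho>)
        = (\<integral>\<^sup>+f. h (\<lambda>i\<in>{..<n}. act n f (act m g (basis_vec i))) *
              ennreal (N ((\<lambda>i\<in>{..<n}. act n f (act m g (basis_vec i))) (m - 1))) \<partial>\<rho>)"
      by (rule haarD(4)[OF \<rho> act_rotations[OF g m(2)], symmetric]) (intro borel_measurable_times_ennreal hm cm)
    also have "\<dots> = (\<integral>\<^sup>+f. h f * ennreal (N (act n f (g (m - 1)))) \<partial>\<rho>)"
    proof (rule nn_integral_cong)
      fix f
      have "h (\<lambda>i\<in>{..<n}. act n f (act m g (basis_vec i))) = h f"
        unfolding h_def using Suc.prems by (intro arg_cong[of _ _ ennreal] prod.cong) (auto simp: act_basis_vec m_def)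
      then show "h (\<lambda>i\<in>{..<n}. act n f (act m g (basis_vec i))) *
              ennreal (N ((\<lambda>i\<in>{..<n}. act n f (act m g (basis_vec i))) (m - 1)))
          = h f * ennreal (N (act n f (g (m - 1))))"
        using m(1,2) by (simp add: act_basis_vec less_le_trans[OF diff_less])
    qed
    finally show ?thesis .
  qed
  have meas: "(\<lambda>(g, f). h f * ennreal (N (act n f (g (m - 1))))) \<in> borel_measurable (\<gamma> \<Otimes>\<^sub>M \<rho>)"
  proof -
    have "(\<lambda>z. act n (snd z) (fst z (m - 1))) \<in> borel_measurable (\<gamma> \<Otimes>\<^sub>M \<rho>)"
      using measurable_compose[OF measurable_snd frame_component_measurable[OF haarD(2)[OF \<rho>]]]
        measurable_compose[OF measurable_fst frame_component_measurable[OF haarD(2)[OF \<gamma>], of "m - 1"]] m(1)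
      by (intro act_measurable) auto
    moreover have "(\<lambda>z. h (snd z)) \<in> borel_measurable (\<gamma> \<Otimes>\<^sub>M \<rho>)"
      by (rule measurable_compose[OF measurable_snd hm])
    ultimately show ?thesis by (simp add: split_beta')
  qed
  have "(\<integral>\<^sup>+f. ennreal (\<Prod>i<Suc j. N (f (n - 1 - i))) \<partial>\<rho>)
      = (\<integral>\<^sup>+g. (\<integral>\<^sup>+f. h f * ennreal (N (f (m - 1))) \<partial>\<rho>) \<partial>\<gamma>)"
    unfolding split by (simp add: G.emeasure_space_1)
  also have "\<dots> = (\<integral>\<^sup>+g. (\<integral>\<^sup>+f. h f * ennreal (N (act n f (g (m - 1)))) \<partial>\<rho>) \<partial>\<gamma>)"
    by (intro nn_integral_cong rot) (simp add: haarD(3)[OF \<gamma>])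
  also have "\<dots> = (\<integral>\<^sup>+f. (\<integral>\<^sup>+g. h f * ennreal (N (act n f (g (m - 1)))) \<partial>\<gamma>) \<partial>\<rho>)"
    using P.Fubini'[OF meas] by simp
  also have "\<dots> \<le> (\<integral>\<^sup>+f. h f * (2 * M) \<partial>\<rho>)"
  proof (rule nn_integral_mono)
    fix f assume "f \<in> space \<rho>"
    then have f: "act n f \<in> rotations n" using act_rotations[of f n n] by (simp add: haarD(3)[OF \<rho>])
    have "(\<lambda>g. g (m - 1)) \<in> borel_measurable \<gamma>"
      using m by (intro frame_component_measurable[OF haarD(2)[OF \<gamma>]]) auto
    then have "(\<lambda>g. ennreal (N (act n f (g (m - 1))))) \<in> borel_measurable \<gamma>"
      by (intro measurable_compose[OF measurable_compose[OF _ measurable_compose[OF rotations_measurable[OF f] norm_onD(8)[OF N]]] measurable_ennreal])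
    then have "(\<integral>\<^sup>+g. h f * ennreal (N (act n f (g (m - 1)))) \<partial>\<gamma>) = h f * (\<integral>\<^sup>+g. ennreal (N (act n f (g (m - 1)))) \<partial>\<gamma>)"
      by (rule nn_integral_cmult)
    also have "(\<integral>\<^sup>+g. ennreal (N (act n f (g (m - 1)))) \<partial>\<gamma>) \<le> 2 * (\<integral>\<^sup>+x. ennreal (N (act n f x)) \<partial>\<sigma>)"
      using m by (intro haar_norm_le_sphere[OF norm_on_rotation[OF N f order_refl] \<sigma> \<gamma>]) auto
    also have "(\<integral>\<^sup>+x. ennreal (N (act n f x)) \<partial>\<sigma>) = M"
      unfolding M_def
      by (rule nn_integral_sphere_rotation[OF \<sigma> f]) (intro measurable_sphere_borel[OF invariant_sphere_measureD(2)[OF \<sigma>]], measurable)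
    finally show "(\<integral>\<^sup>+g. h f * ennreal (N (act n f (g (m - 1)))) \<partial>\<gamma>) \<le> h f * (2 * M)"
      by (simp add: mult_left_mono)
  qed
  also have "\<dots> = (\<integral>\<^sup>+f. h f \<partial>\<rho>) * (2 * M)" by (rule nn_integral_multc[OF hm])
  also have "\<dots> \<le> (2 * M) ^ j * (2 * M)"
    using Suc by (intro mult_right_mono) (auto simp: h_def M_def)
  finally show ?case by (simp add: M_def mult.commute)
qed

lemma haar_prod_norm_rotated_le:
  assumes N: "norm_on n N" and \<sigma>: "invariant_sphere_measure n \<sigma>" and \<rho>: "haar n \<rho>"
    and q: "q \<in> rotations n" and j: "2 * j \<le> n"
  shows "(\<integral>\<^sup>+f. ennreal (\<Prod>i<j. N (act n f (q (basis_vec i)))) \<partial>\<rho>) \<le> (2 * (\<integral>\<^sup>+x. ennreal (N x) \<partial>\<sigma>)) ^ j"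
proof -
  \<comment> \<open>The rotation that reverses the order of the axes moves the last \<open>j\<close> axes to the front.\<close>
  let ?r = "\<lambda>i\<in>{..<n}. basis_vec (n - 1 - i)"
  have "?r \<in> frames n" by (auto simp: frames_def)
  then have r: "act n ?r \<in> rotations n" by (intro act_rotations) auto
  have qr: "(\<lambda>x. q (act n ?r x)) \<in> rotations n" by (rule rotations_compose[OF q r])
  have hm: "(\<lambda>f. ennreal (\<Prod>i<j. N (f (n - 1 - i)))) \<in> borel_measurable \<rho>"
  proof (cases "j = 0")
    case False
    have "(\<lambda>f. N (f (n - 1 - i))) \<in> borel_measurable \<rho>" for i
      using False j by (intro measurable_compose[OF frame_component_measurable[OF haarD(2)[OF \<rho>]] norm_onD(8)[OF N]]) auto
    then show ?thesis by measurable
  qed simp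
  have "(\<integral>\<^sup>+f. ennreal (\<Prod>i<j. N (f (n - 1 - i))) \<partial>\<rho>)
      = (\<integral>\<^sup>+f. ennreal (\<Prod>i<j. N ((\<lambda>i\<in>{..<n}. act n f (q (act n ?r (basis_vec i)))) (n - 1 - i))) \<partial>\<rho>)"
    by (rule haarD(4)[OF \<rho> qr hm, symmetric])
  also have "\<dots> = (\<integral>\<^sup>+f. ennreal (\<Prod>i<j. N (act n f (q (basis_vec i)))) \<partial>\<rho>)"
    using j by (intro nn_integral_cong arg_cong[of _ _ ennreal] prod.cong) (auto simp: act_basis_vec)
  finally show ?thesis using haar_prod_norm_le[OF N \<sigma> \<rho> j] by simp
qed

section \<open>Volume of the unit ball of a norm\<close>

lemma unit_ball_borel:
  assumes "norm_on k N" shows "{x. N x \<le> 1} \<in> sets borel"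
  using norm_onD(1)[OF assms] by (intro borel_closed closed_Collect_le) (auto intro: continuous_intros)

text \<open>
  Integration in polar coordinates, with the average over directions written as an average over
  random frames. By invariance of Lebesgue measure the integrand may be replaced by its average over
  rotations, which depends on \<open>norm x\<close> only; each direction then contributes a Euclidean ball, and
  scaling reduces it to the unit ball.
\<close>

lemma nn_integral_unit_ball:
  assumes \<rho>: "haar k \<rho>" and k: "0 < k" and N: "norm_on k N"
  shows "(\<integral>\<^sup>+x. indicator {x. N x \<le> 1} x * ennreal (norm x ^ q) \<partial>lebesgue_Rn k)
    = (\<integral>\<^sup>+f. ennreal (inverse (N (f 0)) ^ (k + q)) \<partial>\<rho>) * (\<integral>\<^sup>+x. indicator (cball 0 1) x * ennreal (norm x ^ q) \<partial>lebesgue_Rn k)"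
proof -
  interpret R: prob_space \<rho> by (rule haarD[OF \<rho>])
  interpret L: sigma_finite_measure "lebesgue_Rn k" by (rule sigma_finite_lebesgue_Rn)
  interpret P: pair_sigma_finite \<rho> "lebesgue_Rn k" ..
  note [measurable] = norm_onD(8)[OF N] unit_ball_borel[OF N]
  define F where "F x = indicator {x. N x \<le> 1} x * ennreal (norm x ^ q)" for x
  have F [measurable]: "F \<in> borel_measurable borel" unfolding F_def[abs_def] by measurable
  define c where "c = (\<integral>\<^sup>+x. indicator (cball 0 1) x * ennreal (norm x ^ q) \<partial>lebesgue_Rn k)"
  define K :: "real \<Rightarrow> finseq \<Rightarrow> ennreal" where "K a x = indicator {x. norm x * a \<le> 1} x * ennreal (norm x ^ q)" for a x
  have comp: "(\<lambda>z. fst z i) \<in> borel_measurable (\<rho> \<Otimes>\<^sub>M lebesgue_Rn k)" if "i < k" for i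
    by (rule measurable_compose[OF measurable_fst frame_component_measurable[OF haarD(2)[OF \<rho>] that]])
  have sndm: "snd \<in> borel_measurable (\<rho> \<Otimes>\<^sub>M lebesgue_Rn k)"
    using measurable_snd[of \<rho> "lebesgue_Rn k"] by (simp cong: measurable_cong_sets)
  have m1: "(\<lambda>(f, x). F (act k f x)) \<in> borel_measurable (\<rho> \<Otimes>\<^sub>M lebesgue_Rn k)"
    using measurable_compose[OF act_measurable[OF comp sndm, of k] F] by (simp add: split_beta')
  have m2: "(\<lambda>(f, x). K (N (f 0)) x) \<in> borel_measurable (\<rho> \<Otimes>\<^sub>M lebesgue_Rn k)"
  proof -
    have [measurable]: "(\<lambda>z. N (fst z 0)) \<in> borel_measurable (\<rho> \<Otimes>\<^sub>M lebesgue_Rn k)"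
      by (rule measurable_compose[OF comp[OF k] norm_onD(8)[OF N]])
    note [measurable] = sndm
    have "(\<lambda>z. if norm (snd z) * N (fst z 0) \<le> 1 then ennreal (norm (snd z) ^ q) else 0) \<in> borel_measurable (\<rho> \<Otimes>\<^sub>M lebesgue_Rn k)"
      by measurable
    also have "(\<lambda>z. if norm (snd z) * N (fst z 0) \<le> 1 then ennreal (norm (snd z) ^ q) else 0) = (\<lambda>(f, x). K (N (f 0)) x)"
      by (auto simp: K_def)
    finally show ?thesis .
  qed
  have avg: "(\<integral>\<^sup>+f. F (act k f x) \<partial>\<rho>) = (\<integral>\<^sup>+f. K (N (f 0)) x \<partial>\<rho>)" if x: "x \<in> Rn k" for x
  proof (cases "x = 0")
    case True
    then show ?thesis by (simp add: F_def K_def linear_0[OF linear_act] norm_onD[OF N])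
  next
    case False
    define z where "z = x /\<^sub>R norm x"
    have z: "z \<in> Rn k" "norm z = 1" using False x by (auto simp: z_def intro!: subspace_scale subspace_Rn)
    have xz: "x = norm x *\<^sub>R z" using False by (simp add: z_def)
    define G where "G y = (if norm x * N y \<le> 1 then ennreal (norm x ^ q) else 0)" for y
    have "(\<integral>\<^sup>+f. F (act k f x) \<partial>\<rho>) = (\<integral>\<^sup>+f. G (act k f z) \<partial>\<rho>)"
    proof (rule nn_integral_cong)
      fix f assume "f \<in> space \<rho>"
      then have f: "act k f \<in> rotations k" using act_rotations[of f k k] by (simp add: haarD(3)[OF \<rho>])
      have "N (act k f x) = norm x * N (act k f z)"
        by (subst xz) (simp add: rotationsD(5)[OF f] norm_onD(3)[OF N] del: scaleR_scaleR)
      then show "F (act k f x) = G (act k f z)"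
        by (simp add: F_def G_def rotationsD(3)[OF f])
    qed
    also have "\<dots> = (\<integral>\<^sup>+f. G (f 0) \<partial>\<rho>)"
      by (rule haar_unit_vector[OF \<rho> z k]) (unfold G_def, measurable)
    also have "\<dots> = (\<integral>\<^sup>+f. K (N (f 0)) x \<partial>\<rho>)"
      by (intro nn_integral_cong) (simp add: G_def K_def)
    finally show ?thesis .
  qed
  have scale: "(\<integral>\<^sup>+x. K a x \<partial>lebesgue_Rn k) = ennreal (inverse a ^ (k + q)) * c" if a: "a > 0" for a
  proof -
    have "(\<integral>\<^sup>+x. K a x \<partial>lebesgue_Rn k) = ennreal (\<bar>inverse a\<bar> ^ k) * (\<integral>\<^sup>+x. K a (0 + inverse a *\<^sub>R x) \<partial>lebesgue_Rn k)"
    proof (rule nn_integral_lebesgue_Rn_affine)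
      have "K a = (\<lambda>x. if norm x * a \<le> 1 then ennreal (norm x ^ q) else 0)" by (auto simp: K_def)
      then show "K a \<in> borel_measurable borel" by simp
    qed (use a in \<open>auto simp: subspace_0 subspace_Rn\<close>)
    also have "(\<integral>\<^sup>+x. K a (0 + inverse a *\<^sub>R x) \<partial>lebesgue_Rn k)
        = (\<integral>\<^sup>+x. ennreal (inverse a ^ q) * (indicator (cball 0 1) x * ennreal (norm x ^ q)) \<partial>lebesgue_Rn k)"
    proof (rule nn_integral_cong)
      fix x :: finseq
      have "norm (inverse a *\<^sub>R x) * a = norm x" "norm (inverse a *\<^sub>R x) ^ q = inverse a ^ q * norm x ^ q"
        using a by (simp_all add: power_mult_distrib)
      moreover have "ennreal (inverse a ^ q * norm x ^ q) = ennreal (inverse a ^ q) * ennreal (norm x ^ q)"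
        using a by (intro ennreal_mult') simp
      ultimately show "K a (0 + inverse a *\<^sub>R x) = ennreal (inverse a ^ q) * (indicator (cball 0 1) x * ennreal (norm x ^ q))"
        unfolding K_def by (simp only: add_0 mem_Collect_eq indicator_def) simp
    qed
    also have "\<dots> = ennreal (inverse a ^ q) * c"
      unfolding c_def by (rule nn_integral_cmult) measurable
    also have "ennreal (\<bar>inverse a\<bar> ^ k) * (ennreal (inverse a ^ q) * c) = ennreal (inverse a ^ (k + q)) * c"
      using a by (simp add: power_add ennreal_mult mult.assoc)
    finally show ?thesis .
  qed
  have "(\<integral>\<^sup>+x. F x \<partial>lebesgue_Rn k) = (\<integral>\<^sup>+f. (\<integral>\<^sup>+x. F x \<partial>lebesgue_Rn k) \<partial>\<rho>)"
    by (simp add: R.emeasure_space_1)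
  also have "\<dots> = (\<integral>\<^sup>+f. (\<integral>\<^sup>+x. F (act k f x) \<partial>lebesgue_Rn k) \<partial>\<rho>)"
    by (intro nn_integral_cong nn_integral_lebesgue_Rn_rotation[OF act_rotations F, symmetric]) (auto simp: haarD(3)[OF \<rho>])
  also have "\<dots> = (\<integral>\<^sup>+x. (\<integral>\<^sup>+f. F (act k f x) \<partial>\<rho>) \<partial>lebesgue_Rn k)"
    using P.Fubini'[OF m1] by simp
  also have "\<dots> = (\<integral>\<^sup>+x. (\<integral>\<^sup>+f. K (N (f 0)) x \<partial>\<rho>) \<partial>lebesgue_Rn k)"
    by (rule nn_integral_cong_AE) (rule AE_mp[OF AE_lebesgue_Rn_Rn AE_I2], simp add: avg)
  also have "\<dots> = (\<integral>\<^sup>+f. (\<integral>\<^sup>+x. K (N (f 0)) x \<partial>lebesgue_Rn k) \<partial>\<rho>)"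
    using P.Fubini'[OF m2] by simp
  also have "\<dots> = (\<integral>\<^sup>+f. ennreal (inverse (N (f 0)) ^ (k + q)) * c \<partial>\<rho>)"
    by (intro nn_integral_cong scale norm_frame_pos[OF N _ k]) (simp add: haarD(3)[OF \<rho>])
  also have "\<dots> = (\<integral>\<^sup>+f. ennreal (inverse (N (f 0)) ^ (k + q)) \<partial>\<rho>) * c"
  proof (rule nn_integral_multc)
    have [measurable]: "(\<lambda>f. N (f 0)) \<in> borel_measurable \<rho>"
      by (rule measurable_compose[OF frame_component_measurable[OF haarD(2)[OF \<rho>] k] norm_onD(8)[OF N]])
    show "(\<lambda>f. ennreal (inverse (N (f 0)) ^ (k + q))) \<in> borel_measurable \<rho>" by measurable
  qed
  finally show ?thesis by (simp add: F_def c_def)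
qed

text \<open>
  For \<open>b\<close> in the unit ball of \<open>N\<close> the points \<open>(x0 + b) / 2\<close> and \<open>(x0 - b) / 2\<close> belong to it as well,
  and one of them has norm at least \<open>norm x0 / 2\<close>. The factor \<open>8 ^ k\<close> is made of \<open>2 ^ k\<close> from the
  change of variables and \<open>2 ^ (2 * k)\<close> from halving the norm.
\<close>

lemma unit_ball_moment_ge:
  assumes N: "norm_on k N" and x0: "x0 \<in> Rn k" "N x0 \<le> 1"
  shows "ennreal (norm x0 ^ (2 * k)) * emeasure (lebesgue_Rn k) {x. N x \<le> 1}
    \<le> ennreal (2 * 8 ^ k) * (\<integral>\<^sup>+x. indicator {x. N x \<le> 1} x * ennreal (norm x ^ (2 * k)) \<partial>lebesgue_Rn k)"
proof -
  note [measurable] = norm_onD(8)[OF N] unit_ball_borel[OF N]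
  define B where "B = {x. N x \<le> 1}"
  define F where "F x = indicator B x * ennreal (norm x ^ (2 * k))" for x
  have B [measurable]: "B \<in> sets borel" unfolding B_def by measurable
  have F [measurable]: "F \<in> borel_measurable borel" unfolding F_def[abs_def] by measurable
  define I where "I = (\<integral>\<^sup>+x. F x \<partial>lebesgue_Rn k)"
  define a where "a = (1/2) *\<^sub>R x0"
  have a: "a \<in> Rn k" using x0 by (auto simp: a_def intro: subspace_scale subspace_Rn)
  have Ip: "I = ennreal ((1/2) ^ k) * (\<integral>\<^sup>+x. F (a + (1/2) *\<^sub>R x) \<partial>lebesgue_Rn k)"
    using nn_integral_lebesgue_Rn_affine[OF F a, of "1/2"] by (simp add: I_def)
  have Im: "I = ennreal ((1/2) ^ k) * (\<integral>\<^sup>+x. F (a + (-1/2) *\<^sub>R x) \<partial>lebesgue_Rn k)"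
    using nn_integral_lebesgue_Rn_affine[OF F a, of "-1/2"] by (simp add: I_def)
  have pt: "ennreal ((norm x0 / 2) ^ (2 * k)) * indicator B x \<le> F (a + (1/2) *\<^sub>R x) + F (a + (-1/2) *\<^sub>R x)" for x
  proof (cases "x \<in> B")
    case True
    let ?p = "a + (1/2) *\<^sub>R x" and ?m = "a + (-1/2) *\<^sub>R x"
    have "N ((1/2) *\<^sub>R x0) + N (c *\<^sub>R x) \<le> 1" if "\<bar>c\<bar> = 1/2" for c
    proof -
      have "N (c *\<^sub>R x) = 1/2 * N x" "N ((1/2) *\<^sub>R x0) = 1/2 * N x0"
        unfolding norm_onD(3)[OF N] that by simp_all
      moreover have "N x \<le> 1" using True by (simp add: B_def)
      ultimately show ?thesis using x0(2) by linarith
    qed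
    from this[of "1/2"] this[of "-1/2"] have B: "?p \<in> B" "?m \<in> B"
      using norm_onD(2)[OF N, of a "(1/2) *\<^sub>R x"] norm_onD(2)[OF N, of a "(-1/2) *\<^sub>R x"]
      by (auto simp: B_def a_def)
    have "?p + ?m = (1/2 + 1/2) *\<^sub>R x0" unfolding a_def scaleR_left_distrib by simp
    then have "?p + ?m = x0" by simp
    then have "norm x0 \<le> norm ?p + norm ?m" by (metis norm_triangle_ineq)
    then have "norm x0 / 2 \<le> norm ?p \<or> norm x0 / 2 \<le> norm ?m" by linarith
    then have "ennreal ((norm x0 / 2) ^ (2 * k)) \<le> ennreal (norm ?p ^ (2 * k)) \<or>
        ennreal ((norm x0 / 2) ^ (2 * k)) \<le> ennreal (norm ?m ^ (2 * k))"
      by (auto intro!: ennreal_leI power_mono)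
    then have "ennreal ((norm x0 / 2) ^ (2 * k)) \<le> ennreal (norm ?p ^ (2 * k)) + ennreal (norm ?m ^ (2 * k))"
      by (metis add_increasing add_increasing2 zero_le)
    then show ?thesis using True B by (simp add: F_def)
  qed simp
  have "ennreal ((norm x0 / 2) ^ (2 * k)) * emeasure (lebesgue_Rn k) B
      = (\<integral>\<^sup>+x. ennreal ((norm x0 / 2) ^ (2 * k)) * indicator B x \<partial>lebesgue_Rn k)"
    by (subst nn_integral_cmult) auto
  also have "\<dots> \<le> (\<integral>\<^sup>+x. F (a + (1/2) *\<^sub>R x) + F (a + (-1/2) *\<^sub>R x) \<partial>lebesgue_Rn k)"
    by (intro nn_integral_mono pt)
  also have "\<dots> = (\<integral>\<^sup>+x. F (a + (1/2) *\<^sub>R x) \<partial>lebesgue_Rn k) + (\<integral>\<^sup>+x. F (a + (-1/2) *\<^sub>R x) \<partial>lebesgue_Rn k)"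
    by (rule nn_integral_add) measurable
  finally have "ennreal ((1/2) ^ k) * (ennreal ((norm x0 / 2) ^ (2 * k)) * emeasure (lebesgue_Rn k) B) \<le> I + I"
    unfolding distrib_left[symmetric]
    by (subst (1) Ip, subst Im) (simp only: distrib_left[symmetric] mult_left_mono zero_le)
  then have "ennreal (8 ^ k) * (ennreal ((1/2) ^ k) * (ennreal ((norm x0 / 2) ^ (2 * k)) * emeasure (lebesgue_Rn k) B))
      \<le> ennreal (8 ^ k) * (2 * I)"
    by (intro mult_left_mono) (auto simp: mult_2)
  moreover have "8 ^ k * ((1/2) ^ k * (norm x0 / 2) ^ (2 * k)) = norm x0 ^ (2 * k)"
  proof -
    have "8 ^ k * ((1/2) ^ k * (norm x0 / 2) ^ (2 * k)) = (8 * (1/2 * (norm x0 / 2)\<^sup>2)) ^ k"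
      unfolding power_mult power_mult_distrib[symmetric] ..
    also have "8 * (1/2 * (norm x0 / 2)\<^sup>2) = (norm x0)\<^sup>2" by (simp add: power2_eq_square)
    finally show ?thesis by (simp add: power_mult)
  qed
  moreover have "ennreal (8 ^ k) * (ennreal ((1/2) ^ k) * (ennreal u * v)) = ennreal (8 ^ k * ((1/2) ^ k * u)) * v"
    if "u \<ge> 0" for u v using that by (simp add: ennreal_mult' mult.assoc)
  moreover have "ennreal (8 ^ k) * (2 * I) = ennreal (2 * 8 ^ k) * I"
    by (simp add: ennreal_mult' mult_ac)
  ultimately show ?thesis
    by (simp add: B_def[symmetric] F_def[symmetric] I_def[symmetric] del: power_divide)
qed

text \<open>
  The inequality of arithmetic and geometric means bounds the mean of the reciprocal of the product
  by the first factor, since all vectors of a random frame have the same distribution. The reciprocal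
  of the product and the product itself have means with product at least 1 by Cauchy-Schwarz.
\<close>

lemma haar_inverse_power_ge:
  assumes \<rho>: "haar k \<rho>" and k: "0 < k" and N: "norm_on k N"
  shows "1 \<le> (\<integral>\<^sup>+f. ennreal (inverse (N (f 0)) ^ k) \<partial>\<rho>) * (\<integral>\<^sup>+f. ennreal (\<Prod>i<k. N (f i)) \<partial>\<rho>)"
proof -
  interpret R: prob_space \<rho> by (rule haarD[OF \<rho>])
  have inv_power: "(\<lambda>x. ennreal (inverse (N x) ^ k)) \<in> borel_measurable borel"
    using norm_onD(8)[OF N] by measurable
  have [measurable]: "(\<lambda>f. N (f i)) \<in> borel_measurable \<rho>" if "i < k" for i
    by (rule measurable_compose[OF frame_component_measurable[OF haarD(2)[OF \<rho>] that] norm_onD(8)[OF N]])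
  define P where "P f = (\<Prod>i<k. N (f i))" for f
  have Pm [measurable]: "P \<in> borel_measurable \<rho>"
    unfolding P_def[abs_def] by (rule borel_measurable_prod) simp
  have pos: "N (f i) > 0" if "f \<in> space \<rho>" "i < k" for f i
    using that by (intro norm_frame_pos[OF N]) (auto simp: haarD(3)[OF \<rho>])
  have Ppos: "P f > 0" if "f \<in> space \<rho>" for f
    unfolding P_def using pos[OF that] by (intro prod_pos) auto
  define J where "J = (\<integral>\<^sup>+f. ennreal (inverse (N (f 0)) ^ k) \<partial>\<rho>)"
  have amgm: "inverse (P f) \<le> (\<Sum>i<k. inverse (N (f i)) ^ k / k)" if f: "f \<in> space \<rho>" for f
  proof -
    have "(\<Prod>i<k. inverse (N (f i)) ^ k) powr (1 / card {..<k}) \<le> (\<Sum>i<k. inverse (N (f i)) ^ k / card {..<k})"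
      using k pos[OF f] by (intro arith_geom_mean) (auto intro!: less_imp_le)
    moreover have "(\<Prod>i<k. inverse (N (f i)) ^ k) = inverse (P f) ^ k"
      by (simp add: P_def prod_power_distrib prod_inversef[symmetric] comp_def del: power_inverse)
    moreover have "(inverse (P f) ^ k) powr (1 / real k) = inverse (P f)"
      using Ppos[OF f] k by (simp add: powr_realpow[symmetric] powr_powr)
    ultimately show ?thesis by simp
  qed
  have "(\<integral>\<^sup>+f. ennreal (inverse (P f)) \<partial>\<rho>) \<le> (\<integral>\<^sup>+f. (\<Sum>i<k. ennreal (inverse (N (f i)) ^ k) / of_nat k) \<partial>\<rho>)"
  proof (rule nn_integral_mono)
    fix f assume f: "f \<in> space \<rho>"
    have "(\<Sum>i<k. ennreal (inverse (N (f i)) ^ k) / of_nat k) = (\<Sum>i<k. ennreal (inverse (N (f i)) ^ k / k))"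
      using k pos[OF f] by (intro sum.cong refl) (simp add: divide_ennreal[symmetric] ennreal_of_nat_eq_real_of_nat less_imp_le)
    also have "\<dots> = ennreal (\<Sum>i<k. inverse (N (f i)) ^ k / k)"
      using pos[OF f] by (intro sum_ennreal) (auto intro!: less_imp_le divide_nonneg_nonneg zero_le_power)
    finally show "ennreal (inverse (P f)) \<le> (\<Sum>i<k. ennreal (inverse (N (f i)) ^ k) / of_nat k)"
      using amgm[OF f] by (simp add: ennreal_leI)
  qed
  also have "\<dots> = (\<Sum>i<k. (\<integral>\<^sup>+f. ennreal (inverse (N (f i)) ^ k) / of_nat k \<partial>\<rho>))"
    by (rule nn_integral_sum) simp
  also have "\<dots> = (\<Sum>i<k. J / of_nat k)"
  proof (rule sum.cong[OF refl])
    fix i assume "i \<in> {..<k}"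
    then have i: "i < k" by simp
    have "(\<integral>\<^sup>+f. ennreal (inverse (N (f i)) ^ k) / of_nat k \<partial>\<rho>) = (\<integral>\<^sup>+f. ennreal (inverse (N (f i)) ^ k) \<partial>\<rho>) / of_nat k"
      using i by (intro nn_integral_divide) simp
    also have "(\<integral>\<^sup>+f. ennreal (inverse (N (f i)) ^ k) \<partial>\<rho>) = J"
      unfolding J_def by (rule haar_same_component[OF \<rho> i k inv_power])
    finally show "(\<integral>\<^sup>+f. ennreal (inverse (N (f i)) ^ k) / of_nat k \<partial>\<rho>) = J / of_nat k" .
  qed
  also have "\<dots> = J"
    using k by (simp add: ennreal_times_divide ennreal_mult_divide_eq mult.commute)
  finally have le: "(\<integral>\<^sup>+f. ennreal (inverse (P f)) \<partial>\<rho>) \<le> J" .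
  have "(\<integral>\<^sup>+f. ennreal (sqrt (inverse (P f))) * ennreal (sqrt (P f)) \<partial>\<rho>) = (\<integral>\<^sup>+f. 1 \<partial>\<rho>)"
    using Ppos by (intro nn_integral_cong)
      (simp add: ennreal_mult[symmetric] real_sqrt_mult[symmetric] less_imp_le less_imp_neq[THEN not_sym])
  then have "1 = (\<integral>\<^sup>+f. ennreal (sqrt (inverse (P f))) * ennreal (sqrt (P f)) \<partial>\<rho>)\<^sup>2"
    by (simp add: R.emeasure_space_1)
  also have "\<dots> \<le> (\<integral>\<^sup>+f. (ennreal (sqrt (inverse (P f))))\<^sup>2 \<partial>\<rho>) * (\<integral>\<^sup>+f. (ennreal (sqrt (P f)))\<^sup>2 \<partial>\<rho>)"
    by (rule Cauchy_Schwarz_nn_integral) measurable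
  also have "\<dots> = (\<integral>\<^sup>+f. ennreal (inverse (P f)) \<partial>\<rho>) * (\<integral>\<^sup>+f. ennreal (P f) \<partial>\<rho>)"
    using Ppos by (intro arg_cong2[of _ _ _ _ "(*)"] nn_integral_cong) (simp_all add: ennreal_power less_imp_le)
  also have "\<dots> \<le> J * (\<integral>\<^sup>+f. ennreal (P f) \<partial>\<rho>)" using le by (rule mult_right_mono) simp
  finally show ?thesis by (simp add: J_def P_def)
qed

text \<open>
  The radius in the direction of \<open>y\<close>, bounded by two averages that are well behaved when the section
  varies. Both sides of \<open>unit_ball_moment_ge\<close> are rewritten in polar coordinates, with the moment of the
  Euclidean ball estimated by its volume, and the volume average is then replaced by
  \<open>haar_inverse_power_ge\<close>.
\<close>

lemma norm_power_le_averages: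
  assumes \<rho>: "haar k \<rho>" and k: "0 < k" and N: "norm_on k N" and y: "y \<in> Rn k"
  shows "(ennreal ((norm y / N y) ^ k))\<^sup>2 \<le> ennreal (2 * 8 ^ k) *
    (\<integral>\<^sup>+f. ennreal (inverse (N (f 0)) ^ (3 * k)) \<partial>\<rho>) * (\<integral>\<^sup>+f. ennreal (\<Prod>i<k. N (f i)) \<partial>\<rho>)"
proof (cases "y = 0")
  case True
  then show ?thesis using k by (simp add: zero_power)
next
  case False
  have Ny: "N y > 0" using norm_onD(4)[OF N y False] .
  define x0 where "x0 = y /\<^sub>R N y"
  have x0: "x0 \<in> Rn k" "N x0 \<le> 1" "norm x0 = norm y / N y"
    using y Ny by (auto simp: x0_def norm_onD(3)[OF N] divide_inverse mult.commute intro!: subspace_scale subspace_Rn)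
  define J where "J p = (\<integral>\<^sup>+f. ennreal (inverse (N (f 0)) ^ p) \<partial>\<rho>)" for p
  define Y where "Y = (\<integral>\<^sup>+f. ennreal (\<Prod>i<k. N (f i)) \<partial>\<rho>)"
  have vol: "emeasure (lebesgue_Rn k) {x. N x \<le> 1} = J k * ball_volume k"
  proof -
    have "emeasure (lebesgue_Rn k) {x. N x \<le> 1} = (\<integral>\<^sup>+x. indicator {x. N x \<le> 1} x * ennreal (norm x ^ 0) \<partial>lebesgue_Rn k)"
      using unit_ball_borel[OF N] by simp
    also have "\<dots> = J k * (\<integral>\<^sup>+x. indicator (cball 0 1) x * ennreal (norm x ^ 0) \<partial>lebesgue_Rn k)"
      unfolding J_def nn_integral_unit_ball[OF \<rho> k N] by simp
    finally show ?thesis by (simp add: ball_volume_def)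
  qed
  have mom: "(\<integral>\<^sup>+x. indicator {x. N x \<le> 1} x * ennreal (norm x ^ (2 * k)) \<partial>lebesgue_Rn k) \<le> J (3 * k) * ball_volume k"
  proof -
    have "(\<integral>\<^sup>+x. indicator {x. N x \<le> 1} x * ennreal (norm x ^ (2 * k)) \<partial>lebesgue_Rn k)
        = J (3 * k) * (\<integral>\<^sup>+x. indicator (cball 0 1) x * ennreal (norm x ^ (2 * k)) \<partial>lebesgue_Rn k)"
      unfolding J_def nn_integral_unit_ball[OF \<rho> k N] by (simp add: algebra_simps numeral_3_eq_3)
    also have "(\<integral>\<^sup>+x. indicator (cball 0 1) x * ennreal (norm x ^ (2 * k)) \<partial>lebesgue_Rn k)
        \<le> (\<integral>\<^sup>+x. indicator (cball 0 1) x \<partial>lebesgue_Rn k)"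
      by (intro nn_integral_mono) (auto simp: indicator_def power_le_one)
    also have "\<dots> = ball_volume k" by (simp add: ball_volume_def)
    finally show ?thesis by (simp add: mult_left_mono)
  qed
  have "ball_volume k * (ennreal (norm x0 ^ (2 * k)) * J k) \<le> ball_volume k * (ennreal (2 * 8 ^ k) * J (3 * k))"
    using order_trans[OF unit_ball_moment_ge[OF N x0(1,2)] mult_left_mono[OF mom]] by (simp add: vol mult_ac)
  then have le: "ennreal (norm x0 ^ (2 * k)) * J k \<le> ennreal (2 * 8 ^ k) * J (3 * k)"
    using ball_volume_pos[of k] ball_volume_finite[of k] by (subst (asm) ennreal_mult_le_mult_iff) auto
  have "(ennreal ((norm y / N y) ^ k))\<^sup>2 = ennreal (norm x0 ^ (2 * k))"
    using Ny by (simp add: x0(3) ennreal_power power_mult[symmetric] mult.commute[of k])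
  also have "\<dots> \<le> ennreal (norm x0 ^ (2 * k)) * (J k * Y)"
    using mult_left_mono[OF haar_inverse_power_ge[OF \<rho> k N], of "ennreal (norm x0 ^ (2 * k))"] by (simp add: J_def Y_def)
  also have "\<dots> \<le> ennreal (2 * 8 ^ k) * J (3 * k) * Y"
    using mult_right_mono[OF le, of Y] by (simp add: mult.assoc)
  finally show ?thesis by (simp add: J_def Y_def)
qed

section \<open>The Grassmannian as a measurable space\<close>

lemma grassmannian_image:
  assumes T: "T \<in> rotations n" and E: "E \<in> grassmannian n k"
  shows "T ` E \<in> grassmannian n k"
proof -
  have E': "subspace E" "E \<subseteq> Rn n" "dim E = k" using E by (auto simp: grassmannian_def)
  have lin: "linear T" by (rule rotationsD(1)[OF T])
  obtain B where B: "B \<subseteq> E" "independent B" "E \<subseteq> span B" "card B = dim E"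
    by (rule basis_exists)
  have span: "span B = E" using B E' by (simp add: span_minimal subset_antisym)
  have inj: "inj_on T S" for S
    using orthogonal_transformation_inj[of T] T by (auto simp: rotations_def intro: inj_on_subset)
  have "independent (T ` B)" by (rule linear_independent_injective_image[OF lin B(2) inj])
  moreover have "span (T ` B) = T ` E" by (simp add: linear_span_image[OF lin] span)
  ultimately have "dim (T ` E) = card (T ` B)"
    by (metis dim_eq_card span_span)
  also have "\<dots> = k" using card_image[OF inj[of B]] B E' by simp
  finally show ?thesis
    using E' rotationsD(9)[OF T] by (auto simp: grassmannian_def intro!: linear_subspace_image lin)
qed

lemma orth_proj_image:
  assumes T: "T \<in> rotations n" and E: "E \<in> grassmannian n k" and w: "w \<in> Rn n" "T w = trunc n y"
  shows "orth_proj (T ` E) y = T (orth_proj E w)"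
proof (rule orth_proj_unique)
  show "subspace (T ` E)" "T (orth_proj E w) \<in> T ` E"
    using grassmannian_image[OF T E] orth_proj(1)[OF E] by (auto simp: grassmannian_def)
  fix z assume "z \<in> T ` E"
  then obtain v where v: "v \<in> E" "z = T v" by auto
  have z: "z \<in> Rn n" using v E rotationsD(9)[OF T] by (auto simp: grassmannian_def)
  have "inner (y - trunc n y) z = 0"
    using inner_Rn[OF z, of "y - trunc n y"] by (simp add: inner_commute)
  moreover have "inner (trunc n y - T (orth_proj E w)) z = inner (w - orth_proj E w) v"
    by (simp add: v(2) w(2)[symmetric] rotationsD(2)[OF T] flip: rotationsD(7)[OF T])
  moreover have "\<dots> = 0" using orth_proj(2)[OF E v(1)] by (simp add: orthogonal_def)
  ultimately show "orthogonal (y - T (orth_proj E w)) z"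
    by (simp add: orthogonal_def inner_diff_left)
qed

text \<open>
  The projection onto \<open>T ` E\<close> is conjugate to the projection onto \<open>E\<close> on \<open>Rn n\<close>. Hence the
  action of \<open>T\<close> on the Grassmannian does not increase distances; in particular it is continuous.
\<close>

lemma gap_image_le:
  assumes T: "T \<in> rotations n" and E: "E \<in> grassmannian n k" and F: "F \<in> grassmannian n k"
  shows "gap (T ` E) (T ` F) \<le> gap E F"
  unfolding gap_grassmannian(1)[OF grassmannian_image[OF T E] grassmannian_image[OF T F]]
proof (rule onorm_bound)
  show "0 \<le> gap E F" by (simp add: gap_def)
  fix y
  obtain w where w: "w \<in> Rn n" "T w = trunc n y" using rotations_preimage[OF T trunc_in_Rn] by metis
  have "norm (orth_proj (T ` E) y - orth_proj (T ` F) y) = norm (orth_proj E w - orth_proj F w)"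
    unfolding orth_proj_image[OF T E w] orth_proj_image[OF T F w]
    by (simp flip: rotationsD(7)[OF T] add: rotationsD(3)[OF T])
  also have "\<dots> \<le> gap E F * norm w"
    using onorm[OF gap_grassmannian(2)[OF E F]] by (simp add: gap_grassmannian(1)[OF E F])
  also have "norm w \<le> norm y" using norm_trunc_le[of n y] rotationsD(3)[OF T, of w] w by simp
  finally show "norm (orth_proj (T ` E) y - orth_proj (T ` F) y) \<le> gap E F * norm y"
    by (simp add: gap_def mult_left_mono)
qed

lemma invariant_grassmannian_measureD:
  assumes "invariant_grassmannian_measure n k \<mu>"
  shows "prob_space \<mu>" "space \<mu> = grassmannian n k"
    "U \<subseteq> grassmannian n k \<Longrightarrow>
      (\<And>E. E \<in> U \<Longrightarrow> \<exists>r>0. \<forall>F\<in>grassmannian n k. gap E F < r \<longrightarrow> F \<in> U) \<Longrightarrow> U \<in> sets \<mu>"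
    "T \<in> rotations n \<Longrightarrow> image T \<in> measurable \<mu> \<mu>"
    "T \<in> rotations n \<Longrightarrow> F \<in> borel_measurable \<mu> \<Longrightarrow> (\<integral>\<^sup>+E. F (T ` E) \<partial>\<mu>) = (\<integral>\<^sup>+E. F E \<partial>\<mu> :: ennreal)"
proof -
  interpret M: Metric_space "grassmannian n k" gap by (rule Metric_space_gap)
  let ?O = "{U. openin M.mtopology U}"
  have sub: "?O \<subseteq> Pow (grassmannian n k)" using openin_subset by fastforce
  have sets: "sets \<mu> = sets (sigma (grassmannian n k) ?O)"
    using assms by (simp add: invariant_grassmannian_measure_def)
  show "prob_space \<mu>" using assms by (simp add: invariant_grassmannian_measure_def)
  show space: "space \<mu> = grassmannian n k"
    using sets_eq_imp_space_eq[OF sets] sub by (simp add: space_measure_of)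
  have open_sets: "U \<in> sets \<mu>" if "U \<subseteq> grassmannian n k"
    "\<And>E. E \<in> U \<Longrightarrow> \<exists>r>0. \<forall>F\<in>grassmannian n k. gap E F < r \<longrightarrow> F \<in> U" for U
  proof -
    have "openin M.mtopology U"
      unfolding M.openin_mtopology using that by (fastforce simp: subset_iff)
    then have "U \<in> sigma_sets (grassmannian n k) ?O" by (intro sigma_sets.Basic) simp
    then show ?thesis unfolding sets sets_measure_of[OF sub] .
  qed
  then show "U \<subseteq> grassmannian n k \<Longrightarrow>
      (\<And>E. E \<in> U \<Longrightarrow> \<exists>r>0. \<forall>F\<in>grassmannian n k. gap E F < r \<longrightarrow> F \<in> U) \<Longrightarrow> U \<in> sets \<mu>"
    by blast
  show meas: "image T \<in> measurable \<mu> \<mu>" if T: "T \<in> rotations n"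
  proof -
    have "image T \<in> measurable \<mu> (sigma (grassmannian n k) ?O)"
    proof (rule measurable_measure_of[OF sub])
      show "image T \<in> space \<mu> \<rightarrow> grassmannian n k" using grassmannian_image[OF T] by (auto simp: space)
      fix U assume "U \<in> ?O"
      then have U: "\<And>E. E \<in> U \<Longrightarrow> \<exists>r>0. M.mball E r \<subseteq> U" by (simp add: M.openin_mtopology)
      show "image T -` U \<inter> space \<mu> \<in> sets \<mu>"
      proof (rule open_sets)
        show "image T -` U \<inter> space \<mu> \<subseteq> grassmannian n k" by (simp add: space)
        fix E assume E: "E \<in> image T -` U \<inter> space \<mu>"
        then obtain r where r: "r > 0" "M.mball (T ` E) r \<subseteq> U" using U by auto
        have EG: "E \<in> grassmannian n k" using E by (simp add: space)
        have "F \<in> image T -` U \<inter> space \<mu>" if F: "F \<in> grassmannian n k" "gap E F < r" for F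
          using r(2) gap_image_le[OF T EG F(1)] F grassmannian_image[OF T EG] grassmannian_image[OF T F(1)]
          by (auto simp: space subset_iff)
        then show "\<exists>r>0. \<forall>F\<in>grassmannian n k. gap E F < r \<longrightarrow> F \<in> image T -` U \<inter> space \<mu>"
          using r(1) by blast
      qed
    qed
    then show ?thesis by (simp cong: measurable_cong_sets add: sets)
  qed
  show "(\<integral>\<^sup>+E. F (T ` E) \<partial>\<mu>) = (\<integral>\<^sup>+E. F E \<partial>\<mu>)" if T: "T \<in> rotations n" and F: "F \<in> borel_measurable \<mu>"
    for F :: "finseq set \<Rightarrow> ennreal"
  proof -
    have "distr \<mu> \<mu> (image T) = \<mu>" using assms T by (simp add: invariant_grassmannian_measure_def)
    then show ?thesis using nn_integral_distr[OF meas[OF T] , of F] F by simp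
  qed
qed

text \<open>
  The projection of a fixed vector depends continuously on the subspace.
\<close>

lemma orth_proj_measurable:
  assumes \<mu>: "invariant_grassmannian_measure n k \<mu>"
  shows "(\<lambda>E. orth_proj E x) \<in> borel_measurable \<mu>"
proof (rule borel_measurableI)
  fix V :: "finseq set" assume V: "open V"
  note space = invariant_grassmannian_measureD(2)[OF \<mu>]
  show "(\<lambda>E. orth_proj E x) -` V \<inter> space \<mu> \<in> sets \<mu>"
  proof (rule invariant_grassmannian_measureD(3)[OF \<mu>])
    show "(\<lambda>E. orth_proj E x) -` V \<inter> space \<mu> \<subseteq> grassmannian n k" by (simp add: space)
    fix E assume "E \<in> (\<lambda>E. orth_proj E x) -` V \<inter> space \<mu>"
    then have E: "E \<in> grassmannian n k" "orth_proj E x \<in> V" by (auto simp: space)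
    then obtain e where e: "e > 0" "ball (orth_proj E x) e \<subseteq> V" using V by (meson openE)
    have "F \<in> (\<lambda>E. orth_proj E x) -` V \<inter> space \<mu>" if F: "F \<in> grassmannian n k" "gap E F < e / (norm x + 1)" for F
    proof -
      have "norm (orth_proj E x - orth_proj F x) \<le> gap E F * norm x"
        using onorm[OF gap_grassmannian(2)[OF E(1) F(1)]] by (simp add: gap_grassmannian(1)[OF E(1) F(1)])
      also have "\<dots> \<le> gap E F * (norm x + 1)" by (intro mult_left_mono) (auto simp: gap_def)
      also have "\<dots> < e" using F(2) by (simp add: pos_less_divide_eq add_nonneg_pos)
      finally have "orth_proj F x \<in> ball (orth_proj E x) e" by (simp add: dist_norm)
      then show ?thesis using e F by (auto simp: space)
    qed
    then show "\<exists>r>0. \<forall>F\<in>grassmannian n k. gap E F < r \<longrightarrow> F \<in> (\<lambda>E. orth_proj E x) -` V \<inter> space \<mu>"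
      using e(1) by (intro exI[of _ "e / (norm x + 1)"]) (auto simp: add_nonneg_pos)
  qed
qed

section \<open>The radius of a section\<close>

text \<open>
  A countable set of test vectors: their projections are dense in every subspace, which turns suprema
  over a section into countable suprema and makes them measurable in the section.
\<close>

definition dense_points :: "finseq set" where
  "dense_points = (SOME D. countable D \<and> (\<forall>X. open X \<longrightarrow> X \<noteq> {} \<longrightarrow> (\<exists>d\<in>D. d \<in> X)))"

lemma dense_points: "countable dense_points" "open X \<Longrightarrow> X \<noteq> {} \<Longrightarrow> \<exists>d\<in>dense_points. d \<in> X"
  using someI_ex[OF countable_dense_exists[where 'a = finseq]] unfolding dense_points_def by auto

text \<open>
  The \<open>k\<close>-th power of the largest Euclidean norm of a vector of \<open>E\<close> in the unit ball of \<open>N \<circ> T\<close>.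
\<close>

definition radius_power :: "nat \<Rightarrow> (finseq \<Rightarrow> real) \<Rightarrow> (finseq \<Rightarrow> finseq) \<Rightarrow> finseq set \<Rightarrow> ennreal" where
  "radius_power k N T E = (SUP d\<in>dense_points. ennreal ((norm (orth_proj E d) / N (T (orth_proj E d))) ^ k))"

lemma orth_proj_id: "E \<in> grassmannian n k \<Longrightarrow> y \<in> E \<Longrightarrow> orth_proj E y = y"
  by (intro orth_proj_unique) (auto simp: grassmannian_def orthogonal_def)

lemma le_radius_power:
  assumes N: "norm_on n N" and T: "T \<in> rotations n" and E: "E \<in> grassmannian n k" and y: "y \<in> E" and j: "0 < j"
  shows "ennreal ((norm y / N (T y)) ^ j) \<le> radius_power j N T E"
proof (cases "y = 0")
  case True
  then show ?thesis using j by (simp add: zero_power)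
next
  case False
  let ?\<phi> = "\<lambda>d. ennreal ((norm (orth_proj E d) / N (T (orth_proj E d))) ^ j)"
  have Py: "orth_proj E y = y" by (rule orth_proj_id[OF E y])
  have "y \<in> Rn n" using E y by (auto simp: grassmannian_def)
  then have pos: "N (T y) > 0"
    using False rotationsD(3)[OF T, of y] by (intro norm_onD(4)[OF N] rotationsD(9)[OF T]) auto
  \<comment> \<open>The quotient is continuous at \<open>y\<close>, which the projection fixes, so a test vector close to \<open>y\<close> comes close to its value.\<close>
  have NT: "continuous_on UNIV (\<lambda>x. N (T x))" by (rule norm_onD(1)[OF norm_on_rotation[OF N T order_refl]])
  have cP: "isCont (orth_proj E) y"
    using bounded_linear_orth_proj[OF E] by (rule linear_continuous_at)
  have cNT: "isCont (\<lambda>d. N (T (orth_proj E d))) y"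
    using isCont_o2[OF cP, of "\<lambda>x. N (T x)"] NT by (simp add: continuous_on_eq_continuous_at)
  have c: "isCont (\<lambda>d. (norm (orth_proj E d) / N (T (orth_proj E d))) ^ j) y"
    using pos by (intro continuous_intros cP cNT) (simp add: Py)
  have c: "(?\<phi> \<longlongrightarrow> ?\<phi> y) (nhds y)"
    by (intro tendsto_ennrealI iffD1[OF tendsto_at_iff_tendsto_nhds c[unfolded isCont_def]])
  show ?thesis
  proof (rule ccontr)
    assume "\<not> ?thesis"
    then have "radius_power j N T E < ?\<phi> y" by (simp add: Py)
    then have "eventually (\<lambda>d. radius_power j N T E < ?\<phi> d) (nhds y)" by (rule order_tendstoD(1)[OF c])
    then obtain S where S: "open S" "y \<in> S" "\<And>d. d \<in> S \<Longrightarrow> radius_power j N T E < ?\<phi> d"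
      unfolding eventually_nhds by auto
    then obtain d where d: "d \<in> dense_points" "d \<in> S" using dense_points(2)[of S] by auto
    have "?\<phi> d \<le> radius_power j N T E" unfolding radius_power_def using d(1) by (rule SUP_upper)
    with S(3)[OF d(2)] show False by simp
  qed
qed

lemma radius_power_image_le:
  assumes N: "norm_on n N" and T: "T \<in> rotations n" and E: "E \<in> grassmannian n k" and j: "0 < j"
  shows "radius_power j N (\<lambda>x. x) (T ` E) \<le> radius_power j N T E"
  unfolding radius_power_def[of j N "\<lambda>x. x"]
proof (rule SUP_least)
  fix d
  have "orth_proj (T ` E) d \<in> T ` E" by (rule orth_proj(1)[OF grassmannian_image[OF T E]])
  then obtain y where y: "y \<in> E" "orth_proj (T ` E) d = T y" by auto
  then show "ennreal ((norm (orth_proj (T ` E) d) / N (orth_proj (T ` E) d)) ^ j) \<le> radius_power j N T E"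
    using le_radius_power[OF N T E y(1) j] by (simp add: rotationsD(3)[OF T])
qed

text \<open>
  The difference of two points of the section is twice a point of the section, by symmetry and
  convexity.
\<close>

lemma diameter_power_le_radius:
  assumes N: "norm_on n N" and E: "E \<in> grassmannian n k" and j: "0 < j"
    and K: "convex K" "uminus ` K = K" "bounded K" "\<And>x. x \<in> K \<Longrightarrow> N x \<le> 1"
  shows "ennreal (diameter (K \<inter> E) ^ j) \<le> ennreal (2 ^ j) * radius_power j N (\<lambda>x. x) E"
proof (cases "radius_power j N (\<lambda>x. x) E")
  case (real r)
  have "diameter (K \<inter> E) \<le> 2 * root j r"
  proof (rule diameter_le)
    show "K \<inter> E \<noteq> {} \<or> 0 \<le> 2 * root j r" using real(1) j by (simp add: real_root_ge_zero)
    fix x y assume x: "x \<in> K \<inter> E" and y: "y \<in> K \<inter> E"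
    have "- y \<in> K" using K(2) y by blast
    define z where "z = (1/2) *\<^sub>R x + (1/2) *\<^sub>R (- y)"
    have zK: "z \<in> K" unfolding z_def using x \<open>- y \<in> K\<close> by (intro convexD[OF K(1)]) auto
    have "subspace E" using E by (simp add: grassmannian_def)
    then have zE: "z \<in> E" unfolding z_def using x y by (intro subspace_add subspace_scale subspace_neg) auto
    have "norm z \<le> norm z / N z"
    proof (cases "z = 0")
      case False
      have "N z > 0" using zE E False by (intro norm_onD(4)[OF N]) (auto simp: grassmannian_def)
      then show ?thesis using K(4)[OF zK] by (simp add: le_divide_eq mult_left_le)
    qed simp
    then have "norm z ^ j \<le> (norm z / N z) ^ j" by (intro power_mono) auto
    also have "\<dots> \<le> r"
      using le_radius_power[OF N rotations_id E zE j] real by simp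
    finally have "norm z \<le> root j r"
      using j real(1) by (metis norm_ge_zero real_root_le_mono real_root_power_cancel)
    moreover have "norm (x - y) = 2 * norm z"
    proof -
      have "x - y = 2 *\<^sub>R z" by (simp add: z_def algebra_simps)
      then show ?thesis by simp
    qed
    ultimately show "norm (x - y) \<le> 2 * root j r" by simp
  qed
  moreover have "diameter (K \<inter> E) \<ge> 0" using K(3) by (intro diameter_ge_0) (auto intro: bounded_subset)
  ultimately have "diameter (K \<inter> E) ^ j \<le> (2 * root j r) ^ j" by (rule power_mono)
  also have "\<dots> = 2 ^ j * r" using j real(1) by (simp add: power_mult_distrib)
  finally show ?thesis using real by (simp add: ennreal_mult'[symmetric] ennreal_leI)
qed (simp add: ennreal_mult_top)

section \<open>The norm of a convex body\<close>

text \<open>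
  The Minkowski functional is precomposed with the projection to \<open>Rn n\<close>, because outside \<open>Rn n\<close> it is an
  infimum over the empty set. The body contains a Euclidean ball, since it contains the midpoints of a
  ball around an interior point \<open>x0\<close> with the point \<open>- x0\<close>; this gives the upper bound and continuity, and
  boundedness gives the lower bound.
\<close>

lemma symmetric_convex_body_norm:
  assumes K: "symmetric_convex_body n K"
  obtains N \<delta> L where "norm_on n N" "\<And>x. x \<in> Rn n \<Longrightarrow> N x = body_norm K x" "\<And>x. x \<in> K \<Longrightarrow> N x \<le> 1"
    "0 < \<delta>" "0 < L" "\<And>x. x \<in> Rn n \<Longrightarrow> \<delta> * norm x \<le> N x" "\<And>x. N x \<le> L * norm x"
proof -
  have sub: "K \<subseteq> Rn n" and cpt: "compact K" and cvx: "convex K" and sym: "\<And>x. x \<in> K \<Longrightarrow> - x \<in> K"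
    and int: "top_of_set (Rn n) interior_of K \<noteq> {}"
    using K by (auto simp: symmetric_convex_body_def)
  obtain x0 U where U: "openin (top_of_set (Rn n)) U" "x0 \<in> U" "U \<subseteq> K"
    using int by (auto simp: interior_of_def)
  then obtain e where e: "e > 0" "ball x0 e \<inter> Rn n \<subseteq> U" unfolding openin_contains_ball by meson
  have x0: "x0 \<in> K" "x0 \<in> Rn n" using U sub by auto
  define r where "r = e / 4"
  have r: "r > 0" using e by (simp add: r_def)
  have ball: "y \<in> K" if y: "y \<in> Rn n" "norm y \<le> r" for y
  proof -
    have "x0 + 2 *\<^sub>R y \<in> ball x0 e \<inter> Rn n"
      using x0 y e by (auto simp: dist_norm r_def intro!: subspace_add subspace_scale subspace_Rn)
    then have "x0 + 2 *\<^sub>R y \<in> K" using e U by auto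
    then have "(1/2) *\<^sub>R (x0 + 2 *\<^sub>R y) + (1/2) *\<^sub>R (- x0) \<in> K"
      using sym[OF x0(1)] by (intro convexD[OF cvx]) auto
    then show ?thesis by (simp add: scaleR_add_right)
  qed
  have zero: "0 \<in> K" using ball[of 0] r by (simp add: subspace_0 subspace_Rn)
  obtain R where R: "R > 0" "\<And>x. x \<in> K \<Longrightarrow> norm x \<le> R"
    using compact_imp_bounded[OF cpt] by (auto simp: bounded_pos)
  define A where "A x = {t. 0 < t \<and> x /\<^sub>R t \<in> K}" for x
  have A: "body_norm K x = Inf (A x)" for x
  proof -
    have "{t. 0 < t \<and> x \<in> (\<lambda>y. t *\<^sub>R y) ` K} = A x"
      by (force simp: A_def image_iff)
    then show ?thesis by (simp add: body_norm_def)
  qed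
  have bdd: "bdd_below (A x)" for x by (rule bdd_belowI[of _ 0]) (simp add: A_def)
  have mem: "t \<in> A x" if "x \<in> Rn n" "0 < t" "norm x \<le> r * t" for x t
  proof -
    have "norm (x /\<^sub>R t) \<le> r" using that by (simp add: field_simps)
    then have "x /\<^sub>R t \<in> K" using that by (intro ball subspace_scale[OF subspace_Rn])
    then show ?thesis using that by (simp add: A_def)
  qed
  have ne: "A x \<noteq> {}" if "x \<in> Rn n" for x
  proof -
    have "norm x \<le> r * (norm x / r + 1)" using r by (simp add: field_simps)
    then have "norm x / r + 1 \<in> A x" using that r by (intro mem) (auto intro: add_nonneg_pos)
    then show ?thesis by auto
  qed
  define N where "N x = body_norm K (trunc n x)" for x
  have NI: "N x \<le> t" if "t \<in> A (trunc n x)" for x t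
    unfolding N_def A using that bdd by (rule cInf_lower)
  have NG: "c \<le> N x" if "\<And>t. t \<in> A (trunc n x) \<Longrightarrow> c \<le> t" for x c
    unfolding N_def A using that ne[OF trunc_in_Rn] by (intro cInf_greatest) auto
  have N_eq: "N x = body_norm K x" if "x \<in> Rn n" for x by (simp add: N_def trunc_eq[OF that])
  have N_K: "N x \<le> 1" if "x \<in> K" for x
    using that sub by (intro NI) (auto simp: A_def trunc_eq)
  have lower: "norm x / R \<le> N x" if "x \<in> Rn n" for x
  proof (rule NG)
    fix t assume "t \<in> A (trunc n x)"
    then have t: "0 < t" "x /\<^sub>R t \<in> K" using that by (auto simp: A_def trunc_eq)
    then show "norm x / R \<le> t" using R(1) R(2)[OF t(2)] by (simp add: field_simps)
  qed
  have N0: "0 \<le> N x" for x by (rule NG) (simp add: A_def)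
  have upper: "N x \<le> norm x / r" for x
  proof -
    have "N x \<le> norm x / r + e" if "e > 0" for e
    proof -
      have "norm (trunc n x) \<le> norm x + r * e" using norm_trunc_le[of n x] r that by (simp add: add_increasing2)
      also have "\<dots> = r * (norm x / r + e)" using r by (simp add: field_simps)
      finally show ?thesis using r that by (intro NI mem) (auto intro: add_nonneg_pos)
    qed
    then show ?thesis by (rule field_le_epsilon)
  qed
  have add: "N (x + y) \<le> N x + N y" for x y
  proof -
    have *: "N (x + y) \<le> s + t" if "s \<in> A (trunc n x)" "t \<in> A (trunc n y)" for s t
    proof (rule NI)
      have st: "s > 0" "t > 0" "trunc n x /\<^sub>R s \<in> K" "trunc n y /\<^sub>R t \<in> K" using that by (auto simp: A_def)
      have "(s / (s + t)) *\<^sub>R (trunc n x /\<^sub>R s) + (t / (s + t)) *\<^sub>R (trunc n y /\<^sub>R t) \<in> K"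
        using st by (intro convexD[OF cvx]) (auto simp: add_divide_distrib[symmetric])
      moreover have "(s / (s + t)) *\<^sub>R (trunc n x /\<^sub>R s) + (t / (s + t)) *\<^sub>R (trunc n y /\<^sub>R t) = trunc n (x + y) /\<^sub>R (s + t)"
      proof -
        have "s / (s + t) * inverse s = inverse (s + t)" "t / (s + t) * inverse t = inverse (s + t)"
          using st by (auto simp: field_simps)
        then show ?thesis by (simp only: scaleR_scaleR linear_add[OF linear_trunc] scaleR_add_right)
      qed
      ultimately show "s + t \<in> A (trunc n (x + y))" using st by (simp add: A_def)
    qed
    have "N (x + y) - N x \<le> N y"
    proof (rule NG)
      fix t assume t: "t \<in> A (trunc n y)"
      have "N (x + y) - t \<le> N x" by (rule NG) (use *[OF _ t] in \<open>simp add: algebra_simps\<close>)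
      then show "N (x + y) - N x \<le> t" by simp
    qed
    then show ?thesis by simp
  qed
  have scale_le: "N (c *\<^sub>R x) \<le> \<bar>c\<bar> * N x" if c: "c \<noteq> 0" for c x
  proof -
    have "N (c *\<^sub>R x) / \<bar>c\<bar> \<le> N x"
    proof (rule NG)
      fix t assume t: "t \<in> A (trunc n x)"
      have "trunc n (c *\<^sub>R x) /\<^sub>R (\<bar>c\<bar> * t) = sgn c *\<^sub>R (trunc n x /\<^sub>R t)"
        using c by (simp add: linear_scale[OF linear_trunc] sgn_real_def)
      moreover have "sgn c *\<^sub>R (trunc n x /\<^sub>R t) \<in> K"
        using t sym c by (cases "c > 0") (auto simp: A_def sgn_real_def)
      ultimately have "\<bar>c\<bar> * t \<in> A (trunc n (c *\<^sub>R x))" using t c by (simp add: A_def)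
      then show "N (c *\<^sub>R x) / \<bar>c\<bar> \<le> t" using NI c by (simp add: divide_le_eq mult.commute)
    qed
    then show ?thesis using c by (simp add: divide_le_eq mult.commute)
  qed
  have scale: "N (c *\<^sub>R x) = \<bar>c\<bar> * N x" for c x
  proof (cases "c = 0")
    case True
    then show ?thesis using upper[of 0] N0[of 0] by simp
  next
    case False
    have "N x \<le> \<bar>inverse c\<bar> * N (c *\<^sub>R x)" using scale_le[of "inverse c" "c *\<^sub>R x"] False by simp
    then have "\<bar>c\<bar> * N x \<le> N (c *\<^sub>R x)" using False by (simp add: field_simps)
    with scale_le[OF False] show ?thesis by (rule antisym)
  qed
  have lip: "\<bar>N x - N y\<bar> \<le> norm (x - y) / r" for x y
  proof -
    have "N x \<le> N (x - y) + N y" "N y \<le> N (y - x) + N x" using add[of "x - y" y] add[of "y - x" x] by simp_all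
    moreover have "N (x - y) \<le> norm (x - y) / r" "N (y - x) \<le> norm (x - y) / r"
      using upper[of "x - y"] upper[of "y - x"] by (simp_all add: norm_minus_commute)
    ultimately show ?thesis by linarith
  qed
  have cont: "continuous_on UNIV N"
  proof (rule continuous_onI)
    fix x :: finseq and \<epsilon> :: real assume \<epsilon>: "\<epsilon> > 0"
    have "dist (N x') (N x) \<le> \<epsilon>" if "dist x' x < \<epsilon> * r" for x'
    proof -
      have "norm (x' - x) / r < \<epsilon>" using that r by (simp add: dist_norm divide_less_eq)
      then show ?thesis using lip[of x' x] by (simp add: dist_real_def)
    qed
    then show "\<exists>d>0. \<forall>x'\<in>UNIV. dist x' x < d \<longrightarrow> dist (N x') (N x) \<le> \<epsilon>"
      using \<epsilon> r by (intro exI[of _ "\<epsilon> * r"]) auto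
  qed
  have "norm_on n N"
    unfolding norm_on_def
  proof (intro conjI allI ballI impI cont add scale)
    fix x assume "x \<in> Rn n" "x \<noteq> 0"
    then show "0 < N x" using lower[of x] R(1) by (meson divide_pos_pos less_le_trans zero_less_norm_iff)
  qed
  then show thesis
    using that[of N "1 / R" "1 / r"] N_eq N_K lower upper R(1) r by simp
qed

section \<open>Averaging over sections\<close>

text \<open>
  The weighted inequality of arithmetic and geometric means; it replaces the Cauchy-Schwarz
  inequality by a bound that is linear in \<open>X\<close> and \<open>Y\<close> and can be integrated termwise.
\<close>

lemma ennreal_twice_le_of_square_le:
  fixes a X Y :: ennreal
  assumes "a\<^sup>2 \<le> X * Y" "s > 0"
  shows "2 * a \<le> ennreal s * X + ennreal (1 / s) * Y"
proof (cases "X = \<infinity> \<or> Y = \<infinity>")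
  case True
  then show ?thesis using assms(2) by (auto simp: ennreal_mult_top)
next
  case False
  then obtain x y where xy: "X = ennreal x" "x \<ge> 0" "Y = ennreal y" "y \<ge> 0"
    by (metis ennreal_cases infinity_ennreal_def)
  have "a \<noteq> \<infinity>" using assms(1) xy by (auto simp: power2_eq_square ennreal_mult'[symmetric] top_unique)
  then obtain b where b: "a = ennreal b" "b \<ge> 0" by (metis ennreal_cases infinity_ennreal_def)
  have "b\<^sup>2 \<le> x * y" using assms(1) xy b by (simp add: ennreal_power ennreal_mult'[symmetric])
  have "(2 * b)\<^sup>2 \<le> 4 * (s * x) * (1 / s * y)" using \<open>b\<^sup>2 \<le> x * y\<close> assms(2) by (simp add: power2_eq_square)
  also have "4 * p * q \<le> (p + q)\<^sup>2" for p q :: real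
    using zero_le_power2[of "p - q"] by (simp add: power2_eq_square algebra_simps)
  finally have "(2 * b)\<^sup>2 \<le> (s * x + 1 / s * y)\<^sup>2" .
  then have "2 * b \<le> s * x + 1 / s * y"
    by (rule power2_le_imp_le) (use assms(2) xy in simp)
  then have "ennreal (2 * b) \<le> ennreal (s * x + 1 / s * y)" by (rule ennreal_leI)
  also have "\<dots> = ennreal (s * x) + ennreal (1 / s * y)"
    using assms(2) xy by (intro ennreal_plus mult_nonneg_nonneg) auto
  also have "ennreal (s * x) = ennreal s * X" unfolding xy using assms(2) xy by (intro ennreal_mult) auto
  also have "ennreal (1 / s * y) = ennreal (1 / s) * Y" unfolding xy using assms(2) xy by (intro ennreal_mult) auto
  also have "ennreal (2 * b) = 2 * a" unfolding b by (simp add: ennreal_mult')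
  finally show ?thesis .
qed

lemma haar_pair_measurable:
  assumes \<rho>: "haar n \<rho>" and \<gamma>: "haar k \<gamma>" and Q: "Q \<in> rotations n" and i: "i < k"
  shows "(\<lambda>z. act n (fst z) (Q (snd z i))) \<in> borel_measurable (\<rho> \<Otimes>\<^sub>M \<gamma>)"
proof (rule act_measurable)
  show "(\<lambda>z. fst z j) \<in> borel_measurable (\<rho> \<Otimes>\<^sub>M \<gamma>)" if "j < n" for j
    by (rule measurable_compose[OF measurable_fst frame_component_measurable[OF haarD(2)[OF \<rho>] that]])
  show "(\<lambda>z. Q (snd z i)) \<in> borel_measurable (\<rho> \<Otimes>\<^sub>M \<gamma>)"
    by (rule measurable_compose[OF measurable_compose[OF measurable_snd frame_component_measurable[OF haarD(2)[OF \<gamma>] i]]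
          rotations_measurable[OF Q]])
qed

text \<open>
  Write \<open>E\<close> as the image of \<open>Rn k\<close> under a rotation \<open>Q\<close> and apply \<open>norm_power_le_averages\<close> to the
  norm \<open>N \<circ> act n f \<circ> Q\<close> on \<open>Rn k\<close>. When the two averages are integrated over \<open>f\<close>, exchanging the
  integrals reduces the first to the uniform measure on the sphere and the second to
  \<open>haar_prod_norm_rotated_le\<close>.
\<close>

lemma radius_power_average_le:
  assumes N: "norm_on n N" and \<sigma>: "invariant_sphere_measure n \<sigma>" and \<rho>: "haar n \<rho>"
    and E: "E \<in> grassmannian n k" and k: "0 < k" "2 * k \<le> n" and s: "s > 0"
  shows "2 * (\<integral>\<^sup>+f. radius_power k N (act n f) E \<partial>\<rho>)
    \<le> ennreal s * (ennreal (2 * 8 ^ k) * (\<integral>\<^sup>+x. ennreal (inverse (N x) ^ (3 * k)) \<partial>\<sigma>))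
      + ennreal (1 / s) * (2 * (\<integral>\<^sup>+x. ennreal (N x) \<partial>\<sigma>)) ^ k"
proof -
  have kn: "k \<le> n" using k by simp
  obtain Q where Q: "Q \<in> rotations n" "Q ` Rn k = E" using grassmannian_rotated[OF E] by blast
  obtain \<gamma> where \<gamma>: "haar k \<gamma>" using haar_exists by blast
  interpret R: prob_space \<rho> by (rule haarD[OF \<rho>])
  interpret G: prob_space \<gamma> by (rule haarD[OF \<gamma>])
  interpret P: pair_prob_space \<rho> \<gamma> ..
  note pm = measurable_compose[OF haar_pair_measurable[OF \<rho> \<gamma> Q(1)] norm_onD(8)[OF N]]
  define q where "q f g = ennreal (inverse (N (act n f (Q (g 0)))) ^ (3 * k))" for f g :: "nat \<Rightarrow> finseq"
  define p where "p f g = ennreal (\<Prod>i<k. N (act n f (Q (g i))))" for f g :: "nat \<Rightarrow> finseq"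
  have qm: "(\<lambda>(f, g). q f g) \<in> borel_measurable (\<rho> \<Otimes>\<^sub>M \<gamma>)"
  proof -
    note [measurable] = pm[OF k(1)]
    have "(\<lambda>z. q (fst z) (snd z)) \<in> borel_measurable (\<rho> \<Otimes>\<^sub>M \<gamma>)" unfolding q_def by measurable
    then show ?thesis by (simp add: split_beta')
  qed
  have pm': "(\<lambda>(f, g). p f g) \<in> borel_measurable (\<rho> \<Otimes>\<^sub>M \<gamma>)"
  proof -
    have "(\<lambda>z. p (fst z) (snd z)) \<in> borel_measurable (\<rho> \<Otimes>\<^sub>M \<gamma>)"
      unfolding p_def by (intro measurable_compose[OF _ measurable_ennreal] borel_measurable_prod pm) auto
    then show ?thesis by (simp add: split_beta')
  qed
  define Qf where "Qf f = (\<integral>\<^sup>+g. q f g \<partial>\<gamma>)" for f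
  define Yf where "Yf f = (\<integral>\<^sup>+g. p f g \<partial>\<gamma>)" for f
  have Qm: "Qf \<in> borel_measurable \<rho>" unfolding Qf_def[abs_def] using qm by measurable
  have Ym: "Yf \<in> borel_measurable \<rho>" unfolding Yf_def[abs_def] using pm' by measurable
  have Qint: "(\<integral>\<^sup>+f. Qf f \<partial>\<rho>) = (\<integral>\<^sup>+x. ennreal (inverse (N x) ^ (3 * k)) \<partial>\<sigma>)"
  proof -
    define F where "F x = ennreal (inverse (N x) ^ (3 * k))" for x
    have F: "F \<in> borel_measurable borel" unfolding F_def[abs_def] using norm_onD(8)[OF N] by measurable
    have "(\<integral>\<^sup>+f. Qf f \<partial>\<rho>) = (\<integral>\<^sup>+g. (\<integral>\<^sup>+f. q f g \<partial>\<rho>) \<partial>\<gamma>)"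
      unfolding Qf_def using P.Fubini'[OF qm] by simp
    also have "\<dots> = (\<integral>\<^sup>+g. (\<integral>\<^sup>+x. F x \<partial>\<sigma>) \<partial>\<gamma>)"
    proof (rule nn_integral_cong)
      fix g assume "g \<in> space \<gamma>"
      then have g: "g \<in> frames k" by (simp add: haarD(3)[OF \<gamma>])
      have "Q (g 0) \<in> Rn n" "norm (Q (g 0)) = 1"
        using framesD(1,3)[OF g k(1)] Rn_mono[OF kn] rotationsD(3,9)[OF Q(1)] by auto
      then have "(\<integral>\<^sup>+f. F (act n f (Q (g 0))) \<partial>\<rho>) = (\<integral>\<^sup>+f. F (f 0) \<partial>\<rho>)"
        using k by (intro haar_unit_vector[OF \<rho> _ _ _ F]) auto
      also have "\<dots> = (\<integral>\<^sup>+x. F x \<partial>\<sigma>)" using k by (intro nn_integral_sphere_haar[OF \<rho> \<sigma> _ F, symmetric]) auto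
      finally show "(\<integral>\<^sup>+f. q f g \<partial>\<rho>) = (\<integral>\<^sup>+x. F x \<partial>\<sigma>)" by (simp add: q_def F_def)
    qed
    finally show ?thesis by (simp add: F_def G.emeasure_space_1)
  qed
  have Yint: "(\<integral>\<^sup>+f. Yf f \<partial>\<rho>) \<le> (2 * (\<integral>\<^sup>+x. ennreal (N x) \<partial>\<sigma>)) ^ k"
  proof -
    have "(\<integral>\<^sup>+f. Yf f \<partial>\<rho>) = (\<integral>\<^sup>+g. (\<integral>\<^sup>+f. p f g \<partial>\<rho>) \<partial>\<gamma>)"
      unfolding Yf_def using P.Fubini'[OF pm'] by simp
    also have "\<dots> \<le> (\<integral>\<^sup>+g. (2 * (\<integral>\<^sup>+x. ennreal (N x) \<partial>\<sigma>)) ^ k \<partial>\<gamma>)"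
    proof (rule nn_integral_mono)
      fix g assume "g \<in> space \<gamma>"
      then have g: "g \<in> frames k" by (simp add: haarD(3)[OF \<gamma>])
      have "(\<lambda>x. Q (act k g x)) \<in> rotations n" by (rule rotations_compose[OF Q(1) act_rotations[OF g kn]])
      from haar_prod_norm_rotated_le[OF N \<sigma> \<rho> this k(2)]
      show "(\<integral>\<^sup>+f. p f g \<partial>\<rho>) \<le> (2 * (\<integral>\<^sup>+x. ennreal (N x) \<partial>\<sigma>)) ^ k"
        by (simp add: p_def act_basis_vec)
    qed
    finally show ?thesis by (simp add: G.emeasure_space_1)
  qed
  have pt: "2 * radius_power k N (act n f) E \<le> ennreal s * (ennreal (2 * 8 ^ k) * Qf f) + ennreal (1 / s) * Yf f"
    if "f \<in> space \<rho>" for f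
    unfolding radius_power_def SUP_mult_left_ennreal
  proof (rule SUP_least)
    fix d
    have f: "act n f \<in> rotations n" using act_rotations[of f n n] that by (simp add: haarD(3)[OF \<rho>])
    have fQ: "(\<lambda>x. act n f (Q x)) \<in> rotations n" by (rule rotations_compose[OF f Q(1)])
    have "orth_proj E d \<in> E" by (rule orth_proj(1)[OF E])
    then obtain y where y: "y \<in> Rn k" "orth_proj E d = Q y" using Q(2) by auto
    have "(ennreal ((norm y / N (act n f (Q y))) ^ k))\<^sup>2 \<le> ennreal (2 * 8 ^ k) * Qf f * Yf f"
      using norm_power_le_averages[OF \<gamma> k(1) norm_on_rotation[OF N fQ kn] y(1)]
      by (simp add: Qf_def Yf_def q_def p_def)
    from ennreal_twice_le_of_square_le[OF this s]
    show "2 * ennreal ((norm (orth_proj E d) / N (act n f (orth_proj E d))) ^ k)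
        \<le> ennreal s * (ennreal (2 * 8 ^ k) * Qf f) + ennreal (1 / s) * Yf f"
      by (simp add: y(2) rotationsD(3)[OF Q(1)])
  qed
  have rm: "(\<lambda>f. radius_power k N (act n f) E) \<in> borel_measurable \<rho>"
    unfolding radius_power_def
  proof (rule borel_measurable_SUP[OF dense_points(1)])
    fix d
    have [measurable]: "(\<lambda>f. N (act n f (orth_proj E d))) \<in> borel_measurable \<rho>"
      by (rule haar_act_measurable[OF \<rho> norm_onD(8)[OF N]])
    show "(\<lambda>f. ennreal ((norm (orth_proj E d) / N (act n f (orth_proj E d))) ^ k)) \<in> borel_measurable \<rho>"
      by measurable
  qed
  have "2 * (\<integral>\<^sup>+f. radius_power k N (act n f) E \<partial>\<rho>) = (\<integral>\<^sup>+f. 2 * radius_power k N (act n f) E \<partial>\<rho>)"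
    by (rule nn_integral_cmult[OF rm, symmetric])
  also have "\<dots> \<le> (\<integral>\<^sup>+f. ennreal s * (ennreal (2 * 8 ^ k) * Qf f) + ennreal (1 / s) * Yf f \<partial>\<rho>)"
    by (intro nn_integral_mono pt)
  also have "\<dots> = ennreal s * (ennreal (2 * 8 ^ k) * (\<integral>\<^sup>+f. Qf f \<partial>\<rho>)) + ennreal (1 / s) * (\<integral>\<^sup>+f. Yf f \<partial>\<rho>)"
    using Qm Ym by (simp add: nn_integral_add nn_integral_cmult)
  also have "\<dots> \<le> ennreal s * (ennreal (2 * 8 ^ k) * (\<integral>\<^sup>+x. ennreal (inverse (N x) ^ (3 * k)) \<partial>\<sigma>))
      + ennreal (1 / s) * (2 * (\<integral>\<^sup>+x. ennreal (N x) \<partial>\<sigma>)) ^ k"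
    unfolding Qint using Yint by (intro add_left_mono mult_left_mono) auto
  finally show ?thesis .
qed

text \<open>
  By the invariance of the measure on the Grassmannian, \<open>E\<close> may be replaced by a random rotation of \<open>E\<close>,
  and for a random rotation the bound holds for each fixed \<open>E\<close>.
\<close>

lemma diameter_average_le:
  assumes N: "norm_on n N" and \<sigma>: "invariant_sphere_measure n \<sigma>" and \<mu>: "invariant_grassmannian_measure n k \<mu>"
    and K: "convex K" "uminus ` K = K" "bounded K" "\<And>x. x \<in> K \<Longrightarrow> N x \<le> 1"
    and k: "0 < k" "2 * k \<le> n" and s: "s > 0"
  shows "2 * (\<integral>\<^sup>+E. ennreal (diameter (K \<inter> E) ^ k) \<partial>\<mu>)
    \<le> ennreal (2 ^ k) * (ennreal s * (ennreal (2 * 8 ^ k) * (\<integral>\<^sup>+x. ennreal (inverse (N x) ^ (3 * k)) \<partial>\<sigma>))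
      + ennreal (1 / s) * (2 * (\<integral>\<^sup>+x. ennreal (N x) \<partial>\<sigma>)) ^ k)" (is "_ \<le> _ * ?B")
proof -
  obtain \<rho> where \<rho>: "haar n \<rho>" using haar_exists by blast
  interpret R: prob_space \<rho> by (rule haarD[OF \<rho>])
  interpret M: prob_space \<mu> by (rule invariant_grassmannian_measureD[OF \<mu>])
  interpret P: pair_prob_space \<rho> \<mu> ..
  note space = invariant_grassmannian_measureD(2)[OF \<mu>]
  note [measurable] = norm_onD(8)[OF N]
  define h where "h = radius_power k N (\<lambda>x. x)"
  have hm: "h \<in> borel_measurable \<mu>"
    unfolding h_def radius_power_def[abs_def]
  proof (rule borel_measurable_SUP[OF dense_points(1)])
    fix d
    note [measurable] = orth_proj_measurable[OF \<mu>, of d]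
    show "(\<lambda>E. ennreal ((norm (orth_proj E d) / N (orth_proj E d)) ^ k)) \<in> borel_measurable \<mu>" by measurable
  qed
  have rm: "(\<lambda>(f, E). radius_power k N (act n f) E) \<in> borel_measurable (\<rho> \<Otimes>\<^sub>M \<mu>)"
  proof -
    have "(\<lambda>z. radius_power k N (act n (fst z)) (snd z)) \<in> borel_measurable (\<rho> \<Otimes>\<^sub>M \<mu>)"
      unfolding radius_power_def
    proof (rule borel_measurable_SUP[OF dense_points(1)])
      fix d
      have [measurable]: "(\<lambda>z. orth_proj (snd z) d) \<in> borel_measurable (\<rho> \<Otimes>\<^sub>M \<mu>)"
        by (rule measurable_compose[OF measurable_snd orth_proj_measurable[OF \<mu>]])
      have [measurable]: "(\<lambda>z. act n (fst z) (orth_proj (snd z) d)) \<in> borel_measurable (\<rho> \<Otimes>\<^sub>M \<mu>)"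
        by (rule act_measurable)
          (auto intro: measurable_compose[OF measurable_fst frame_component_measurable[OF haarD(2)[OF \<rho>]]])
      show "(\<lambda>z. ennreal ((norm (orth_proj (snd z) d) / N (act n (fst z) (orth_proj (snd z) d))) ^ k)) \<in> borel_measurable (\<rho> \<Otimes>\<^sub>M \<mu>)"
        by measurable
    qed
    then show ?thesis by (simp add: split_beta')
  qed
  have "(\<integral>\<^sup>+E. h E \<partial>\<mu>) = (\<integral>\<^sup>+f. (\<integral>\<^sup>+E. h E \<partial>\<mu>) \<partial>\<rho>)" by (simp add: R.emeasure_space_1)
  also have "\<dots> = (\<integral>\<^sup>+f. (\<integral>\<^sup>+E. h (act n f ` E) \<partial>\<mu>) \<partial>\<rho>)"
    by (intro nn_integral_cong invariant_grassmannian_measureD(5)[OF \<mu> act_rotations hm, symmetric])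
       (auto simp: haarD(3)[OF \<rho>])
  also have "\<dots> \<le> (\<integral>\<^sup>+f. (\<integral>\<^sup>+E. radius_power k N (act n f) E \<partial>\<mu>) \<partial>\<rho>)"
    unfolding h_def using k(1)
    by (intro nn_integral_mono radius_power_image_le[OF N act_rotations]) (auto simp: haarD(3)[OF \<rho>] space)
  also have "\<dots> = (\<integral>\<^sup>+E. (\<integral>\<^sup>+f. radius_power k N (act n f) E \<partial>\<rho>) \<partial>\<mu>)"
    using P.Fubini'[OF rm] by simp
  finally have h_le: "(\<integral>\<^sup>+E. h E \<partial>\<mu>) \<le> (\<integral>\<^sup>+E. (\<integral>\<^sup>+f. radius_power k N (act n f) E \<partial>\<rho>) \<partial>\<mu>)" .
  have rm': "(\<lambda>E. \<integral>\<^sup>+f. radius_power k N (act n f) E \<partial>\<rho>) \<in> borel_measurable \<mu>"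
    using measurable_pair_swap[OF rm] by (intro R.borel_measurable_nn_integral) (simp add: split_beta')
  have "2 * (\<integral>\<^sup>+E. h E \<partial>\<mu>) \<le> 2 * (\<integral>\<^sup>+E. (\<integral>\<^sup>+f. radius_power k N (act n f) E \<partial>\<rho>) \<partial>\<mu>)"
    using h_le by (rule mult_left_mono) simp
  also have "\<dots> = (\<integral>\<^sup>+E. 2 * (\<integral>\<^sup>+f. radius_power k N (act n f) E \<partial>\<rho>) \<partial>\<mu>)"
    by (rule nn_integral_cmult[OF rm', symmetric])
  also have "\<dots> \<le> (\<integral>\<^sup>+E. ?B \<partial>\<mu>)"
    by (intro nn_integral_mono radius_power_average_le[OF N \<sigma> \<rho> _ k s]) (simp add: space)
  also have "\<dots> = ?B" by (simp add: M.emeasure_space_1)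
  finally have hB: "2 * (\<integral>\<^sup>+E. h E \<partial>\<mu>) \<le> ?B" .
  have "(\<integral>\<^sup>+E. ennreal (diameter (K \<inter> E) ^ k) \<partial>\<mu>) \<le> (\<integral>\<^sup>+E. ennreal (2 ^ k) * h E \<partial>\<mu>)"
    unfolding h_def by (intro nn_integral_mono diameter_power_le_radius[OF N _ k(1) K]) (auto simp: space)
  also have "\<dots> = ennreal (2 ^ k) * (\<integral>\<^sup>+E. h E \<partial>\<mu>)" by (rule nn_integral_cmult[OF hm])
  finally have "2 * (\<integral>\<^sup>+E. ennreal (diameter (K \<inter> E) ^ k) \<partial>\<mu>) \<le> ennreal (2 ^ k) * (2 * (\<integral>\<^sup>+E. h E \<partial>\<mu>))"
    by (simp add: mult.left_commute mult_left_mono)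
  also have "\<dots> \<le> ennreal (2 ^ k) * ?B" using hB by (rule mult_left_mono) simp
  finally show ?thesis .
qed

section \<open>Moments of the norm on the sphere\<close>

text \<open>
  Young's inequality, applied to \<open>N powr (- q)\<close> divided by its mean.
\<close>

lemma negative_moment_mono:
  fixes N :: "'a \<Rightarrow> real"
  assumes "prob_space M" "0 < p" "p \<le> q" and pos: "\<And>x. x \<in> space M \<Longrightarrow> N x > 0"
    and ip: "integrable M (\<lambda>x. N x powr (- p))" and iq: "integrable M (\<lambda>x. N x powr (- q))"
    and Spos: "(\<integral>x. N x powr (- q) \<partial>M) > 0"
  shows "(\<integral>x. N x powr (- p) \<partial>M) \<le> (\<integral>x. N x powr (- q) \<partial>M) powr (p / q)"
proof -
  interpret M: prob_space M by fact
  define S where "S = (\<integral>x. N x powr (- q) \<partial>M)"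
  have S: "S > 0" using Spos by (simp add: S_def)
  define t where "t = p / q"
  have t: "0 < t" "t \<le> 1" "q * t = p" using assms(2,3) by (auto simp: t_def)
  have pt: "N x powr (- p) / S powr t \<le> t * (N x powr (- q) / S) + (1 - t)" if "x \<in> space M" for x
  proof -
    have Nx: "N x powr (- q) > 0" using pos[OF that] by simp
    have "(N x powr (- q) / S) powr t * 1 powr (1 - t) \<le> t * (N x powr (- q) / S) + (1 - t) * 1"
      using t S Nx by (intro Youngs_inequality_0) auto
    moreover have "(N x powr (- q) / S) powr t = N x powr (- p) / S powr t"
      using S Nx t(3) by (simp add: powr_divide powr_powr)
    ultimately show ?thesis by simp
  qed
  have "(\<integral>x. N x powr (- p) \<partial>M) / S powr t = (\<integral>x. N x powr (- p) / S powr t \<partial>M)" by simp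
  also have "\<dots> \<le> (\<integral>x. t * (N x powr (- q) / S) + (1 - t) \<partial>M)"
    by (rule integral_mono[OF _ _ pt]) (use ip iq in auto)
  also have "\<dots> = t * ((\<integral>x. N x powr (- q) \<partial>M) / S) + (1 - t)"
    using iq by (simp add: M.prob_space)
  also have "\<dots> = 1" using S by (simp add: S_def[symmetric])
  finally show ?thesis using S by (simp add: t_def S_def divide_le_eq)
qed

text \<open>
  The convex function \<open>y powr (- q)\<close> lies above its tangent at 1; this is applied to \<open>N\<close> divided by
  its mean.
\<close>

lemma mean_times_negative_moment_ge_one:
  fixes N :: "'a \<Rightarrow> real"
  assumes "prob_space M" "0 < q" and pos: "\<And>x. x \<in> space M \<Longrightarrow> N x > 0"
    and i: "integrable M N" and iq: "integrable M (\<lambda>x. N x powr (- q))" and mpos: "(\<integral>x. N x \<partial>M) > 0"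
  shows "1 \<le> (\<integral>x. N x \<partial>M) * (\<integral>x. N x powr (- q) \<partial>M) powr (1 / q)"
proof -
  interpret M: prob_space M by fact
  define m where "m = (\<integral>x. N x \<partial>M)"
  have m: "m > 0" using mpos by (simp add: m_def)
  have pt: "1 - q * (N x / m - 1) \<le> m powr q * N x powr (- q)" if "x \<in> space M" for x
  proof -
    let ?y = "N x / m"
    have y: "?y > 0" using pos[OF that] m by simp
    have "1 - q * (?y - 1) \<le> 1 + (- q) * ln ?y"
      using assms(2) ln_le_minus_one[OF y] by (simp add: mult_left_mono)
    also have "\<dots> \<le> exp ((- q) * ln ?y)" by (rule exp_ge_add_one_self)
    also have "\<dots> = ?y powr (- q)" using pos[OF that] m by (simp add: powr_def)
    also have "\<dots> = m powr q * N x powr (- q)"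
      using pos[OF that] m by (simp add: powr_divide powr_minus field_simps)
    finally show ?thesis .
  qed
  have "1 = (\<integral>x. 1 - q * (N x / m - 1) \<partial>M)"
    using i m by (simp add: M.prob_space m_def[symmetric])
  also have "\<dots> \<le> (\<integral>x. m powr q * N x powr (- q) \<partial>M)"
    by (rule integral_mono[OF _ _ pt]) (use i iq in auto)
  finally have 1: "1 \<le> m powr q * (\<integral>x. N x powr (- q) \<partial>M)" by simp
  have "1 powr (1 / q) \<le> (m powr q * (\<integral>x. N x powr (- q) \<partial>M)) powr (1 / q)"
    using assms(2) by (intro powr_mono2 1) auto
  also have "\<dots> = m * (\<integral>x. N x powr (- q) \<partial>M) powr (1 / q)"
    using assms(2) m by (simp add: powr_mult powr_powr integral_nonneg_AE)
  finally show ?thesis by (simp add: m_def)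
qed

theorem proposition3p1:
  shows "\<exists>C>0. \<forall>(n::nat) (K::finseq set) (\<sigma>::finseq measure) (k0::real) (k::nat)
             (\<mu>::finseq set measure).
           symmetric_convex_body n K \<and> invariant_sphere_measure n \<sigma> \<and>
           1 \<le> k0 \<and> k0 < real n \<and> 0 < k \<and> real k < k0 / 4 \<and>
           invariant_grassmannian_measure n k \<mu> \<longrightarrow>
           (\<integral>E. diameter (K \<inter> E) ^ k \<partial>\<mu>) powr (1 / real k)
             \<le> C * (\<integral>x. body_norm K x \<partial>\<sigma>)
                 * (\<integral>x. body_norm K x powr (- k0) \<partial>\<sigma>) powr (2 / k0)"
proof (intro exI[of _ "16::real"] conjI allI impI)
  fix n k :: nat and K \<sigma> \<mu> and k0 :: real
  assume "symmetric_convex_body n K \<and> invariant_sphere_measure n \<sigma> \<and>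
           1 \<le> k0 \<and> k0 < real n \<and> 0 < k \<and> real k < k0 / 4 \<and>
           invariant_grassmannian_measure n k \<mu>"
  then have K: "symmetric_convex_body n K" and \<sigma>: "invariant_sphere_measure n \<sigma>" and k0: "1 \<le> k0" "k0 < real n"
    and k: "0 < k" "real k < k0 / 4" and \<mu>: "invariant_grassmannian_measure n k \<mu>" by auto
  interpret S: prob_space \<sigma> by (rule invariant_sphere_measureD[OF \<sigma>])
  note space = invariant_sphere_measureD(3)[OF \<sigma>]
  obtain N \<delta> L where N: "norm_on n N" "\<And>x. x \<in> Rn n \<Longrightarrow> N x = body_norm K x" "\<And>x. x \<in> K \<Longrightarrow> N x \<le> 1"
    "0 < \<delta>" "0 < L" "\<And>x. x \<in> Rn n \<Longrightarrow> \<delta> * norm x \<le> N x" "\<And>x. N x \<le> L * norm x"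
    by (rule symmetric_convex_body_norm[OF K], rule that)
  have bounds: "\<delta> \<le> N x" "N x \<le> L" "N x > 0" if "x \<in> space \<sigma>" for x
    using that N(4) N(6)[of x] N(7)[of x] by (auto simp: space unit_sphere_iff)
  have Nm: "N \<in> borel_measurable \<sigma>"
    by (rule measurable_sphere_borel[OF invariant_sphere_measureD(2)[OF \<sigma>] norm_onD(8)[OF N(1)]])
  have int_N: "integrable \<sigma> N"
    using bounds Nm by (intro S.integrable_const_bound[of _ L]) (auto intro!: AE_I2 simp: less_imp_le abs_of_pos)
  have int_powr: "integrable \<sigma> (\<lambda>x. N x powr (- p))" if "p \<ge> 0" for p
    using bounds Nm N(4) that
    by (intro S.integrable_const_bound[of _ "\<delta> powr (- p)"]) (auto intro!: AE_I2 powr_mono2')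
  define m where "m = (\<integral>x. N x \<partial>\<sigma>)"
  define S where "S = (\<integral>x. N x powr (- k0) \<partial>\<sigma>)"
  define S3 where "S3 = (\<integral>x. N x powr (- (3 * real k)) \<partial>\<sigma>)"
  have m_eq: "(\<integral>x. body_norm K x \<partial>\<sigma>) = m"
    unfolding m_def by (rule Bochner_Integration.integral_cong) (auto simp: space unit_sphere_iff N(2))
  have S_eq: "(\<integral>x. body_norm K x powr (- k0) \<partial>\<sigma>) = S"
    unfolding S_def by (rule Bochner_Integration.integral_cong) (auto simp: space unit_sphere_iff N(2))
  have lower: "c \<le> (\<integral>x. F x \<partial>\<sigma>)" if "integrable \<sigma> F" "\<And>x. x \<in> space \<sigma> \<Longrightarrow> c \<le> F x" for F and c :: real
    using integral_mono[OF _ that(1), of "\<lambda>_. c"] that(2) by (simp add: S.prob_space)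
  have m: "m > 0" using lower[OF int_N bounds(1)] N(4) by (simp add: m_def)
  have powr_lower: "(\<integral>x. N x powr (- p) \<partial>\<sigma>) > 0" if "p \<ge> 0" for p
  proof -
    have "L powr (- p) \<le> (\<integral>x. N x powr (- p) \<partial>\<sigma>)"
      using bounds that by (intro lower int_powr powr_mono2') auto
    moreover have "L powr (- p) > 0" using N(5) by simp
    ultimately show ?thesis by linarith
  qed
  have Spos: "S > 0" "S3 > 0" unfolding S_def S3_def using powr_lower k0 by auto
  \<comment> \<open>In terms of \<open>u\<close> the claim only involves powers with natural exponents.\<close>
  define u where "u = S powr (1 / k0)"
  have u: "u > 0" using Spos by (simp add: u_def)
  have mu: "1 \<le> m * u"
    unfolding m_def u_def S_def using k0 m[unfolded m_def]
    by (intro mean_times_negative_moment_ge_one S.prob_space_axioms int_N int_powr bounds) auto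
  have S3: "S3 \<le> u ^ (3 * k)"
  proof -
    have "S3 \<le> S powr (3 * real k / k0)"
      unfolding S3_def S_def using k k0 Spos[unfolded S_def]
      by (intro negative_moment_mono S.prob_space_axioms int_powr bounds) auto
    also have "\<dots> = u powr (real (3 * k))" by (simp add: u_def powr_powr)
    also have "\<dots> = u ^ (3 * k)" using u by (rule powr_realpow)
    finally show ?thesis .
  qed
  have S_powr: "S powr (2 / k0) = u\<^sup>2"
    using Spos by (simp add: u_def powr_powr power2_eq_square powr_add[symmetric] add_divide_distrib[symmetric])
  have e1: "(\<integral>\<^sup>+x. ennreal (inverse (N x) ^ (3 * k)) \<partial>\<sigma>) = ennreal S3"
  proof -
    have "(\<integral>\<^sup>+x. ennreal (inverse (N x) ^ (3 * k)) \<partial>\<sigma>) = (\<integral>\<^sup>+x. ennreal (N x powr (- (3 * real k))) \<partial>\<sigma>)"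
    proof (rule nn_integral_cong)
      fix x assume "x \<in> space \<sigma>"
      from bounds(3)[OF this] show "ennreal (inverse (N x) ^ (3 * k)) = ennreal (N x powr (- (3 * real k)))"
        using powr_realpow[of "N x" "3 * k"] by (simp add: powr_minus power_inverse)
    qed
    then show ?thesis unfolding S3_def by (simp add: nn_integral_eq_integral int_powr)
  qed
  have e2: "(\<integral>\<^sup>+x. ennreal (N x) \<partial>\<sigma>) = ennreal m"
    unfolding m_def using bounds(3) by (intro nn_integral_eq_integral int_N AE_I2) (simp add: less_imp_le)
  define X where "X = 2 * 8 ^ k * S3"
  define Y where "Y = (2 * m) ^ k"
  have XY: "X > 0" "Y > 0" using Spos m by (auto simp: X_def Y_def)
  \<comment> \<open>This value makes the two terms of \<open>diameter_average_le\<close> equal.\<close>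
  define s where "s = sqrt (Y / X)"
  have s: "s > 0" using XY by (simp add: s_def)
  have sX: "s * X = sqrt (X * Y)" "1 / s * Y = sqrt (X * Y)"
  proof -
    have s2: "s\<^sup>2 = Y / X" using XY by (simp add: s_def)
    have "(s * X)\<^sup>2 = Y / X * X\<^sup>2" by (simp only: power_mult_distrib s2)
    also have "\<dots> = X * Y" using XY by (simp add: power2_eq_square)
    finally show "s * X = sqrt (X * Y)" using s XY by (intro real_sqrt_unique[symmetric]) auto
    have "(1 / s * Y)\<^sup>2 = 1 / (Y / X) * Y\<^sup>2" by (simp only: power_mult_distrib power_divide s2 power_one)
    also have "\<dots> = X * Y" using XY by (simp add: power2_eq_square)
    finally show "1 / s * Y = sqrt (X * Y)" using s XY by (intro real_sqrt_unique[symmetric]) auto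
  qed
  have k2: "2 * k \<le> n" using k k0 by linarith
  have K': "convex K" "uminus ` K = K" "bounded K"
    using K by (auto simp: symmetric_convex_body_def compact_imp_bounded)
  have "2 * (\<integral>\<^sup>+E. ennreal (diameter (K \<inter> E) ^ k) \<partial>\<mu>) \<le> ennreal (2 ^ k) * (ennreal s * (ennreal (2 * 8 ^ k) * ennreal S3)
      + ennreal (1 / s) * (2 * ennreal m) ^ k)"
    using diameter_average_le[OF N(1) \<sigma> \<mu> K' N(3) k(1) k2 s] unfolding e1 e2 .
  also have "ennreal s * (ennreal (2 * 8 ^ k) * ennreal S3) = ennreal (s * X)"
    using s Spos by (simp add: X_def ennreal_mult)
  also have "ennreal (1 / s) * (2 * ennreal m) ^ k = ennreal (1 / s * Y)"
  proof -
    have "(2 * ennreal m) ^ k = ennreal Y"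
      using m by (simp add: Y_def ennreal_mult' flip: ennreal_power)
    then show ?thesis using s XY by (simp only: ennreal_mult' less_imp_le zero_less_divide_1_iff)
  qed
  also have "ennreal (2 ^ k) * (ennreal (s * X) + ennreal (1 / s * Y)) = 2 * ennreal (2 ^ k * sqrt (X * Y))"
    unfolding sX by (simp add: mult_2 ennreal_mult' distrib_left)
  finally have "(\<integral>\<^sup>+E. ennreal (diameter (K \<inter> E) ^ k) \<partial>\<mu>) \<le> ennreal (2 ^ k * sqrt (X * Y))"
    by (subst (asm) ennreal_mult_le_mult_iff) auto
  then have I: "(\<integral>E. diameter (K \<inter> E) ^ k \<partial>\<mu>) \<le> 2 ^ k * sqrt (X * Y)"
    using XY by (intro integral_real_bounded) auto
  have "sqrt (X * Y) \<le> (8 * m * u\<^sup>2) ^ k"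
  proof (rule real_le_lsqrt)
    have "X * Y \<le> (2 * 8 ^ k * u ^ (3 * k)) * (2 * m) ^ k"
      unfolding X_def Y_def using S3 m by (intro mult_right_mono mult_left_mono) auto
    also have "\<dots> = 2 * (16 ^ k * (u ^ (3 * k) * m ^ k))"
    proof -
      have "(16::real) ^ k = 8 ^ k * 2 ^ k" by (simp flip: power_mult_distrib)
      then show ?thesis by (simp add: power_mult_distrib)
    qed
    also have "\<dots> \<le> 4 ^ k * (16 ^ k * (u ^ (3 * k) * m ^ k)) * (m * u) ^ k"
    proof -
      have "(2::real) \<le> 4 ^ k" using k(1) power_increasing[of 1 k "4::real"] by simp
      moreover have "1 \<le> (m * u) ^ k" using mu by simp
      ultimately have "2 * 1 \<le> 4 ^ k * (m * u) ^ k" by (intro mult_mono) auto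
      then have "2 * (16 ^ k * (u ^ (3 * k) * m ^ k)) \<le> (4 ^ k * (m * u) ^ k) * (16 ^ k * (u ^ (3 * k) * m ^ k))"
        using u m by (intro mult_right_mono) auto
      then show ?thesis by (simp add: mult_ac)
    qed
    also have "\<dots> = ((8 * m * u\<^sup>2) ^ k)\<^sup>2"
    proof -
      have "4 ^ k * (16 ^ k * (u ^ (3 * k) * m ^ k)) * (m * u) ^ k = (4 * (16 * (u ^ 3 * m)) * (m * u)) ^ k"
        by (simp only: power_mult_distrib power_mult)
      also have "4 * (16 * (u ^ 3 * m)) * (m * u) = (8 * m * u\<^sup>2)\<^sup>2"
        by (simp add: power2_eq_square power3_eq_cube)
      finally show ?thesis by (simp only: power_mult[symmetric] mult.commute)
    qed
    finally show "X * Y \<le> ((8 * m * u\<^sup>2) ^ k)\<^sup>2" .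
  qed (use m in auto)
  then have "(\<integral>E. diameter (K \<inter> E) ^ k \<partial>\<mu>) \<le> 2 ^ k * (8 * m * u\<^sup>2) ^ k"
    using I by (meson mult_left_mono order_trans zero_le_numeral zero_le_power)
  also have "\<dots> = (2 * (8 * m * u\<^sup>2)) ^ k" by (rule power_mult_distrib[symmetric])
  also have "2 * (8 * m * u\<^sup>2) = 16 * m * u\<^sup>2" by simp
  finally have I': "(\<integral>E. diameter (K \<inter> E) ^ k \<partial>\<mu>) \<le> (16 * m * u\<^sup>2) ^ k" .
  have I0: "0 \<le> (\<integral>E. diameter (K \<inter> E) ^ k \<partial>\<mu>)"
    using K'(3) by (intro Bochner_Integration.integral_nonneg zero_le_power diameter_ge_0) (auto intro: bounded_subset)
  have "(\<integral>E. diameter (K \<inter> E) ^ k \<partial>\<mu>) powr (1 / real k) \<le> ((16 * m * u\<^sup>2) ^ k) powr (1 / real k)"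
    using I' I0 by (intro powr_mono2) auto
  also have "\<dots> = 16 * m * u\<^sup>2"
  proof -
    have "16 * m * u\<^sup>2 > 0" using m u by simp
    from powr_realpow[OF this, of k, symmetric] this show ?thesis using k(1) by (simp only: powr_powr) simp
  qed
  finally show "(\<integral>E. diameter (K \<inter> E) ^ k \<partial>\<mu>) powr (1 / real k)
      \<le> 16 * (\<integral>x. body_norm K x \<partial>\<sigma>) * (\<integral>x. body_norm K x powr (- k0) \<partial>\<sigma>) powr (2 / k0)"
    unfolding m_eq S_eq S_powr .
qed simp

end
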